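(* Let $Y=(Y_1,Y_2)\in\mathcal{L}^2(\Omega,\mathcal{F},\mathbb{P})$ be such that $\nu=\operatorname{Law}(Y)$ is $\mathcal{D}$-regular and the one-dimensional laws of $Y_1$ and $Y_2$ are atomless. Let $G\in\mathfrak{M}$ be a maximizer of $\int\phi_G\,d\nu$ over $\mathfrak{M}$ and set $\phi=\phi_G$. Then $X=D^c\phi(Y)$, i.e. $$X_1=Y_1-\frac{\partial\phi}{\partial y_2}(Y),\qquad X_2=Y_2-\frac{\partial\phi}{\partial y_1}(Y),$$ is the unique optimal map (minimizer of $\mathbb{E}[c(X,Y)]$ over $X\in\mathcal{X}(Y)$), and the law of $(X,Y)$ is the unique optimal plan (minimizer of $\int c\,d\gamma$ over $\gamma\in\Gamma(\nu)$). Moreover, the law of $X$ is $\mathcal{D}$-regular and the laws of $X_1$ and $X_2$ are atomless.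
   Context: $c(x,y)=(x_1-y_1)(x_2-y_2)$ for $x,y\in\mathbb{R}^2$. $\Gamma(\nu)$ is the set of Borel probability measures $\gamma$ on $\mathbb{R}^2\times\mathbb{R}^2$ with finite second moment, $y$-marginal $\nu$, and $\gamma(y|x)=x$ (conditional expectation of $y$ given $x$ under $\gamma$ equals $x$, $\gamma$-a.s.). $\mathcal{X}(Y)$ is the set of two-dimensional $Y$-measurable $X\in\mathcal{L}^2$ with $\mathbb{E}[Y|X]=X$ (random variables equal a.s. are identified). A set $G\subset\mathbb{R}^2$ is monotone if $c(r,s)\ge0$ for $r,s\in G$; maximal monotone if not a proper subset of a monotone set; $\mathfrak{M}$ is the family of maximal monotone sets. $\phi_G(y)=\inf_{x\in G}c(x,y)\in[-\infty,0]$. $\mathcal{D}$ is the family of graphs of strictly decreasing functions $f$ defined on closed intervals of $\mathbb{R}$ (possibly a single point) such that for some $K>0$, $\frac1K(t-s)\le f(s)-f(t)\le K(t-s)$ for $s<t$. A Borel probability measure $\mu$ on $\mathbb{R}^2$ is $\mathcal{D}$-regular if $\mu(D)=0$ for all $D\in\mathcal{D}$. Let $\operatorname{dom}\phi=\{\phi>-\infty\}$ (a convex set). For $y$ in the interior of $\operatorname{dom}\phi$, $\nabla\phi(y)$ is the classical gradient when it exists; for $y$ in the relative boundary of $\operatorname{dom}\phi$ (closure minus relative interior), $\nabla\phi(y)$ is said to exist if $\nabla\phi(y^n)$ converges to a common limit $\nabla\phi(y)$ for every sequence $y^n\to y$ of points of the interior of $\operatorname{dom}\phi$ at which $\phi$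 is differentiable. $\operatorname{dom}\nabla\phi$ is the set of $y\in\operatorname{dom}\phi$ where $\nabla\phi(y)$ exists, and on it $D^c\phi=(D^c_1\phi,D^c_2\phi)$ with $D^c_1\phi(y)=y_1-\frac{\partial\phi}{\partial y_2}(y)$, $D^c_2\phi(y)=y_2-\frac{\partial\phi}{\partial y_1}(y)$. *)

theory Defs
  imports "HOL-Probability.Probability"
begin

type_synonym pt = "real \<times> real"

definition cst :: "pt \<Rightarrow> pt \<Rightarrow> real" where
  "cst x y = (fst x - fst y) * (snd x - snd y)"

definition monotone_set :: "pt set \<Rightarrow> bool" where
  "monotone_set G \<longleftrightarrow> (\<forall>r\<in>G. \<forall>s\<in>G. cst r s \<ge> 0)"

definition maximal_monotone :: "pt set \<Rightarrow> bool" where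
  "maximal_monotone G \<longleftrightarrow> monotone_set G \<and>
     (\<forall>H. monotone_set H \<and> G \<subseteq> H \<longrightarrow> H = G)"

definition phiG :: "pt set \<Rightarrow> pt \<Rightarrow> ereal" where
  "phiG G y = (INF x\<in>G. ereal (cst x y))"

text \<open>Integral of the nonpositive extended-real function phi_G against nu (possibly -infinity).\<close>
definition int_phi :: "pt measure \<Rightarrow> pt set \<Rightarrow> ereal" where
  "int_phi \<nu> G = - enn2ereal (\<integral>\<^sup>+ y. e2ennreal (- phiG G y) \<partial>\<nu>)"

definition D_family :: "pt set set" where
  "D_family = {D. \<exists>a b (f::real \<Rightarrow> real) (K::real). a \<le> b \<and> K > 0 \<and>
      (\<forall>s t. a \<le> s \<and> s < t \<and> t \<le> b \<longrightarrow>
          (t - s) / K \<le> f s - f t \<and> f s - f t \<le> K * (t - s)) \<and>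
      D = (\<lambda>t. (t, f t)) ` {a..b}}"

definition D_regular :: "pt measure \<Rightarrow> bool" where
  "D_regular \<mu> \<longleftrightarrow> (\<forall>D\<in>D_family. emeasure \<mu> D = 0)"

definition atomless :: "real measure \<Rightarrow> bool" where
  "atomless \<mu> \<longleftrightarrow> (\<forall>t. emeasure \<mu> {t} = 0)"

definition dom_phi :: "(pt \<Rightarrow> ereal) \<Rightarrow> pt set" where
  "dom_phi \<phi> = {y. \<phi> y > -\<infinity>}"

definition has_grad :: "(pt \<Rightarrow> ereal) \<Rightarrow> pt \<Rightarrow> pt \<Rightarrow> bool" where
  "has_grad \<phi> y g \<longleftrightarrow>
     (y \<in> interior (dom_phi \<phi>) \<and>
        ((\<lambda>z. real_of_ereal (\<phi> z)) has_derivative (\<lambda>h. g \<bullet> h)) (at y))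
   \<or> (y \<in> closure (dom_phi \<phi>) - rel_interior (dom_phi \<phi>) \<and>
        (\<forall>(ys::nat \<Rightarrow> pt) (gs::nat \<Rightarrow> pt).
           (\<forall>n. ys n \<in> interior (dom_phi \<phi>) \<and>
              ((\<lambda>z. real_of_ereal (\<phi> z)) has_derivative (\<lambda>h. gs n \<bullet> h)) (at (ys n)))
           \<and> ys \<longlonglongrightarrow> y \<longrightarrow> gs \<longlonglongrightarrow> g))"

definition dom_grad :: "(pt \<Rightarrow> ereal) \<Rightarrow> pt set" where
  "dom_grad \<phi> = {y \<in> dom_phi \<phi>. \<exists>!g. has_grad \<phi> y g}"

definition grad :: "(pt \<Rightarrow> ereal) \<Rightarrow> pt \<Rightarrow> pt" where
  "grad \<phi> y = (THE g. has_grad \<phi> y g)"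

definition Dc :: "(pt \<Rightarrow> ereal) \<Rightarrow> pt \<Rightarrow> pt" where
  "Dc \<phi> y = (fst y - snd (grad \<phi> y), snd y - fst (grad \<phi> y))"

definition admissible_maps :: "'a measure \<Rightarrow> ('a \<Rightarrow> pt) \<Rightarrow> ('a \<Rightarrow> pt) set" where
  "admissible_maps M Y = {X. X \<in> measurable (vimage_algebra (space M) Y borel) borel \<and>
      X \<in> borel_measurable M \<and>
      integrable M (\<lambda>\<omega>. (norm (X \<omega>))\<^sup>2) \<and>
      (AE \<omega> in M. real_cond_exp M (vimage_algebra (space M) X borel) (\<lambda>\<omega>. fst (Y \<omega>)) \<omega> = fst (X \<omega>)) \<and>
      (AE \<omega> in M. real_cond_exp M (vimage_algebra (space M) X borel) (\<lambda>\<omega>. snd (Y \<omega>)) \<omega> = snd (X \<omega>))}"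

definition admissible_plans :: "pt measure \<Rightarrow> (pt \<times> pt) measure set" where
  "admissible_plans \<nu> = {\<gamma>. prob_space \<gamma> \<and> sets \<gamma> = sets borel \<and>
      integrable \<gamma> (\<lambda>p. (norm (fst p))\<^sup>2 + (norm (snd p))\<^sup>2) \<and>
      distr \<gamma> borel snd = \<nu> \<and>
      (AE p in \<gamma>. real_cond_exp \<gamma> (vimage_algebra (space \<gamma>) fst borel) (\<lambda>p. fst (snd p)) p = fst (fst p)) \<and>
      (AE p in \<gamma>. real_cond_exp \<gamma> (vimage_algebra (space \<gamma>) fst borel) (\<lambda>p. snd (snd p)) p = snd (fst p))}"

end

theory Submission
  imports Defs
begin

text \<open>On \<open>\<real>\<^sup>2\<close> the function \<open>\<psi> y = y\<^sub>1 y\<^sub>2 - \<phi>\<^sub>G y\<close> is a supremum of affine functions indexed by \<open>G\<close>, so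
  \<open>D\<^sup>c \<phi>\<^sub>G y\<close> is the minimizer of \<open>c(\<cdot>, y)\<close> on \<open>G\<close> wherever that minimizer is unique; non-uniqueness only
  occurs on countably many axis-parallel lines and countably many decreasing bi-Lipschitz graphs.

  The martingale property \<open>E[Y | X] = X\<close> comes from a first variation. Moving \<open>G\<close> along an arbitrary
  continuous, compactly supported vector field \<open>v\<close> gives a curve \<open>{x + \<epsilon> v x}\<close> that need not be
  monotone, but there is always a maximal monotone set \<open>G'\<close> whose \<open>\<phi>\<close> is at least as large: in the
  coordinates \<open>u = x\<^sub>1 + x\<^sub>2\<close>, \<open>w = x\<^sub>2 - x\<^sub>1\<close>, where \<open>4 c = (\<Delta>u)\<^sup>2 - (\<Delta>w)\<^sup>2\<close>, it is the graph of a
  1-Lipschitz selection from the set of all admissible points. Maximality of \<open>G\<close> then gives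
  \<open>E[v\<^sub>1(X)(X\<^sub>2 - Y\<^sub>2) + v\<^sub>2(X)(X\<^sub>1 - Y\<^sub>1)] = 0\<close>.

  Optimality and uniqueness follow from the conditional Jensen inequality
  \<open>E[\<psi>(Y) | X] \<ge> \<psi>(X) \<ge> X\<^sub>1 X\<^sub>2\<close>. For the regularity of the law of \<open>X\<close>, an atom at \<open>x \<in> G\<close> would confine
  \<open>Y\<close> to a half-plane bounded by a line through \<open>x\<close> of nonpositive slope; the mean of \<open>Y\<close> on the atom
  being \<open>x\<close>, \<open>Y\<close> would be concentrated on that line.\<close>

subsection \<open>Maximal monotone sets\<close>

text \<open>Why the selection exists: on a segment, c(., y) is the convex combination of its end
  values minus t(1-t) c(z, z'), so the admissible points contain the segment between any two of them
  with c(z, z') \<le> 0. In the coordinates (u, w) their sections over each u are therefore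
  intervals, compact because \<phi> of the moved curve is finite somewhere. The only obstruction to
  a 1-Lipschitz selection is a pair of levels whose sections differ by more than the distance of the
  levels. Such a gap would persist at all pairs of levels further apart, but far out the curve is
  unmoved, hence 1-Lipschitz.

  Domination bounds the perturbed \<phi> only from below, so one field gives an inequality; v and -v
  together give the identity. Square integrability of X is not known beforehand; compactly supported
  fields keep every integral finite until it has been derived.

  Since X must be Y-measurable as a function and not just almost everywhere, \<open>Dc\<close> has
  to be Borel on the whole plane, including the boundary of the domain and the points where the
  gradient is only an arbitrary value of \<open>THE\<close>.\<close>

lemma cst_commute: "cst x y = cst y x"
  by (simp add: cst_def algebra_simps)

lemma cst_sum_diff:
  "4 * cst x z = ((fst x + snd x) - (fst z + snd z))\<^sup>2 - ((snd x - fst x) - (snd z - fst z))\<^sup>2"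
  by (simp add: cst_def power2_eq_square algebra_simps)

lemma continuous_on_cst [continuous_intros]:
  assumes "continuous_on A f" "continuous_on A h"
  shows "continuous_on A (\<lambda>t. cst (f t) (h t))"
  unfolding cst_def by (intro continuous_intros assms)

lemma monotone_set_insert:
  assumes "monotone_set G" "\<And>z. z \<in> G \<Longrightarrow> cst x z \<ge> 0"
  shows "monotone_set (insert x G)"
proof -
  have "cst x x = 0" by (simp add: cst_def)
  then show ?thesis using assms cst_commute unfolding monotone_set_def by (smt (verit) insert_iff)
qed

lemma maximal_monotone_mem_iff:
  assumes "maximal_monotone G"
  shows "x \<in> G \<longleftrightarrow> (\<forall>z\<in>G. cst x z \<ge> 0)"
proof
  show "x \<in> G \<Longrightarrow> \<forall>z\<in>G. cst x z \<ge> 0"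
    using assms unfolding maximal_monotone_def monotone_set_def by blast
next
  assume "\<forall>z\<in>G. cst x z \<ge> 0"
  then have "monotone_set (insert x G)"
    using assms monotone_set_insert unfolding maximal_monotone_def by blast
  then have "insert x G = G" using assms unfolding maximal_monotone_def by blast
  then show "x \<in> G" by blast
qed

text \<open>In the coordinates u, w a monotone set is the graph of a 1-Lipschitz function over a set
  of u-values. Once every u occurs, a further point would share its u with a point of
  \<open>G\<close>, and there 4c = -(\<Delta>w)^2.\<close>

lemma monotone_set_surj_sum_imp_maximal:
  assumes mono: "monotone_set G" and surj: "\<And>u. \<exists>x\<in>G. fst x + snd x = u"
  shows "maximal_monotone G"
  unfolding maximal_monotone_def
proof (intro conjI allI impI mono)
  fix H assume H: "monotone_set H \<and> G \<subseteq> H"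
  have "x \<in> G" if x: "x \<in> H" for x
  proof -
    obtain z where z: "z \<in> G" "fst z + snd z = fst x + snd x" using surj by blast
    then have "cst x z \<ge> 0" using H x unfolding monotone_set_def by blast
    moreover have "((fst x + snd x) - (fst z + snd z))\<^sup>2 = 0" using z(2) by simp
    ultimately have "((snd x - fst x) - (snd z - fst z))\<^sup>2 \<le> 0"
      using cst_sum_diff[of x z] by linarith
    then have "snd x - fst x = snd z - fst z" by simp
    with z(2) have "fst x = fst z" "snd x = snd z" by linarith+
    then have "x = z" by (simp add: prod_eq_iff)
    then show ?thesis using z by simp
  qed
  then show "H = G" using H by blast
qed

lemma abs_fst_snd_le_norm: "\<bar>fst h\<bar> \<le> norm h" "\<bar>snd h\<bar> \<le> norm h" for h :: pt
  using norm_fst_le[of "fst h" "snd h"] norm_snd_le[of "snd h" "fst h"] by auto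

locale max_monotone =
  fixes G :: "pt set"
  assumes maximal: "maximal_monotone G"
begin

lemmas mem_iff = maximal_monotone_mem_iff[OF maximal]

lemma cst_nonneg: "x \<in> G \<Longrightarrow> z \<in> G \<Longrightarrow> cst x z \<ge> 0"
  using mem_iff by blast

lemma ordered:
  assumes "x \<in> G" "z \<in> G"
  shows "fst x \<le> fst z \<and> snd x \<le> snd z \<or> fst z \<le> fst x \<and> snd z \<le> snd x"
  using cst_nonneg[OF assms] unfolding cst_def by (auto simp: zero_le_mult_iff)

lemma closed_G: "closed G"
proof -
  have "G = (\<Inter>z\<in>G. {x. cst x z \<ge> 0})" using mem_iff by blast
  moreover have "closed (\<Inter>z\<in>G. {x. cst x z \<ge> 0})"
    by (intro closed_INT ballI closed_Collect_le continuous_intros)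
  ultimately show ?thesis by simp
qed

lemma nonempty: "G \<noteq> {}"
proof
  assume "G = {}"
  then have "0 \<in> G" using mem_iff[of 0] by blast
  then show False using \<open>G = {}\<close> by simp
qed

lemma diff_le_sum:
  assumes "x \<in> G" "z \<in> G"
  shows "\<bar>(snd x - fst x) - (snd z - fst z)\<bar> \<le> \<bar>(fst x + snd x) - (fst z + snd z)\<bar>"
  using cst_nonneg[OF assms] cst_sum_diff[of x z] by (simp add: abs_le_square_iff)

text \<open>One-point extension of a 1-Lipschitz function: the bounds \<open>lo\<close> and
  \<open>hi\<close> that the points of \<open>G\<close> impose on the value at u are compatible, and
  any value between them gives a point that maximality puts into \<open>G\<close>.\<close>

lemma ex_sum: "\<exists>x\<in>G. fst x + snd x = u"
proof -
  define lo where "lo x = (snd x - fst x) - \<bar>u - (fst x + snd x)\<bar>" for x :: pt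
  define hi where "hi x = (snd x - fst x) + \<bar>u - (fst x + snd x)\<bar>" for x :: pt
  have lohi: "lo x \<le> hi z" if "x \<in> G" "z \<in> G" for x z
    using diff_le_sum[OF that] unfolding lo_def hi_def by linarith
  obtain z0 where z0: "z0 \<in> G" using nonempty by blast
  define w where "w = (SUP x\<in>G. lo x)"
  have bdd: "bdd_above (lo ` G)" using lohi[OF _ z0] by (intro bdd_aboveI2)
  have w: "lo x \<le> w" "w \<le> hi x" if "x \<in> G" for x
    unfolding w_def by (intro cSUP_upper cSUP_least that bdd lohi nonempty; simp)+
  let ?x = "((u - w) / 2, (u + w) / 2)"
  have s: "fst ?x + snd ?x = u" "snd ?x - fst ?x = w" by (auto simp: field_simps)
  have "cst ?x z \<ge> 0" if "z \<in> G" for z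
  proof -
    have "\<bar>w - (snd z - fst z)\<bar> \<le> \<bar>u - (fst z + snd z)\<bar>"
      using w[OF that] unfolding lo_def hi_def by linarith
    then have "(w - (snd z - fst z))\<^sup>2 \<le> (u - (fst z + snd z))\<^sup>2" by (simp add: abs_le_square_iff)
    then show ?thesis using cst_sum_diff[of ?x z] unfolding s by linarith
  qed
  then have "?x \<in> G" using mem_iff by blast
  then show ?thesis using s by blast
qed

lemma sum_inj:
  assumes "x \<in> G" "z \<in> G" "fst x + snd x = fst z + snd z"
  shows "x = z"
  using diff_le_sum[OF assms(1,2)] assms(3) by (simp add: prod_eq_iff)

text \<open>Minty parametrization of a maximal monotone set, the inverse of x \<mapsto> x1 + x2 on
  \<open>G\<close>. Its values at rational u later serve as a countable dense family in
  \<open>G\<close>.\<close>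

definition g :: "real \<Rightarrow> pt" where
  "g u = (THE x. x \<in> G \<and> fst x + snd x = u)"

lemma g_props: "g u \<in> G \<and> fst (g u) + snd (g u) = u"
  unfolding g_def
proof (rule theI')
  show "\<exists>!x. x \<in> G \<and> fst x + snd x = u" using ex_sum[of u] sum_inj by metis
qed

lemma g_in [simp]: "g u \<in> G" and g_sum: "fst (g u) + snd (g u) = u"
  using g_props by auto

lemma g_of_sum: "x \<in> G \<Longrightarrow> g (fst x + snd x) = x"
  using sum_inj g_props by blast

lemma g_mono:
  assumes "u \<le> v"
  shows "fst (g u) \<le> fst (g v)" "snd (g u) \<le> snd (g v)"
  using ordered[of "g u" "g v"] g_sum[of u] g_sum[of v] assms by (auto; linarith)+

text \<open>Both components are nondecreasing and their increments add up to that of u, so neither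
  exceeds it.\<close>

lemma continuous_g: "continuous_on UNIV g"
proof -
  have a: "\<bar>fst (g u) - fst (g v)\<bar> \<le> 1 * \<bar>u - v\<bar>" "\<bar>snd (g u) - snd (g v)\<bar> \<le> 1 * \<bar>u - v\<bar>" for u v
    using g_mono[of u v] g_mono[of v u] g_sum[of u] g_sum[of v] by (cases "u \<le> v"; simp)+
  have "1-lipschitz_on UNIV (\<lambda>u. fst (g u))" "1-lipschitz_on UNIV (\<lambda>u. snd (g u))"
    using a by (auto simp: lipschitz_on_def dist_real_def)
  then have "continuous_on UNIV (\<lambda>u. (fst (g u), snd (g u)))"
    by (intro continuous_intros lipschitz_on_continuous_on)
  then show ?thesis by simp
qed

text \<open>The source of \<phi> \<le> 0: a point outside \<open>G\<close> must violate monotonicity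
  with some point of \<open>G\<close>.\<close>

lemma ex_cst_nonpos: "\<exists>x\<in>G. cst x y \<le> 0"
proof (cases "y \<in> G")
  case True then show ?thesis by (intro bexI[of _ y]) (auto simp: cst_def)
next
  case False then show ?thesis using mem_iff[of y] cst_commute by (metis linorder_not_le order_less_imp_le)
qed

subsection \<open>Minimizers\<close>

text \<open>The working form of the interior of the effective domain (\<open>interior_dom\<close>).
  Points s, r of \<open>G\<close> on both sides of y give the coercivity that replaces compactness
  of \<open>G\<close>.\<close>

definition core :: "pt set" where
  "core = {y. \<exists>s\<in>G. \<exists>r\<in>G. fst s < fst y \<and> snd s < snd y \<and> fst y < fst r \<and> snd y < snd r}"

definition argm :: "pt \<Rightarrow> pt \<Rightarrow> bool" where
  "argm y x \<longleftrightarrow> x \<in> G \<and> (\<forall>z\<in>G. cst x y \<le> cst z y)"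

lemma argm_in: "argm y x \<Longrightarrow> x \<in> G" unfolding argm_def by simp

lemma argm_le: "argm y x \<Longrightarrow> z \<in> G \<Longrightarrow> cst x y \<le> cst z y" unfolding argm_def by simp

lemma argm_phi: "argm y x \<Longrightarrow> phiG G y = ereal (cst x y)"
  unfolding argm_def phiG_def by (intro antisym INF_lower INF_greatest) auto

lemma argm_nonpos: "argm y x \<Longrightarrow> cst x y \<le> 0"
  using ex_cst_nonpos[of y] argm_le[of y x] by force

text \<open>\<open>G\<close> is totally ordered componentwise, so its points outside the box lie
  beyond r or before s, where both factors of c have the same sign and are at least as large as
  those of the corner.\<close>

lemma cst_outside_box:
  assumes "s \<in> G" "r \<in> G" "x \<in> G"
    and "fst s < fst y" "snd s < snd y" "fst y < fst r" "snd y < snd r"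
    and "x \<notin> {fst s..fst r} \<times> {snd s..snd r}"
  shows "cst x y \<ge> min ((fst y - fst s) * (snd y - snd s)) ((fst r - fst y) * (snd r - snd y))"
proof -
  consider "fst r \<le> fst x" "snd r \<le> snd x" | "fst x \<le> fst s" "snd x \<le> snd s"
    using ordered[OF assms(3,1)] ordered[OF assms(3,2)] assms(8)
    by (cases x) force
  then show ?thesis
  proof cases
    case 1
    then have "(fst r - fst y) * (snd r - snd y) \<le> cst x y"
      unfolding cst_def using assms by (intro mult_mono) auto
    then show ?thesis by simp
  next
    case 2
    then have "(fst y - fst s) * (snd y - snd s) \<le> (fst y - fst x) * (snd y - snd x)"
      using assms by (intro mult_mono) auto
    also have "\<dots> = cst x y" unfolding cst_def by (simp add: algebra_simps)
    finally show ?thesis by simp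
  qed
qed

lemma cst_outside_box_pos:
  assumes "s \<in> G" "r \<in> G" "x \<in> G"
    and "fst s < fst y" "snd s < snd y" "fst y < fst r" "snd y < snd r"
    and "x \<notin> {fst s..fst r} \<times> {snd s..snd r}"
  shows "cst x y > 0"
  using cst_outside_box[OF assms] assms(4-7) by (smt (verit) mult_pos_pos min_def)

lemma compact_box: "K \<subseteq> G \<Longrightarrow> closed K \<Longrightarrow> compact (K \<inter> {a..b} \<times> {c..d})" for K :: "pt set" and a b c d :: real
  by (intro closed_Int_compact compact_Times) auto

lemma ex_argm:
  assumes "y \<in> core"
  shows "\<exists>x. argm y x"
proof -
  obtain s r where sr: "s \<in> G" "r \<in> G" "fst s < fst y" "snd s < snd y" "fst y < fst r" "snd y < snd r"
    using assms unfolding core_def by blast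
  let ?B = "{fst s..fst r} \<times> {snd s..snd r}"
  obtain p where p: "p \<in> G" "cst p y \<le> 0" using ex_cst_nonpos by blast
  then have pB: "p \<in> G \<inter> ?B" using cst_outside_box_pos[OF sr(1,2) p(1) sr(3-6)] by fastforce
  have "continuous_on (G \<inter> ?B) (\<lambda>x. cst x y)" by (intro continuous_intros)
  then obtain x where x: "x \<in> G \<inter> ?B" "\<forall>z\<in>G \<inter> ?B. cst x y \<le> cst z y"
    using continuous_attains_inf[of "G \<inter> ?B" "\<lambda>x. cst x y"] compact_box[OF subset_refl closed_G] pB by blast
  have "cst x y \<le> cst z y" if "z \<in> G" for z
  proof (cases "z \<in> ?B")
    case False
    have "cst x y \<le> cst p y" using x(2) pB by blast
    then show ?thesis using p cst_outside_box_pos[OF sr(1,2) that sr(3-6) False] by linarith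
  qed (use x(2) that in blast)
  then show ?thesis using x unfolding argm_def by blast
qed

text \<open>Inside the box the minimum over \<open>K\<close> is attained and exceeds the minimum
  over \<open>G\<close>; outside, c is at least the positive corner value while the minimum over
  \<open>G\<close> is nonpositive.\<close>

lemma argm_gap:
  assumes y: "y \<in> core" and x: "argm y x" and K: "closed K" "K \<subseteq> G" "\<And>z. z \<in> K \<Longrightarrow> \<not> argm y z"
  obtains \<kappa> where "\<kappa> > 0" "\<And>z. z \<in> K \<Longrightarrow> cst z y \<ge> cst x y + \<kappa>"
proof -
  obtain s r where sr: "s \<in> G" "r \<in> G" "fst s < fst y" "snd s < snd y" "fst y < fst r" "snd y < snd r"
    using y unfolding core_def by blast
  let ?B = "{fst s..fst r} \<times> {snd s..snd r}"
  define m where "m = min ((fst y - fst s) * (snd y - snd s)) ((fst r - fst y) * (snd r - snd y))"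
  have m: "m > 0" unfolding m_def using sr by simp
  have out: "cst z y \<ge> cst x y + m" if "z \<in> K" "z \<notin> ?B" for z
    using cst_outside_box[OF sr(1,2) _ sr(3-6) that(2)] that K argm_nonpos[OF x] unfolding m_def by fastforce
  show ?thesis
  proof (cases "K \<inter> ?B = {}")
    case True
    then show ?thesis using m out that[of m] by blast
  next
    case False
    have "continuous_on (K \<inter> ?B) (\<lambda>x. cst x y)" by (intro continuous_intros)
    then obtain p where p: "p \<in> K \<inter> ?B" "\<forall>z\<in>K \<inter> ?B. cst p y \<le> cst z y"
      using continuous_attains_inf[of "K \<inter> ?B" "\<lambda>x. cst x y"] compact_box[OF K(2,1)] False by blast
    have "\<not> argm y p" using K p by blast
    then obtain q where "q \<in> G" "cst q y < cst p y" using p K unfolding argm_def by force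
    then have d: "cst x y < cst p y" using argm_le[OF x] by fastforce
    let ?k = "min m (cst p y - cst x y)"
    have "cst z y \<ge> cst x y + ?k" if "z \<in> K" for z
      using p(2) that out[OF that] by (cases "z \<in> ?B") force+
    then show ?thesis using m d that[of ?k] by simp
  qed
qed

lemma open_core: "open core"
proof -
  have "core = (\<Union>s\<in>G. \<Union>r\<in>G. {fst s<..<fst r} \<times> {snd s<..<snd r})"
    unfolding core_def by force
  then show ?thesis by (auto intro!: open_UN open_Times)
qed

end

subsection \<open>Lipschitz selections and the domination of general curves\<close>

text \<open>Pairs with |\<Delta>u| \<le> |\<Delta>w| are those with c \<le> 0 once
  \<open>rot\<close> leads back to the original coordinates. Taking z, z' over the same u shows that
  sections are convex.\<close>

definition steep_closed :: "pt set \<Rightarrow> bool" where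
  "steep_closed T \<longleftrightarrow> (\<forall>z\<in>T. \<forall>z'\<in>T. \<bar>fst z - fst z'\<bar> \<le> \<bar>snd z - snd z'\<bar> \<longrightarrow> closed_segment z z' \<subseteq> T)"

lemma steep_closed_point:
  fixes u w :: real
  assumes "steep_closed T" "(a, b) \<in> T" "(a', b') \<in> T" "\<bar>a - a'\<bar> \<le> \<bar>b - b'\<bar>"
    and "0 \<le> t" "t \<le> 1" "u = (1 - t) * a + t * a'" "w = (1 - t) * b + t * b'"
  shows "(u, w) \<in> T"
proof -
  have "(u, w) \<in> closed_segment (a, b) (a', b')"
    using assms(5-8) unfolding in_segment by (intro exI[of _ t]) auto
  then show ?thesis using assms(1-4) unfolding steep_closed_def by fastforce
qed

lemma steep_closed_vertical:
  fixes u w :: real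
  assumes "steep_closed T" "(u, b) \<in> T" "(u, b') \<in> T" "b \<le> w" "w \<le> b'"
  shows "(u, w) \<in> T"
proof (cases "b = b'")
  case False
  then have "b < b'" using assms by simp
  define t where "t = (w - b) / (b' - b)"
  have "t * (b' - b) = w - b" using \<open>b < b'\<close> unfolding t_def by simp
  moreover have "0 \<le> t" "t \<le> 1" using \<open>b < b'\<close> assms(4,5) unfolding t_def by auto
  ultimately show ?thesis
    by (intro steep_closed_point[OF assms(1-3), where t = t]) (auto simp: algebra_simps)
qed (use assms in auto)

text \<open>Axiomatizes the set of admissible points in the coordinates (u, w). The linear growth
  bound makes the part over a bounded range of u compact.\<close>

locale steep_sections =
  fixes T :: "pt set" and A :: real
  assumes closed_T: "closed T" and steep: "steep_closed T"
    and level: "\<And>u. \<exists>w. (u, w) \<in> T"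
    and bound: "\<And>u w. (u, w) \<in> T \<Longrightarrow> \<bar>w\<bar> \<le> A + \<bar>u\<bar>"
begin

lemma compact_slab:
  assumes "closed C"
  shows "compact (T \<inter> C \<inter> {p. a \<le> fst p \<and> fst p \<le> b})"
proof -
  have cl: "closed (T \<inter> C \<inter> {p. a \<le> fst p \<and> fst p \<le> b})"
    by (intro closed_Int closed_T assms closed_Collect_conj closed_Collect_le continuous_intros)
  have eq: "T \<inter> C \<inter> {p. a \<le> fst p \<and> fst p \<le> b} = ({a..b} \<times> {- (A + \<bar>a\<bar> + \<bar>b\<bar>)..A + \<bar>a\<bar> + \<bar>b\<bar>}) \<inter> (T \<inter> C \<inter> {p. a \<le> fst p \<and> fst p \<le> b})"
    using bound by fastforce
  have cp: "compact ({a..b} \<times> {- (A + \<bar>a\<bar> + \<bar>b\<bar>)..A + \<bar>a\<bar> + \<bar>b\<bar>})"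
    by (intro compact_Times) auto
  show ?thesis by (subst eq) (rule compact_Int_closed[OF cp cl])
qed

lemma fst_cont: "continuous_on X (fst :: pt \<Rightarrow> real)"
  using continuous_on_fst[OF continuous_on_id] by simp

text \<open>Walking away from \<open>(q, b)\<close>, the sections cannot re-enter the light cone of \<open>(q, b)\<close>: at the
  first level where they do, a boundary point of the cone lies in \<open>T\<close>, and the segment joining it to
  \<open>(q, b)\<close> would put a boundary point into the section at \<open>u0\<close>.\<close>

lemma above_cone_left:
  assumes Q: "(q, b) \<in> T" and u0: "u0 < q" and above: "\<And>w. (u0, w) \<in> T \<Longrightarrow> w > b + (q - u0)"
    and u1: "u1 \<le> u0" "(u1, w1) \<in> T"
  shows "w1 > b + (q - u1)"
proof (rule ccontr)
  assume "\<not> ?thesis"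
  then have w1: "w1 \<le> b + (q - u1)" by simp
  define C where "C = T \<inter> {p. snd p \<le> b + (q - fst p)} \<inter> {p. u1 \<le> fst p \<and> fst p \<le> u0}"
  have "compact C" unfolding C_def by (intro compact_slab closed_Collect_le continuous_intros)
  moreover have "C \<noteq> {}" using u1 w1 unfolding C_def by force
  ultimately obtain p where p: "p \<in> C" "\<forall>z\<in>C. fst z \<le> fst p"
    using continuous_attains_sup[of C fst, OF _ _ fst_cont] by blast
  define \<alpha> where "\<alpha> = fst p"
  have pT: "(\<alpha>, snd p) \<in> T" "snd p \<le> b + (q - \<alpha>)" "u1 \<le> \<alpha>" "\<alpha> \<le> u0"
    using p unfolding C_def \<alpha>_def by auto
  \<comment> \<open>\<open>\<alpha>\<close> is the last level with a point on or below the edge w =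
    b + (q - u), and \<open>D\<close> collects the points on or above it at levels from
    \<open>\<alpha>\<close> to \<open>u0\<close>. A level strictly between \<open>\<alpha>\<close>
    and the first level of \<open>D\<close> would have a point in neither set, so these two levels
    agree and convexity of the section yields an edge point.\<close>
  define D where "D = T \<inter> {p. snd p \<ge> b + (q - fst p)} \<inter> {p. \<alpha> \<le> fst p \<and> fst p \<le> u0}"
  have "compact D" unfolding D_def by (intro compact_slab closed_Collect_le continuous_intros)
  moreover have "D \<noteq> {}" using level[of u0] above pT unfolding D_def by force
  ultimately obtain d where d: "d \<in> D" "\<forall>z\<in>D. fst d \<le> fst z"
    using continuous_attains_inf[of D fst, OF _ _ fst_cont] by blast
  have dT: "(fst d, snd d) \<in> T" "snd d \<ge> b + (q - fst d)" "\<alpha> \<le> fst d" "fst d \<le> u0"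
    using d unfolding D_def by auto
  have "fst d = \<alpha>"
  proof (rule ccontr)
    assume "fst d \<noteq> \<alpha>"
    then have lt: "\<alpha> < fst d" using dT by simp
    define v where "v = (\<alpha> + fst d) / 2"
    have v: "\<alpha> < v" "v < fst d" using lt unfolding v_def by auto
    obtain w where w: "(v, w) \<in> T" using level by blast
    have "(v, w) \<in> C \<or> (v, w) \<in> D" using w v pT dT unfolding C_def D_def by auto
    then show False using p(2) d(2) v unfolding \<alpha>_def by force
  qed
  then have m: "(\<alpha>, b + (q - \<alpha>)) \<in> T"
    using steep_closed_vertical[OF steep pT(1)] dT pT by metis
  define t where "t = (u0 - \<alpha>) / (q - \<alpha>)"
  have t: "t * (q - \<alpha>) = u0 - \<alpha>" "0 \<le> t" "t \<le> 1" using pT(4) u0 unfolding t_def by auto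
  have "(u0, b + (q - u0)) \<in> T"
  proof (rule steep_closed_point[OF steep m Q])
    show "u0 = (1 - t) * \<alpha> + t * q" "b + (q - u0) = (1 - t) * (b + (q - \<alpha>)) + t * b"
      using t(1) by (auto simp: algebra_simps)
  qed (use t in auto)
  then show False using above by force
qed

end

lemma steep_closed_reflect:
  assumes "steep_closed T" "\<bar>\<sigma>\<bar> = 1" "\<bar>\<tau>\<bar> = 1"
  shows "steep_closed {p. (\<sigma> * fst p, \<tau> * snd p) \<in> T}"
  unfolding steep_closed_def
proof (intro ballI impI subsetI)
  fix z z' p :: pt
  assume *: "z \<in> {p. (\<sigma> * fst p, \<tau> * snd p) \<in> T}" "z' \<in> {p. (\<sigma> * fst p, \<tau> * snd p) \<in> T}"
    "\<bar>fst z - fst z'\<bar> \<le> \<bar>snd z - snd z'\<bar>" "p \<in> closed_segment z z'"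
  then obtain t where t: "0 \<le> t" "t \<le> 1" "p = (1 - t) *\<^sub>R z + t *\<^sub>R z'" unfolding in_segment by blast
  have "\<bar>\<sigma> * fst z - \<sigma> * fst z'\<bar> \<le> \<bar>\<tau> * snd z - \<tau> * snd z'\<bar>"
    using *(3) assms(2,3) by (simp flip: right_diff_distrib add: abs_mult)
  moreover have "\<sigma> * fst p = (1 - t) * (\<sigma> * fst z) + t * (\<sigma> * fst z')"
    "\<tau> * snd p = (1 - t) * (\<tau> * snd z) + t * (\<tau> * snd z')"
    unfolding t(3) by (simp_all add: algebra_simps)
  ultimately have "(\<sigma> * fst p, \<tau> * snd p) \<in> T"
    using steep_closed_point[OF assms(1) _ _ _ t(1,2)] *(1,2) by blast
  then show "p \<in> {p. (\<sigma> * fst p, \<tau> * snd p) \<in> T}" by simp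
qed

text \<open>The cone lemma is stated for one direction only; sign changes of u and w transfer it to
  the other directions.\<close>

lemma steep_sections_reflect:
  assumes "steep_sections T A" "\<bar>\<sigma>\<bar> = 1" "\<bar>\<tau>\<bar> = 1"
  shows "steep_sections {p. (\<sigma> * fst p, \<tau> * snd p) \<in> T} A"
proof -
  interpret steep_sections T A by fact
  have sq: "\<sigma> * \<sigma> = 1" "\<tau> * \<tau> = 1" using assms(2,3) by (metis abs_mult_self_eq mult_1)+
  show ?thesis
  proof
    have "{p. (\<sigma> * fst p, \<tau> * snd p) \<in> T} = (\<lambda>p. (\<sigma> * fst p, \<tau> * snd p)) -` T" by auto
    then show "closed {p. (\<sigma> * fst p, \<tau> * snd p) \<in> T}"
      using continuous_closed_vimage[OF closed_T, of "\<lambda>p. (\<sigma> * fst p, \<tau> * snd p)"]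
      by (simp add: continuous_intros)
    show "steep_closed {p. (\<sigma> * fst p, \<tau> * snd p) \<in> T}" by (rule steep_closed_reflect[OF steep assms(2,3)])
    show "\<exists>w. (u, w) \<in> {p. (\<sigma> * fst p, \<tau> * snd p) \<in> T}" for u
    proof -
      obtain w where "(\<sigma> * u, w) \<in> T" using level by blast
      then have "(u, \<tau> * w) \<in> {p. (\<sigma> * fst p, \<tau> * snd p) \<in> T}"
        using sq by (simp flip: mult.assoc)
      then show ?thesis by blast
    qed
    show "\<bar>w\<bar> \<le> A + \<bar>u\<bar>" if "(u, w) \<in> {p. (\<sigma> * fst p, \<tau> * snd p) \<in> T}" for u w
      using bound[of "\<sigma> * u" "\<tau> * w"] that assms(2,3) by (simp add: abs_mult)
  qed
qed

text \<open>A drop steeper than slope 1 between the sections at u and u' is pushed outwards: by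
  \<open>above_cone_left\<close> to every level left of u, then after a point reflection to every
  level right of u'. Far enough out it contradicts \<open>far\<close>.\<close>

lemma (in steep_sections) no_descending_gap:
  assumes far: "\<And>u u'. u \<le> - L \<Longrightarrow> L \<le> u' \<Longrightarrow> \<exists>w w'. (u, w) \<in> T \<and> (u', w') \<in> T \<and> w \<le> w' + (u' - u)"
    and "u < u'"
  shows "\<exists>w w'. (u, w) \<in> T \<and> (u', w') \<in> T \<and> w \<le> w' + (u' - u)"
proof (rule ccontr)
  assume "\<not> ?thesis"
  then have gap: "w > w' + (u' - u)" if "(u, w) \<in> T" "(u', w') \<in> T" for w w'
    using that by (meson not_le_imp_less)
  have left: "w1 > w' + (u' - u1)" if "u1 \<le> u" "(u1, w1) \<in> T" "(u', w') \<in> T" for u1 w1 w'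
    using above_cone_left[OF that(3) assms(2) gap[OF _ that(3)] that(1,2)] by blast
  interpret R: steep_sections "{p. (- 1 * fst p, - 1 * snd p) \<in> T}" A
    by (rule steep_sections_reflect[OF steep_sections_axioms]) auto
  have right: "w1 > w2 + (u2 - u1)" if "u1 \<le> u" "(u1, w1) \<in> T" "u' \<le> u2" "(u2, w2) \<in> T" for u1 w1 u2 w2
  proof -
    have "- w2 > - w1 + (- u1 - - u2)"
    proof (rule R.above_cone_left[where ?u0.0 = "- u'"])
      have "- w > - w1 + (- u1 - - u')" if "(u', w) \<in> T" for w
        using left[OF \<open>u1 \<le> u\<close> \<open>(u1, w1) \<in> T\<close> that] by simp
      then show "w > - w1 + (- u1 - - u')" if "(- u', w) \<in> {p. (- 1 * fst p, - 1 * snd p) \<in> T}" for w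
        using that by force
    qed (use that assms(2) in auto)
    then show ?thesis by simp
  qed
  obtain w w' where "(min u (- L), w) \<in> T" "(max u' L, w') \<in> T" "w \<le> w' + (max u' L - min u (- L))"
    using far[of "min u (- L)" "max u' L"] by auto
  then show False using right[of "min u (- L)" w "max u' L" w'] by simp
qed

text \<open>What a selection requires is \<open>lo u \<le> hi v + \<bar>u - v\<bar>\<close> for all
  u, v, which is the absence of gaps in both directions; the ascending case is the descending one
  for the set reflected in u.\<close>

theorem steep_sections_selection:
  assumes "steep_sections T A"
    and far: "\<And>u u'. u \<le> - L \<Longrightarrow> L \<le> u' \<Longrightarrow> \<exists>w w'. (u, w) \<in> T \<and> (u', w') \<in> T \<and> \<bar>w - w'\<bar> \<le> u' - u"
  obtains f where "\<And>u. (u, f u) \<in> T" "\<And>u v. \<bar>f u - f v\<bar> \<le> \<bar>u - v\<bar>"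
proof -
  interpret steep_sections T A by fact
  interpret R: steep_sections "{p. (- 1 * fst p, 1 * snd p) \<in> T}" A
    by (rule steep_sections_reflect[OF assms(1)]) auto
  have desc: "\<exists>w w'. (u, w) \<in> T \<and> (u', w') \<in> T \<and> w \<le> w' + (u' - u)" if "u < u'" for u u'
  proof (rule no_descending_gap[OF _ that, of L])
    fix v v' assume "v \<le> - L" "L \<le> v'"
    then obtain w w' where "(v, w) \<in> T" "(v', w') \<in> T" "\<bar>w - w'\<bar> \<le> v' - v" using far by blast
    then show "\<exists>w w'. (v, w) \<in> T \<and> (v', w') \<in> T \<and> w \<le> w' + (v' - v)" by (intro exI[of _ w] exI[of _ w']) auto
  qed
  have farR: "\<exists>w w'. (u, w) \<in> {p. (- 1 * fst p, 1 * snd p) \<in> T} \<and> (u', w') \<in> {p. (- 1 * fst p, 1 * snd p) \<in> T} \<and> w \<le> w' + (u' - u)"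
    if "u \<le> - L" "L \<le> u'" for u u'
  proof -
    have "- u' \<le> - L" "L \<le> - u" using that by auto
    from far[OF this] obtain w w' where "(- u', w) \<in> T" "(- u, w') \<in> T" "\<bar>w - w'\<bar> \<le> - u - - u'" by blast
    then show ?thesis by (intro exI[of _ w] exI[of _ w']) auto
  qed
  have asc: "\<exists>w w'. (u, w) \<in> T \<and> (u', w') \<in> T \<and> w \<le> w' + (u - u')" if "u' < u" for u u'
  proof -
    have "- u < - u'" using that by simp
    from R.no_descending_gap[OF farR this] show ?thesis by auto
  qed
  have cpt: "compact {w. (u, w) \<in> T}" for u
  proof -
    have "{w. (u, w) \<in> T} = snd ` (T \<inter> UNIV \<inter> {p. u \<le> fst p \<and> fst p \<le> u})" by force
    then show ?thesis using compact_slab[of UNIV u u]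
      by (simp add: compact_continuous_image continuous_on_snd)
  qed
  define hi where "hi u = Sup {w. (u, w) \<in> T}" for u
  define lo where "lo u = Inf {w. (u, w) \<in> T}" for u
  have ne: "{w. (u, w) \<in> T} \<noteq> {}" for u using level by blast
  have hi: "(u, hi u) \<in> T" "(u, w) \<in> T \<Longrightarrow> w \<le> hi u" for u w
    using closed_contains_Sup[OF ne _ compact_imp_closed[OF cpt]] cpt[of u] unfolding hi_def
    by (auto intro!: cSup_upper simp: compact_imp_bounded bounded_imp_bdd_above)
  have lo: "(u, lo u) \<in> T" "(u, w) \<in> T \<Longrightarrow> lo u \<le> w" for u w
    using closed_contains_Inf[OF ne _ compact_imp_closed[OF cpt]] cpt[of u] unfolding lo_def
    by (auto intro!: cInf_lower simp: compact_imp_bounded bounded_imp_bdd_below)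
  have key: "lo u \<le> hi v + \<bar>u - v\<bar>" for u v
  proof (cases u v rule: linorder_cases)
    case less
    then obtain w w' where "(u, w) \<in> T" "(v, w') \<in> T" "w \<le> w' + (v - u)" using desc by blast
    then show ?thesis using lo(2)[of u w] hi(2)[of v w'] by linarith
  next
    case equal
    then show ?thesis using lo(2)[OF hi(1)] by simp
  next
    case greater
    then obtain w w' where "(u, w) \<in> T" "(v, w') \<in> T" "w \<le> w' + (u - v)" using asc by blast
    then show ?thesis using lo(2)[of u w] hi(2)[of v w'] by linarith
  qed
  \<comment> \<open>Inf-convolution of \<open>hi\<close> with the absolute value, the largest
    1-Lipschitz function below \<open>hi\<close>; \<open>key\<close> keeps it above
    \<open>lo\<close>.\<close>
  define f where "f u = (INF v. hi v + \<bar>u - v\<bar>)" for u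
  have bdd: "bdd_below (range (\<lambda>v. hi v + \<bar>u - v\<bar>))" for u using key by (intro bdd_belowI2)
  have f_le: "f u \<le> hi v + \<bar>u - v\<bar>" for u v unfolding f_def by (rule cINF_lower[OF bdd]) simp
  have "lo u \<le> f u" for u unfolding f_def by (rule cINF_greatest) (use key in auto)
  then have "(u, f u) \<in> T" for u
    using steep_closed_vertical[OF steep lo(1)[of u] hi(1)[of u]] f_le[of u u] by simp
  moreover have "f u - \<bar>u - v\<bar> \<le> f v" for u v
    unfolding f_def[of v]
  proof (rule cINF_greatest)
    show "f u - \<bar>u - v\<bar> \<le> hi x + \<bar>v - x\<bar>" for x using f_le[of u x] by linarith
  qed simp
  then have "\<bar>f u - f v\<bar> \<le> \<bar>u - v\<bar>" for u v by (smt (verit))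
  ultimately show ?thesis by (rule that)
qed

text \<open>c is a quadratic form in x - y, so its defect from the convex combination is that form
  at z - z'. The sign of this defect is what singles out steep segments.\<close>

lemma cst_segment:
  "cst ((1 - t) *\<^sub>R z + t *\<^sub>R z') y = (1 - t) * cst z y + t * cst z' y - t * (1 - t) * cst z z'"
  by (simp add: cst_def algebra_simps)

text \<open>A rotation by 45 degrees scaled by 1/sqrt 2: the inverse of x \<mapsto> (x1 + x2, x2 -
  x1), as \<open>rot_inverse\<close> records.\<close>

definition rot :: "pt \<Rightarrow> pt" where
  "rot p = ((fst p - snd p) / 2, (fst p + snd p) / 2)"

lemma cst_rot: "4 * cst (rot p) (rot q) = (fst p - fst q)\<^sup>2 - (snd p - snd q)\<^sup>2"
  unfolding cst_sum_diff rot_def by (simp add: diff_divide_distrib add_divide_distrib)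

lemma rot_sum_diff: "fst (rot p) + snd (rot p) = fst p" "snd (rot p) - fst (rot p) = snd p"
  by (auto simp: rot_def field_simps)

lemma rot_inverse: "rot (fst x + snd x, snd x - fst x) = x"
  by (simp add: rot_def prod_eq_iff)

lemma phiG_upper: "x \<in> H \<Longrightarrow> phiG H y \<le> ereal (cst x y)"
  unfolding phiG_def by (rule INF_lower)

lemma phiG_greatest: "(\<And>x. x \<in> H \<Longrightarrow> c \<le> ereal (cst x y)) \<Longrightarrow> c \<le> phiG H y"
  unfolding phiG_def by (rule INF_greatest)

text \<open>\<open>S\<close> holds all points that can join \<open>H\<close> without lowering its
  \<phi> anywhere. It contains \<open>H\<close>, \<open>fin\<close> bounds its sections, and
  \<open>far\<close> ties it at infinity to \<open>G\<close>, which is 1-Lipschitz in u and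
  w.\<close>

theorem (in max_monotone) ex_maximal_monotone_dominating:
  assumes sums: "\<And>u. \<exists>x\<in>H. fst x + snd x = u"
    and far: "\<And>u. L \<le> \<bar>u\<bar> \<Longrightarrow> g u \<in> H"
    and fin: "phiG H y0 > - \<infinity>"
  shows "\<exists>G'. maximal_monotone G' \<and> (\<forall>y. phiG H y \<le> phiG G' y)"
proof -
  define S where "S = {x. \<forall>y. phiG H y \<le> ereal (cst x y)}"
  have HS: "H \<subseteq> S" unfolding S_def using phiG_upper by blast
  define T where "T = {p. rot p \<in> S}"
  have inT: "(fst x + snd x, snd x - fst x) \<in> T" if "x \<in> S" for x
    using that rot_inverse unfolding T_def by simp
  obtain c0 where c0: "phiG H y0 \<ge> ereal c0"
    using fin by (metis ereal_dense2 order_less_imp_le)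
  \<comment> \<open>Admissibility tested at \<open>y0\<close> alone gives (\<Delta>w)^2 \<le>
    (\<Delta>u)^2 + 4|c0|, hence |\<Delta>w| \<le> |\<Delta>u| + 2 sqrt |c0|. The first two summands
    recentre this at the origin.\<close>
  define A where "A = \<bar>fst y0 + snd y0\<bar> + \<bar>snd y0 - fst y0\<bar> + 2 * sqrt \<bar>c0\<bar>"
  have "steep_sections T A"
  proof
    have eq: "T = (\<Inter>y. {p. phiG H y \<le> ereal (cst (rot p) y)})" unfolding T_def S_def by auto
    have "closed {p. phiG H y \<le> ereal (cst (rot p) y)}" for y
      unfolding rot_def cst_def by (intro closed_Collect_le continuous_intros) auto
    then show "closed T" unfolding eq by blast
    show "steep_closed T" unfolding steep_closed_def
    proof (intro ballI impI subsetI)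
      fix z z' p assume z: "z \<in> T" "z' \<in> T" "\<bar>fst z - fst z'\<bar> \<le> \<bar>snd z - snd z'\<bar>" "p \<in> closed_segment z z'"
      then obtain t where t: "0 \<le> t" "t \<le> 1" "p = (1 - t) *\<^sub>R z + t *\<^sub>R z'" unfolding in_segment by blast
      have rp: "rot p = (1 - t) *\<^sub>R rot z + t *\<^sub>R rot z'"
        unfolding t rot_def by (simp add: prod_eq_iff algebra_simps diff_divide_distrib add_divide_distrib)
      have "(fst z - fst z')\<^sup>2 \<le> (snd z - snd z')\<^sup>2" using z(3) by (simp add: abs_le_square_iff)
      then have le: "cst (rot z) (rot z') \<le> 0" using cst_rot[of z z'] by linarith
      have "phiG H y \<le> ereal (cst (rot p) y)" for y
      proof -
        have b: "phiG H y \<le> ereal (cst (rot z) y)" "phiG H y \<le> ereal (cst (rot z') y)"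
          using z unfolding T_def S_def by blast+
        show ?thesis
        proof (cases "phiG H y")
          case (real r)
          then have "r \<le> cst (rot z) y" "r \<le> cst (rot z') y" using b by auto
          then have "(1 - t) * r + t * r \<le> (1 - t) * cst (rot z) y + t * cst (rot z') y"
            using t by (intro add_mono mult_left_mono) auto
          moreover have "t * (1 - t) * cst (rot z) (rot z') \<le> 0"
            using t le by (intro mult_nonneg_nonpos) auto
          ultimately show ?thesis unfolding rp cst_segment real by (simp add: algebra_simps)
        qed (use b in auto)
      qed
      then show "p \<in> T" unfolding T_def S_def by blast
    qed
    show "\<exists>w. (u, w) \<in> T" for u using sums[of u] HS inT by blast
    show "\<bar>w\<bar> \<le> A + \<bar>u\<bar>" if "(u, w) \<in> T" for u w
    proof -
      have "ereal c0 \<le> ereal (cst (rot (u, w)) y0)" using that c0 order_trans unfolding T_def S_def mem_Collect_eq by blast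
      then have "4 * c0 \<le> (u - (fst y0 + snd y0))\<^sup>2 - (w - (snd y0 - fst y0))\<^sup>2"
        using cst_sum_diff[of "rot (u, w)" y0] by (simp add: rot_sum_diff)
      moreover have "4 * \<bar>c0\<bar> = (2 * sqrt \<bar>c0\<bar>)\<^sup>2" by (simp add: power_mult_distrib)
      ultimately have "(w - (snd y0 - fst y0))\<^sup>2 \<le> \<bar>u - (fst y0 + snd y0)\<bar>\<^sup>2 + (2 * sqrt \<bar>c0\<bar>)\<^sup>2"
        by (simp only: power2_abs)
      also have "\<dots> \<le> (\<bar>u - (fst y0 + snd y0)\<bar> + 2 * sqrt \<bar>c0\<bar>)\<^sup>2"
        unfolding power2_sum by simp
      finally have "\<bar>w - (snd y0 - fst y0)\<bar> \<le> \<bar>u - (fst y0 + snd y0)\<bar> + 2 * sqrt \<bar>c0\<bar>"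
        by (metis abs_le_square_iff abs_of_nonneg add_nonneg_nonneg abs_ge_zero real_sqrt_ge_zero
            mult_nonneg_nonneg zero_le_numeral power2_abs)
      then show ?thesis unfolding A_def by linarith
    qed
  qed
  \<comment> \<open>The maximum with 0 ensures u \<le> u' also when \<open>L\<close> is
    negative.\<close>
  moreover have "\<exists>w w'. (u, w) \<in> T \<and> (u', w') \<in> T \<and> \<bar>w - w'\<bar> \<le> u' - u"
    if "u \<le> - max L 0" "max L 0 \<le> u'" for u u'
  proof -
    have "g u \<in> S" "g u' \<in> S" using far[of u] far[of u'] that HS by auto
    then have "(u, snd (g u) - fst (g u)) \<in> T" "(u', snd (g u') - fst (g u')) \<in> T"
      using inT[of "g u"] inT[of "g u'"] by (auto simp: g_sum)
    moreover have "\<bar>(snd (g u) - fst (g u)) - (snd (g u') - fst (g u'))\<bar> \<le> u' - u"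
      using diff_le_sum[of "g u" "g u'"] that by (simp add: g_sum)
    ultimately show ?thesis by blast
  qed
  ultimately obtain f where f: "\<And>u. (u, f u) \<in> T" "\<And>u v. \<bar>f u - f v\<bar> \<le> \<bar>u - v\<bar>"
    using steep_sections_selection[of T A "max L 0"] by blast
  define G' where "G' = range (\<lambda>u. rot (u, f u))"
  have "cst (rot (u, f u)) (rot (v, f v)) \<ge> 0" for u v
    using cst_rot[of "(u, f u)" "(v, f v)"] f(2)[of u v] by (simp add: abs_le_square_iff)
  then have "monotone_set G'" unfolding G'_def monotone_set_def by blast
  moreover have "\<exists>x\<in>G'. fst x + snd x = u" for u
    unfolding G'_def using rot_sum_diff[of "(u, f u)"] by auto
  ultimately have "maximal_monotone G'" by (rule monotone_set_surj_sum_imp_maximal)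
  moreover have "phiG H y \<le> phiG G' y" for y
  proof -
    have "phiG H y \<le> ereal (cst (rot (u, f u)) y)" for u
      using f(1)[of u] unfolding T_def S_def mem_Collect_eq by blast
    then show ?thesis unfolding G'_def by (intro phiG_greatest, elim rangeE) simp
  qed
  ultimately show ?thesis by blast
qed

subsection \<open>The effective domain\<close>

text \<open>Symmetries of c. The effective domain is studied at its right edge only; the swap, the
  negation and their composition carry the result to the other three edges.\<close>

locale cst_involution =
  fixes \<tau> :: "pt \<Rightarrow> pt"
  assumes inv: "\<tau> (\<tau> x) = x" and iso: "cst (\<tau> x) (\<tau> y) = cst x y"
begin

lemma maximal_monotone_image:
  assumes "maximal_monotone G"
  shows "maximal_monotone (\<tau> ` G)"
proof -
  have mono: "monotone_set (\<tau> ` H)" if "monotone_set H" for H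
    using that iso unfolding monotone_set_def by auto
  show ?thesis unfolding maximal_monotone_def
  proof (intro conjI allI impI)
    show "monotone_set (\<tau> ` G)" using assms mono unfolding maximal_monotone_def by blast
    fix H assume H: "monotone_set H \<and> \<tau> ` G \<subseteq> H"
    have "G \<subseteq> \<tau> ` H" 
    proof
      fix x assume "x \<in> G"
      then have "\<tau> x \<in> H" using H by blast
      then show "x \<in> \<tau> ` H" using inv by (metis imageI)
    qed
    then have "\<tau> ` H = G" using H mono assms unfolding maximal_monotone_def by blast
    then have "\<tau> ` (\<tau> ` H) = \<tau> ` G" by simp
    then show "H = \<tau> ` G" by (simp add: image_image inv)
  qed
qed

lemma phiG_image: "phiG (\<tau> ` G) (\<tau> y) = phiG G y"
  unfolding phiG_def by (simp add: image_image iso)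

end

lemma phiG_eq_MInf:
  assumes "\<And>B. \<exists>x\<in>H. cst x y < B"
  shows "phiG H y = - \<infinity>"
proof (rule ereal_bot)
  fix B
  obtain x where x: "x \<in> H" "cst x y < B" using assms by blast
  have "phiG H y \<le> ereal (cst x y)" using x(1) by (rule phiG_upper)
  also have "\<dots> \<le> ereal B" using x(2) by simp
  finally show "phiG H y \<le> ereal B" .
qed

lemma countable_subsingleton:
  fixes D :: "'a::linorder set"
  assumes "\<And>s t. s \<in> D \<Longrightarrow> t \<in> D \<Longrightarrow> \<not> s < t"
  shows "countable D"
proof (cases "D = {}")
  case False
  then obtain t where "t \<in> D" by blast
  then have "D \<subseteq> {t}" using assms by (metis linorder_neqE singletonI subsetI)
  then show ?thesis by (rule countable_subset) simp
qed simp

context max_monotone begin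

text \<open>Maximality makes a set bounded on the right unbounded upwards, for otherwise the corner
  (b + 1, N) could be adjoined. Points of \<open>G\<close> far above y, yet at least fst y - b to
  its left, drive c to minus infinity.\<close>

lemma phi_right_of_bound:
  assumes bd: "\<And>x. x \<in> G \<Longrightarrow> fst x \<le> b" and y: "b < fst y"
  shows "phiG G y = - \<infinity>"
proof -
  have up: "\<exists>x\<in>G. snd x > N" for N
  proof (rule ccontr)
    assume "\<not> ?thesis"
    then have N: "snd x \<le> N" if "x \<in> G" for x using that by force
    have "cst (b + 1, N) x \<ge> 0" if "x \<in> G" for x
      using bd[OF that] N[OF that] unfolding cst_def by (intro mult_nonneg_nonneg) auto
    then have "(b + 1, N) \<in> G" using mem_iff by blast
    then show False using bd by fastforce
  qed
  have "\<exists>x\<in>G. cst x y < B" for B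
  proof -
    \<comment> \<open>The height at which the horizontal gap fst y - b times the vertical gap
      exceeds |B| + 1.\<close>
    obtain x where x: "x \<in> G" "snd x > snd y + (\<bar>B\<bar> + 1) / (fst y - b)" using up by blast
    have "(\<bar>B\<bar> + 1) / (fst y - b) > 0" using y by simp
    then have d: "snd x - snd y > 0" using x by linarith
    have "cst x y \<le> (b - fst y) * (snd x - snd y)"
      unfolding cst_def using bd[OF x(1)] d by (intro mult_right_mono) auto
    also have "\<dots> < (b - fst y) * ((\<bar>B\<bar> + 1) / (fst y - b))"
      using x(2) y by (intro mult_strict_left_mono_neg) auto
    also have "\<dots> = - (\<bar>B\<bar> + 1)" using y by (simp add: field_simps)
    finally show ?thesis using x(1) by (intro bexI[of _ x]) auto
  qed
  then show ?thesis by (rule phiG_eq_MInf)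
qed

interpretation swap: cst_involution prod.swap
  by standard (auto simp: cst_def)

interpretation neg: cst_involution "\<lambda>x. - x"
  by standard (auto simp: cst_def algebra_simps)

interpretation negswap: cst_involution "\<lambda>x. - prod.swap x"
  by standard (auto simp: cst_def algebra_simps)

lemma phi_beyond_bound:
  shows "(\<And>x. x \<in> G \<Longrightarrow> snd x \<le> b) \<Longrightarrow> b < snd y \<Longrightarrow> phiG G y = - \<infinity>"
    and "(\<And>x. x \<in> G \<Longrightarrow> b \<le> fst x) \<Longrightarrow> fst y < b \<Longrightarrow> phiG G y = - \<infinity>"
    and "(\<And>x. x \<in> G \<Longrightarrow> b \<le> snd x) \<Longrightarrow> snd y < b \<Longrightarrow> phiG G y = - \<infinity>"
proof -
  interpret S: max_monotone "prod.swap ` G" by standard (rule swap.maximal_monotone_image[OF maximal])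
  interpret N: max_monotone "(\<lambda>x. - x) ` G" by standard (rule neg.maximal_monotone_image[OF maximal])
  interpret NS: max_monotone "(\<lambda>x. - prod.swap x) ` G" by standard (rule negswap.maximal_monotone_image[OF maximal])
  show "(\<And>x. x \<in> G \<Longrightarrow> snd x \<le> b) \<Longrightarrow> b < snd y \<Longrightarrow> phiG G y = - \<infinity>"
    using S.phi_right_of_bound[of b "prod.swap y"] by (force simp: swap.phiG_image)
  show "(\<And>x. x \<in> G \<Longrightarrow> b \<le> fst x) \<Longrightarrow> fst y < b \<Longrightarrow> phiG G y = - \<infinity>"
    using N.phi_right_of_bound[of "- b" "- y"] by (force simp: neg.phiG_image)
  show "(\<And>x. x \<in> G \<Longrightarrow> b \<le> snd x) \<Longrightarrow> snd y < b \<Longrightarrow> phiG G y = - \<infinity>"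
    using NS.phi_right_of_bound[of "- b" "- prod.swap y"] by (force simp: negswap.phiG_image)
qed

text \<open>\<open>G\<close> being ordered, a point to the right of y and a point above y can both
  be replaced by the larger of the two. So leaving \<open>core\<close> means being blocked in one of
  the four axis directions.\<close>

lemma not_core_cases:
  assumes "y \<notin> core"
  obtains (right) "\<And>x. x \<in> G \<Longrightarrow> fst x \<le> fst y" | (above) "\<And>x. x \<in> G \<Longrightarrow> snd x \<le> snd y"
    | (left) "\<And>x. x \<in> G \<Longrightarrow> fst y \<le> fst x" | (below) "\<And>x. x \<in> G \<Longrightarrow> snd y \<le> snd x"
proof (rule ccontr)
  assume no: "\<not> thesis"
  obtain p where p: "p \<in> G" "fst p > fst y" using right no by (meson linorder_not_le)
  obtain q where q: "q \<in> G" "snd q > snd y" using above no by (meson linorder_not_le)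
  obtain p' where p': "p' \<in> G" "fst p' < fst y" using left no by (meson linorder_not_le)
  obtain q' where q': "q' \<in> G" "snd q' < snd y" using below no by (meson linorder_not_le)
  have "\<exists>r\<in>G. fst y < fst r \<and> snd y < snd r"
    using ordered[OF p(1) q(1)] p q by (meson order_less_le_trans)
  moreover have "\<exists>s\<in>G. fst s < fst y \<and> snd s < snd y"
    using ordered[OF p'(1) q'(1)] p' q' by (meson order_le_less_trans)
  ultimately have "y \<in> core" unfolding core_def by blast
  then show False using assms by blast
qed

text \<open>Each of \<open>C1\<close> to \<open>C4\<close> holds at most one number, the supremum or
  infimum of a coordinate over \<open>G\<close>. Outside \<open>core\<close>, \<phi> can be finite
  only on these at most four lines, which atomless marginals do not charge.\<close>

lemma dom_minus_core:
  "\<exists>C. countable C \<and> (\<forall>y. y \<in> dom_phi (phiG G) \<longrightarrow> y \<in> core \<or> fst y \<in> C \<or> snd y \<in> C)"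
proof -
  define C1 where "C1 = {t. (\<forall>x\<in>G. fst x \<le> t) \<and> (\<forall>b<t. \<exists>x\<in>G. b < fst x)}"
  define C2 where "C2 = {t. (\<forall>x\<in>G. snd x \<le> t) \<and> (\<forall>b<t. \<exists>x\<in>G. b < snd x)}"
  define C3 where "C3 = {t. (\<forall>x\<in>G. t \<le> fst x) \<and> (\<forall>b>t. \<exists>x\<in>G. fst x < b)}"
  define C4 where "C4 = {t. (\<forall>x\<in>G. t \<le> snd x) \<and> (\<forall>b>t. \<exists>x\<in>G. snd x < b)}"
  have "countable (C1 \<union> C2 \<union> C3 \<union> C4)"
    by (intro countable_Un countable_subsingleton) (unfold C1_def C2_def C3_def C4_def mem_Collect_eq, (blast dest: leD)+)
  moreover have "y \<in> core \<or> fst y \<in> C1 \<union> C2 \<union> C3 \<union> C4 \<or> snd y \<in> C1 \<union> C2 \<union> C3 \<union> C4"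
    if y: "y \<in> dom_phi (phiG G)" for y
  proof (cases "y \<in> core")
    case False
    have fin: "phiG G y \<noteq> - \<infinity>" using y unfolding dom_phi_def by auto
    from False show ?thesis
    proof (cases rule: not_core_cases)
      case right
      have "\<exists>x\<in>G. b < fst x" if "b < fst y" for b
        using phi_right_of_bound[OF _ that] fin by (meson linorder_not_le)
      with right have "fst y \<in> C1" unfolding C1_def by blast
      then show ?thesis by blast
    next
      case above
      have "\<exists>x\<in>G. b < snd x" if "b < snd y" for b
        using phi_beyond_bound(1)[OF _ that] fin by (meson linorder_not_le)
      with above have "snd y \<in> C2" unfolding C2_def by blast
      then show ?thesis by blast
    next
      case left
      have "\<exists>x\<in>G. fst x < b" if "fst y < b" for b
        using phi_beyond_bound(2)[OF _ that] fin by (meson linorder_not_le)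
      with left have "fst y \<in> C3" unfolding C3_def by blast
      then show ?thesis by blast
    next
      case below
      have "\<exists>x\<in>G. snd x < b" if "snd y < b" for b
        using phi_beyond_bound(3)[OF _ that] fin by (meson linorder_not_le)
      with below have "snd y \<in> C4" unfolding C4_def by blast
      then show ?thesis by blast
    qed
  qed simp
  ultimately show ?thesis by blast
qed

lemma phi_core_finite: "y \<in> core \<Longrightarrow> phiG G y > - \<infinity>"
  using ex_argm[of y] argm_phi by fastforce

lemma interior_dom: "interior (dom_phi (phiG G)) = core"
proof
  show "core \<subseteq> interior (dom_phi (phiG G))"
    using phi_core_finite by (intro interior_maximal open_core) (auto simp: dom_phi_def)
  show "interior (dom_phi (phiG G)) \<subseteq> core"
  proof
    fix y assume "y \<in> interior (dom_phi (phiG G))"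
    then obtain e where e: "e > 0" "ball y e \<subseteq> dom_phi (phiG G)" using mem_interior by blast
    have d: "phiG G (y + h) \<noteq> - \<infinity>" if "norm h < e" for h
    proof -
      have "y + h \<in> ball y e" using that by (simp add: dist_norm)
      then show ?thesis using e unfolding dom_phi_def by auto
    qed
    show "y \<in> core"
    proof (rule ccontr)
      assume "y \<notin> core"
      then show False
      proof (cases rule: not_core_cases)
        case right then show False using d[of "(e / 2, 0)"] e phi_right_of_bound[of "fst y" "y + (e / 2, 0)"] by (simp add: norm_Pair)
      next
        case above then show False using d[of "(0, e / 2)"] e phi_beyond_bound(1)[of "snd y" "y + (0, e / 2)"] by (simp add: norm_Pair)
      next
        case left then show False using d[of "(- e / 2, 0)"] e phi_beyond_bound(2)[of "fst y" "y + (- e / 2, 0)"] by (simp add: norm_Pair)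
      next
        case below then show False using d[of "(0, - e / 2)"] e phi_beyond_bound(3)[of "snd y" "y + (0, - e / 2)"] by (simp add: norm_Pair)
      qed
    qed
  qed
qed

subsection \<open>Differentiability and uniqueness of minimizers\<close>

lemma argm_in_box:
  assumes "argm y x" "s \<in> G" "r \<in> G" "fst s < fst y" "snd s < snd y" "fst y < fst r" "snd y < snd r"
  shows "fst s \<le> fst x" "snd s \<le> snd x" "fst x \<le> fst r" "snd x \<le> snd r"
proof -
  have "x \<in> {fst s..fst r} \<times> {snd s..snd r}"
    using cst_outside_box_pos[OF assms(2,3) argm_in[OF assms(1)] assms(4-7)] argm_nonpos[OF assms(1)] by fastforce
  then show "fst s \<le> fst x" "snd s \<le> snd x" "fst x \<le> fst r" "snd x \<le> snd r" by (cases x, auto)+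
qed

text \<open>Minimizers at nearby z stay in the box spanned by s and r, where all c(x', .) share a
  Lipschitz constant near y. Comparing z with y costs at most \<open>2 * C * dist z y\<close>, less
  than the gap \<open>\<kappa>\<close> that \<open>argm_gap\<close> gives off the ball around
  x.\<close>

lemma argm_continuous:
  assumes y: "y \<in> core" "argm y x" "\<And>x'. argm y x' \<Longrightarrow> x' = x" and e: "e > 0"
  shows "\<exists>d>0. \<forall>z. dist z y < d \<longrightarrow> z \<in> core \<and> (\<forall>x'. argm z x' \<longrightarrow> dist x' x < e)"
proof -
  obtain s r where sr: "s \<in> G" "r \<in> G" "fst s < fst y" "snd s < snd y" "fst y < fst r" "snd y < snd r"
    using y unfolding core_def by blast
  have cl: "closed (G - ball x e)" using closed_G by (simp add: closed_Diff)
  have no: "\<not> argm y z" if "z \<in> G - ball x e" for z using that y(3)[of z] e by auto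
  obtain \<kappa> where \<kappa>: "\<kappa> > 0" "\<And>z. z \<in> G - ball x e \<Longrightarrow> cst z y \<ge> cst x y + \<kappa>"
    by (rule argm_gap[OF y(1,2) cl _ no]) (simp_all add: Diff_subset)
  \<comment> \<open>The side lengths of the box, plus 1 for the displacement of z from y.\<close>
  define C where "C = (fst r - fst s) + (snd r - snd s) + 1"
  have C: "C > 0" using sr unfolding C_def by simp
  have lip: "\<bar>cst x' z - cst x' y\<bar> \<le> C * dist z y"
    if "fst s \<le> fst x'" "snd s \<le> snd x'" "fst x' \<le> fst r" "snd x' \<le> snd r" "dist z y < 1" for x' z
  proof -
    let ?n = "norm (z - y)"
    have n: "\<bar>fst z - fst y\<bar> \<le> ?n" "\<bar>snd z - snd y\<bar> \<le> ?n" using abs_fst_snd_le_norm[of "z - y"] by auto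
    have n1: "?n < 1" using that by (simp add: dist_norm)
    have "cst x' z - cst x' y = (fst x' - fst z) * (snd y - snd z) + (fst y - fst z) * (snd x' - snd y)"
      by (simp add: cst_def algebra_simps)
    also have "\<bar>\<dots>\<bar> \<le> \<bar>fst x' - fst z\<bar> * \<bar>snd y - snd z\<bar> + \<bar>fst y - fst z\<bar> * \<bar>snd x' - snd y\<bar>"
      by (metis abs_mult abs_triangle_ineq)
    also have "\<dots> \<le> (fst r - fst s + 1) * ?n + ?n * (snd r - snd s)"
      using that sr n n1 by (intro add_mono mult_mono) auto
    also have "\<dots> = C * dist z y" unfolding C_def dist_norm by (simp add: algebra_simps)
    finally show ?thesis .
  qed
  define d0 where "d0 = min (min (fst y - fst s) (snd y - snd s)) (min (fst r - fst y) (snd r - snd y))"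
  have "d0 > 0" using sr unfolding d0_def by simp
  have d0: "fst s < fst z \<and> snd s < snd z \<and> fst z < fst r \<and> snd z < snd r" if "dist z y < d0" for z
    using sr abs_fst_snd_le_norm[of "z - y"] that unfolding d0_def dist_norm by auto
  define d where "d = min (min d0 1) (\<kappa> / (2 * C))"
  have "z \<in> core \<and> (\<forall>x'. argm z x' \<longrightarrow> dist x' x < e)" if z: "dist z y < d" for z
  proof (intro conjI allI impI)
    have zb: "fst s < fst z" "snd s < snd z" "fst z < fst r" "snd z < snd r" using d0[of z] z unfolding d_def by auto
    then show "z \<in> core" unfolding core_def using sr by blast
    fix x' assume x': "argm z x'"
    have "cst x' y \<le> cst x' z + C * dist z y"
      using lip[OF argm_in_box[OF x' sr(1,2) zb], of z] z unfolding d_def by auto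
    also have "cst x' z \<le> cst x z" using argm_le[OF x'] argm_in[OF y(2)] .
    also have "cst x z \<le> cst x y + C * dist z y"
      using lip[OF argm_in_box[OF y(2) sr], of z] z unfolding d_def by auto
    finally have "cst x' y \<le> cst x y + 2 * C * dist z y" by simp
    also have "\<dots> < cst x y + \<kappa>" using z C unfolding d_def by (simp add: field_simps)
    finally have "x' \<in> ball x e" using \<kappa>(2)[of x'] argm_in[OF x'] by force
    then show "dist x' x < e" by (simp add: dist_commute)
  qed
  moreover have "d > 0" unfolding d_def using \<open>d0 > 0\<close> \<kappa> C by simp
  ultimately show ?thesis by blast
qed

lemma cst_has_derivative:
  "((\<lambda>z. cst x z) has_derivative (\<lambda>h. (snd y - snd x, fst y - fst x) \<bullet> h)) (at y)"
  unfolding cst_def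
  by (auto intro!: derivative_eq_intros simp: inner_prod_def algebra_simps)

lemma argm_phi_real: "argm y x \<Longrightarrow> real_of_ereal (phiG G y) = cst x y"
  by (simp add: argm_phi)

text \<open>Envelope argument: c(x, .) touches \<phi> from above at y, so the difference has a local
  minimum there and the gradients agree. As the gradient determines x, differentiability forces a
  unique minimizer.\<close>

lemma derivative_imp_argm:
  assumes y: "y \<in> core" "argm y x"
    and D: "((\<lambda>z. real_of_ereal (phiG G z)) has_derivative (\<lambda>h. v \<bullet> h)) (at y)"
  shows "v = (snd y - snd x, fst y - fst x)"
proof -
  let ?w = "(snd y - snd x, fst y - fst x)"
  have "((\<lambda>z. cst x z - real_of_ereal (phiG G z)) has_derivative (\<lambda>h. ?w \<bullet> h - v \<bullet> h)) (at y)"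
    by (intro derivative_intros cst_has_derivative D)
  moreover have "\<forall>\<^sub>F z in at y. cst x y - real_of_ereal (phiG G y) \<le> cst x z - real_of_ereal (phiG G z)"
  proof -
    have "\<forall>\<^sub>F z in at y. z \<in> core" using open_core y(1) by (rule eventually_at_in_open')
    then show ?thesis
    proof eventually_elim
      case (elim z)
      then obtain x' where x': "argm z x'" using ex_argm by blast
      show ?case using argm_le[OF x' argm_in[OF y(2)]] by (simp add: argm_phi_real[OF x'] argm_phi_real[OF y(2)])
    qed
  qed
  ultimately have "(\<lambda>h. ?w \<bullet> h - v \<bullet> h) = (\<lambda>h. 0)" by (rule has_derivative_local_min)
  then have "?w \<bullet> (?w - v) - v \<bullet> (?w - v) = 0" by meson
  then have "(?w - v) \<bullet> (?w - v) = 0" by (simp add: inner_diff_left)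
  then show ?thesis by simp
qed

text \<open>c(x', z) is bounded above by using x as a competitor at z, and below by using x' as a
  competitor at y. The bounds differ by terms of size |x' - x| |z - y|, small by
  \<open>argm_continuous\<close>; the product of the two components of z - y is of second
  order.\<close>

lemma argm_unique_imp_derivative:
  assumes y: "y \<in> core" "argm y x" "\<And>x'. argm y x' \<Longrightarrow> x' = x"
  shows "((\<lambda>z. real_of_ereal (phiG G z)) has_derivative (\<lambda>h. (snd y - snd x, fst y - fst x) \<bullet> h)) (at y)"
  unfolding has_derivative_at_alt
proof (intro conjI allI impI)
  show "bounded_linear (\<lambda>h. (snd y - snd x, fst y - fst x) \<bullet> h)" by (rule bounded_linear_inner_right)
  fix e :: real assume e: "0 < e"
  let ?w = "(snd y - snd x, fst y - fst x)"
  obtain d where d: "d > 0" "\<And>z. dist z y < d \<Longrightarrow> z \<in> core \<and> (\<forall>x'. argm z x' \<longrightarrow> dist x' x < e / 4)"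
    using argm_continuous[OF y, of "e / 4"] e by auto
  have "norm (real_of_ereal (phiG G z) - real_of_ereal (phiG G y) - ?w \<bullet> (z - y)) \<le> e * norm (z - y)"
    if z: "norm (z - y) < min d (e / 4)" for z
  proof -
    let ?n = "norm (z - y)" and ?h = "z - y"
    obtain x' where x': "argm z x'" "dist x' x < e / 4"
      using d(2)[of z] z ex_argm[of z] by (auto simp: dist_norm)
    have n: "\<bar>fst ?h\<bar> \<le> ?n" "\<bar>snd ?h\<bar> \<le> ?n" by (rule abs_fst_snd_le_norm)+
    have m: "\<bar>fst (x' - x)\<bar> \<le> e / 4" "\<bar>snd (x' - x)\<bar> \<le> e / 4"
      using abs_fst_snd_le_norm[of "x' - x"] x'(2) by (auto simp: dist_norm)
    have q: "\<bar>fst ?h * snd ?h\<bar> \<le> (e / 4) * ?n"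
      unfolding abs_mult using n z by (intro mult_mono) auto
    have a1: "cst x' z \<le> cst x y + ?w \<bullet> ?h + fst ?h * snd ?h"
      using argm_le[OF x'(1) argm_in[OF y(2)]] by (simp add: cst_def inner_prod_def algebra_simps)
    have a2: "cst x' z \<ge> cst x y + ?w \<bullet> ?h + fst ?h * snd ?h - snd (x' - x) * fst ?h - fst (x' - x) * snd ?h"
      using argm_le[OF y(2) argm_in[OF x'(1)]] by (simp add: cst_def inner_prod_def algebra_simps)
    have b: "\<bar>snd (x' - x) * fst ?h\<bar> \<le> (e / 4) * ?n" "\<bar>fst (x' - x) * snd ?h\<bar> \<le> (e / 4) * ?n"
      unfolding abs_mult using n m e by (intro mult_mono; linarith)+
    have "\<bar>cst x' z - cst x y - ?w \<bullet> ?h\<bar> \<le> e * ?n"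
      using a1 a2 b q by linarith
    then show ?thesis by (simp add: argm_phi_real[OF x'(1)] argm_phi_real[OF y(2)])
  qed
  then show "\<exists>d>0. \<forall>z. norm (z - y) < d \<longrightarrow>
      norm (real_of_ereal (phiG G z) - real_of_ereal (phiG G y) - ?w \<bullet> (z - y)) \<le> e * norm (z - y)"
    using d e by (intro exI[of _ "min d (e / 4)"]) auto
qed

text \<open>By \<open>core_derivative_iff\<close>, the differentiability points in the interior of
  the domain. \<open>dom_grad\<close> may contain boundary points as well, but \<nu>-almost every y
  lies in \<open>uniq\<close> (\<open>AE_uniq\<close>).\<close>

definition uniq :: "pt set" where
  "uniq = {y \<in> core. \<exists>!x. argm y x}"

definition tmap :: "pt \<Rightarrow> pt" where
  "tmap y = (THE x. argm y x)"

lemma argm_tmap: "y \<in> uniq \<Longrightarrow> argm y (tmap y)"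
  unfolding uniq_def tmap_def by (auto intro: theI')

lemma tmap_unique: "y \<in> uniq \<Longrightarrow> argm y x \<Longrightarrow> x = tmap y"
  unfolding uniq_def tmap_def by (auto simp: the1_equality)

lemma core_derivative_iff:
  assumes "y \<in> core"
  shows "((\<lambda>z. real_of_ereal (phiG G z)) has_derivative (\<lambda>h. v \<bullet> h)) (at y) \<longleftrightarrow>
    y \<in> uniq \<and> v = (snd y - snd (tmap y), fst y - fst (tmap y))"
proof
  assume D: "((\<lambda>z. real_of_ereal (phiG G z)) has_derivative (\<lambda>h. v \<bullet> h)) (at y)"
  have "x = (fst y - snd v, snd y - fst v)" if "argm y x" for x
    using derivative_imp_argm[OF assms that D] by simp
  then have "y \<in> uniq" unfolding uniq_def using ex_argm[OF assms] assms by blast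
  then show "y \<in> uniq \<and> v = (snd y - snd (tmap y), fst y - fst (tmap y))"
    using derivative_imp_argm[OF assms argm_tmap D] by blast
next
  assume "y \<in> uniq \<and> v = (snd y - snd (tmap y), fst y - fst (tmap y))"
  then show "((\<lambda>z. real_of_ereal (phiG G z)) has_derivative (\<lambda>h. v \<bullet> h)) (at y)"
    using argm_unique_imp_derivative[OF assms argm_tmap tmap_unique] by blast
qed

lemma uniq_core: "uniq \<subseteq> core" unfolding uniq_def by blast

lemma rel_interior_dom: "core \<noteq> {} \<Longrightarrow> rel_interior (dom_phi (phiG G)) = core"
  using rel_interior_nonempty_interior[of "dom_phi (phiG G)"] interior_dom by simp

text \<open>A nonempty interior coincides with the relative interior, so the boundary clause of
  \<open>has_grad\<close> cannot apply here.\<close>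

lemma has_grad_core:
  assumes "y \<in> core"
  shows "has_grad (phiG G) y v \<longleftrightarrow> y \<in> uniq \<and> v = (snd y - snd (tmap y), fst y - fst (tmap y))"
proof -
  have "core \<noteq> {}" using assms by blast
  then show ?thesis
    unfolding has_grad_def interior_dom rel_interior_dom[OF \<open>core \<noteq> {}\<close>]
    using core_derivative_iff[OF assms] assms by blast
qed

lemma uniq_dom_grad:
  assumes "y \<in> uniq"
  shows "y \<in> dom_grad (phiG G)" "Dc (phiG G) y = tmap y"
proof -
  have y: "y \<in> core" using assms uniq_core by blast
  show "y \<in> dom_grad (phiG G)"
    unfolding dom_grad_def dom_phi_def using has_grad_core[OF y] phi_core_finite[OF y] assms by auto
  have "grad (phiG G) y = (snd y - snd (tmap y), fst y - fst (tmap y))"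
    unfolding grad_def using has_grad_core[OF y] assms by (intro the_equality) auto
  then show "Dc (phiG G) y = tmap y" unfolding Dc_def by (simp add: prod_eq_iff)
qed

end

subsection \<open>Measurability\<close>

lemma borel_measurable_fst_pair [measurable (raw)]:
  fixes f :: "'a \<Rightarrow> 'b::topological_space \<times> 'c::topological_space"
  assumes "f \<in> borel_measurable M"
  shows "(\<lambda>x. fst (f x)) \<in> borel_measurable M"
  by (rule measurable_compose[OF assms]) (intro borel_measurable_continuous_onI continuous_intros)

lemma borel_measurable_snd_pair [measurable (raw)]:
  fixes f :: "'a \<Rightarrow> 'b::topological_space \<times> 'c::topological_space"
  assumes "f \<in> borel_measurable M"
  shows "(\<lambda>x. snd (f x)) \<in> borel_measurable M"
  by (rule measurable_compose[OF assms]) (intro borel_measurable_continuous_onI continuous_intros)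

lemma phiG_measurable [measurable]: "(\<lambda>y. phiG H y) \<in> borel_measurable borel"
proof (rule borel_measurableI_less)
  fix a :: ereal
  have "{y. phiG H y < a} = (\<Union>x\<in>H. {y. ereal (cst x y) < a})"
    unfolding phiG_def by (auto simp: INF_less_iff)
  moreover have "open (\<Union>x\<in>H. {y. ereal (cst x y) < a})"
    unfolding cst_def by (intro open_UN ballI open_Collect_less continuous_intros)
  ultimately show "{y \<in> space borel. phiG H y < a} \<in> sets borel" by simp
qed

text \<open>The boundary clause of \<open>has_grad\<close>, with the gradient as
  \<open>\<gamma>\<close>. For y outside the closure of \<open>\<Delta>\<close> the condition is
  vacuous and every l qualifies.\<close>

definition limit_from :: "'a::metric_space set \<Rightarrow> ('a \<Rightarrow> 'b::metric_space) \<Rightarrow> 'a \<Rightarrow> 'b \<Rightarrow> bool" where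
  "limit_from \<Delta> \<gamma> y l \<longleftrightarrow> (\<forall>ys. (\<forall>n. ys n \<in> \<Delta>) \<and> ys \<longlonglongrightarrow> y \<longrightarrow> (\<lambda>n. \<gamma> (ys n)) \<longlonglongrightarrow> l)"

lemma limit_from_unique:
  assumes "y \<in> closure \<Delta>" "limit_from \<Delta> \<gamma> y l" "limit_from \<Delta> \<gamma> y l'"
  shows "l = l'"
proof -
  obtain ys where "\<forall>n. ys n \<in> \<Delta>" "ys \<longlonglongrightarrow> y" using assms(1) closure_sequential by blast
  then have "(\<lambda>n. \<gamma> (ys n)) \<longlonglongrightarrow> l" "(\<lambda>n. \<gamma> (ys n)) \<longlonglongrightarrow> l'"
    using assms(2,3) unfolding limit_from_def by blast+
  then show ?thesis by (rule LIMSEQ_unique)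
qed

text \<open>The points near which \<open>\<gamma>\<close> oscillates by less than e, written as a
  union of open sets so that it is open by construction.\<close>

definition small_osc :: "'a::metric_space set \<Rightarrow> ('a \<Rightarrow> 'b::metric_space) \<Rightarrow> real \<Rightarrow> 'a set" where
  "small_osc \<Delta> \<gamma> e = \<Union>{U. open U \<and> (\<forall>z\<in>U \<inter> \<Delta>. \<forall>z'\<in>U \<inter> \<Delta>. dist (\<gamma> z) (\<gamma> z') < e)}"

lemma small_osc_eventually:
  assumes "y \<in> small_osc \<Delta> \<gamma> e"
  obtains U where "open U" "y \<in> U" "\<And>z z'. z \<in> U \<Longrightarrow> z \<in> \<Delta> \<Longrightarrow> z' \<in> U \<Longrightarrow> z' \<in> \<Delta> \<Longrightarrow> dist (\<gamma> z) (\<gamma> z') < e"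
  using assms unfolding small_osc_def by auto

text \<open>Otherwise the balls of radius 1/(n+1) contain pairs whose images stay e apart, although
  both sequences of images converge to l.\<close>

lemma limit_from_imp_small_osc:
  assumes l: "limit_from \<Delta> \<gamma> y l" and e: "e > 0"
  shows "y \<in> small_osc \<Delta> \<gamma> e"
proof (rule ccontr)
  assume no: "y \<notin> small_osc \<Delta> \<gamma> e"
  have "\<exists>z z'. z \<in> ball y (inverse (real (Suc n))) \<inter> \<Delta> \<and> z' \<in> ball y (inverse (real (Suc n))) \<inter> \<Delta> \<and> dist (\<gamma> z) (\<gamma> z') \<ge> e" for n
  proof (rule ccontr)
    assume "\<not> ?thesis"
    then have "\<forall>z\<in>ball y (inverse (real (Suc n))) \<inter> \<Delta>. \<forall>z'\<in>ball y (inverse (real (Suc n))) \<inter> \<Delta>. dist (\<gamma> z) (\<gamma> z') < e"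
      by (meson linorder_not_le)
    then have "y \<in> small_osc \<Delta> \<gamma> e"
      unfolding small_osc_def by (intro UnionI[of "ball y (inverse (real (Suc n)))"]) auto
    then show False using no by blast
  qed
  then obtain z z' where z: "\<And>n. z n \<in> ball y (inverse (real (Suc n))) \<inter> \<Delta>" "\<And>n. z' n \<in> ball y (inverse (real (Suc n))) \<inter> \<Delta>"
    "\<And>n. dist (\<gamma> (z n)) (\<gamma> (z' n)) \<ge> e" by metis
  have lim: "x \<longlonglongrightarrow> y" if "\<And>n. x n \<in> ball y (inverse (real (Suc n))) \<inter> \<Delta>" for x :: "nat \<Rightarrow> 'a"
  proof -
    have "(\<lambda>n. dist (x n) y) \<longlonglongrightarrow> 0"
      using that by (intro tendsto_sandwich[OF _ _ tendsto_const LIMSEQ_inverse_real_of_nat])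
        (auto simp: dist_commute less_imp_le)
    then show ?thesis using tendsto_dist_iff by blast
  qed
  have "(\<lambda>n. \<gamma> (z n)) \<longlonglongrightarrow> l" "(\<lambda>n. \<gamma> (z' n)) \<longlonglongrightarrow> l"
    using l lim[OF z(1)] lim[OF z(2)] z(1,2) unfolding limit_from_def by blast+
  then have "(\<lambda>n. dist (\<gamma> (z n)) (\<gamma> (z' n))) \<longlonglongrightarrow> dist l l" by (rule tendsto_dist)
  then have "e \<le> dist l l" using z(3) by (intro LIMSEQ_le_const) auto
  then show False using e by simp
qed

text \<open>Cauchy criterion. \<open>close\<close> compares two sequences at once, so it yields both
  convergence along one sequence and independence of the sequence.\<close>

lemma small_osc_imp_limit_from:
  fixes \<gamma> :: "'a::metric_space \<Rightarrow> 'b::complete_space"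
  assumes y: "y \<in> closure \<Delta>" and osc: "\<And>k. y \<in> small_osc \<Delta> \<gamma> (inverse (real (Suc k)))"
  shows "\<exists>l. limit_from \<Delta> \<gamma> y l"
proof -
  have close: "\<forall>\<^sub>F n in sequentially. \<forall>m\<ge>n. dist (\<gamma> (zs m)) (\<gamma> (ys n)) < e"
    if ys: "\<And>n. ys n \<in> \<Delta>" "ys \<longlonglongrightarrow> y" and zs: "\<And>n. zs n \<in> \<Delta>" "zs \<longlonglongrightarrow> y" and e: "e > 0" for ys zs e
  proof -
    obtain k where k: "inverse (real (Suc k)) < e" using e reals_Archimedean by blast
    obtain U where U: "open U" "y \<in> U" "\<And>z z'. z \<in> U \<Longrightarrow> z \<in> \<Delta> \<Longrightarrow> z' \<in> U \<Longrightarrow> z' \<in> \<Delta> \<Longrightarrow> dist (\<gamma> z) (\<gamma> z') < inverse (real (Suc k))"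
      using small_osc_eventually[OF osc[of k]] by metis
    have "\<forall>\<^sub>F n in sequentially. ys n \<in> U" "\<forall>\<^sub>F n in sequentially. \<forall>m\<ge>n. zs m \<in> U"
      using topological_tendstoD[OF ys(2) U(1,2)] topological_tendstoD[OF zs(2) U(1,2)]
      by (auto simp: eventually_all_ge_at_top)
    then show ?thesis by eventually_elim (use U(3) ys zs k in \<open>meson order_less_trans\<close>)
  qed
  obtain ys where ys: "\<And>n. ys n \<in> \<Delta>" "ys \<longlonglongrightarrow> y" using y closure_sequential by blast
  have "Cauchy (\<lambda>n. \<gamma> (ys n))"
    unfolding Cauchy_altdef2
  proof (intro allI impI)
    fix e :: real assume "e > 0"
    then show "\<exists>N. \<forall>n\<ge>N. dist (\<gamma> (ys n)) (\<gamma> (ys N)) < e"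
      using close[OF ys ys] unfolding eventually_sequentially by blast
  qed
  then obtain l where l: "(\<lambda>n. \<gamma> (ys n)) \<longlonglongrightarrow> l" using Cauchy_convergent convergent_def by blast
  have "(\<lambda>n. \<gamma> (zs n)) \<longlonglongrightarrow> l" if zs: "\<forall>n. zs n \<in> \<Delta>" "zs \<longlonglongrightarrow> y" for zs
  proof -
    have "(\<lambda>n. dist (\<gamma> (zs n)) (\<gamma> (ys n))) \<longlonglongrightarrow> 0"
    proof (rule tendstoI)
      fix e :: real assume "e > 0"
      from close[OF ys _ zs(2) this] zs(1)
      show "\<forall>\<^sub>F n in sequentially. dist (dist (\<gamma> (zs n)) (\<gamma> (ys n))) 0 < e"
        by (auto elim: eventually_mono)
    qed
    then have "(\<lambda>n. dist (\<gamma> (zs n)) (\<gamma> (ys n)) + dist (\<gamma> (ys n)) l) \<longlonglongrightarrow> 0"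
      by (rule tendsto_add_zero) (rule l[THEN tendsto_dist_iff[THEN iffD1]])
    then have "(\<lambda>n. dist (\<gamma> (zs n)) l) \<longlonglongrightarrow> 0"
      by (rule Lim_null_comparison[rotated]) (simp add: dist_triangle)
    then show ?thesis by (rule tendsto_dist_iff[THEN iffD2])
  qed
  then show ?thesis unfolding limit_from_def by blast
qed

text \<open>The points with a unique limit contain a Borel set \<open>E\<close> on which the limit
  is continuous, whatever \<open>\<gamma>\<close> is. Off \<open>E\<close>, \<open>THE\<close> takes
  one of two fixed values, each on a Borel piece.\<close>

lemma limit_from_measurable:
  fixes \<gamma> :: "'a::metric_space \<Rightarrow> 'b::complete_space"
  shows "(\<lambda>y. THE l. limit_from \<Delta> \<gamma> y l) \<in> borel_measurable borel"
proof -
  define L where "L y = (THE l. limit_from \<Delta> \<gamma> y l)" for y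
  define E where "E = closure \<Delta> \<inter> (\<Inter>k. small_osc \<Delta> \<gamma> (inverse (real (Suc k))))"
  have "open (small_osc \<Delta> \<gamma> e)" for e unfolding small_osc_def by (auto intro: open_Union)
  then have E: "E \<in> sets borel" unfolding E_def by (intro sets.Int sets.countable_INT) auto
  have EL: "limit_from \<Delta> \<gamma> y (L y)" if "y \<in> E" for y
  proof -
    have y: "y \<in> closure \<Delta>" "\<And>k. y \<in> small_osc \<Delta> \<gamma> (inverse (real (Suc k)))" using that unfolding E_def by blast+
    then have "\<exists>!l. limit_from \<Delta> \<gamma> y l"
      using small_osc_imp_limit_from[OF y] limit_from_unique[OF y(1)] by blast
    then show ?thesis unfolding L_def by (rule theI')
  qed
  \<comment> \<open>In the closure of \<open>\<Delta>\<close> a point outside \<open>E\<close> has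
    no limit; off the closure every l is one vacuously. Neither predicate depends on y, hence
    neither does the value of \<open>THE\<close>.\<close>
  have const: "L y = (if y \<in> closure \<Delta> then THE l. False else THE l. True)" if "y \<notin> E" for y
  proof (cases "y \<in> closure \<Delta>")
    case True
    then have "limit_from \<Delta> \<gamma> y = (\<lambda>l. False)"
      using that limit_from_imp_small_osc[of \<Delta> \<gamma> y] unfolding E_def by auto
    then show ?thesis using True unfolding L_def by simp
  next
    case False
    have "limit_from \<Delta> \<gamma> y = (\<lambda>l. True)"
      using False closure_sequential[of y \<Delta>] unfolding limit_from_def by blast
    then show ?thesis using False unfolding L_def by simp
  qed
  have cont: "continuous_on E L"
    unfolding continuous_on_iff
  proof (intro ballI allI impI)
    fix y and e :: real assume y: "y \<in> E" and e: "e > 0"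
    obtain k where k: "inverse (real (Suc k)) < e" using e reals_Archimedean by blast
    have osc: "y \<in> small_osc \<Delta> \<gamma> (inverse (real (Suc k)))" using y unfolding E_def by blast
    obtain U where U: "open U" "y \<in> U" "\<And>z z'. z \<in> U \<Longrightarrow> z \<in> \<Delta> \<Longrightarrow> z' \<in> U \<Longrightarrow> z' \<in> \<Delta> \<Longrightarrow> dist (\<gamma> z) (\<gamma> z') < inverse (real (Suc k))"
      using small_osc_eventually[OF osc] by metis
    obtain d where d: "d > 0" "ball y d \<subseteq> U" using U(1,2) open_contains_ball by blast
    have seq: "\<exists>zs. (\<forall>n. zs n \<in> \<Delta>) \<and> zs \<longlonglongrightarrow> z \<and> (\<lambda>n. \<gamma> (zs n)) \<longlonglongrightarrow> L z" if "z \<in> E" for z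
      using EL[OF that] that closure_sequential[of z \<Delta>] unfolding limit_from_def E_def by blast
    have "dist (L y') (L y) < e" if y': "y' \<in> E" "dist y' y < d" for y'
    proof -
      obtain ys where ys: "\<forall>n. ys n \<in> \<Delta>" "ys \<longlonglongrightarrow> y" "(\<lambda>n. \<gamma> (ys n)) \<longlonglongrightarrow> L y" using seq[OF y] by blast
      obtain zs where zs: "\<forall>n. zs n \<in> \<Delta>" "zs \<longlonglongrightarrow> y'" "(\<lambda>n. \<gamma> (zs n)) \<longlonglongrightarrow> L y'" using seq[OF y'(1)] by blast
      have "y' \<in> U" using y' d by (auto simp: dist_commute)
      then have "\<forall>\<^sub>F n in sequentially. ys n \<in> U" "\<forall>\<^sub>F n in sequentially. zs n \<in> U"
        using topological_tendstoD[OF ys(2) U(1,2)] topological_tendstoD[OF zs(2) U(1)] by auto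
      then have "\<forall>\<^sub>F n in sequentially. dist (\<gamma> (zs n)) (\<gamma> (ys n)) \<le> inverse (real (Suc k))"
        by eventually_elim (use U(3) ys zs in \<open>meson less_imp_le\<close>)
      then have "dist (L y') (L y) \<le> inverse (real (Suc k))"
        by (intro tendsto_upperbound[OF tendsto_dist[OF zs(3) ys(3)]]) auto
      then show ?thesis using k by simp
    qed
    then show "\<exists>d>0. \<forall>x'\<in>E. dist x' y < d \<longrightarrow> dist (L x') (L y) < e" using d by blast
  qed
  define R where "R y = (if y \<in> closure \<Delta> then (THE l :: 'b. False) else THE l. True)" for y
  have R: "R \<in> borel_measurable borel" unfolding R_def by (intro measurable_If_set) auto
  have "L = (\<lambda>y. if y \<in> E then L y else R y)" using const unfolding R_def by auto
  moreover have "(\<lambda>y. if y \<in> E then L y else R y) \<in> borel_measurable borel"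
  proof (subst measurable_If_restrict_space_iff)
    show "L \<in> borel_measurable (restrict_space borel {x. x \<in> E}) \<and> R \<in> borel_measurable (restrict_space borel {x. x \<notin> E})"
      using borel_measurable_continuous_on_restrict[OF cont] measurable_restrict_space1[OF R] by simp
  qed (use E in auto)
  ultimately show ?thesis unfolding L_def by simp
qed

context max_monotone begin

text \<open>Otherwise \<open>argm_gap\<close> would keep c on \<open>K\<close> above the minimum
  over \<open>G\<close> by a positive amount.\<close>

lemma attained_on_closed:
  assumes "closed K" "K \<subseteq> G" "y \<in> core" "phiG K y = phiG G y"
  shows "\<exists>x\<in>K. argm y x"
proof (rule ccontr)
  assume no: "\<not> ?thesis"
  obtain x where x: "argm y x" using ex_argm assms by blast
  obtain \<kappa> where \<kappa>: "\<kappa> > 0" "\<And>z. z \<in> K \<Longrightarrow> cst z y \<ge> cst x y + \<kappa>"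
    using argm_gap[OF assms(3) x assms(1,2)] no by blast
  have "ereal (cst x y + \<kappa>) \<le> phiG K y" by (intro phiG_greatest) (use \<kappa> in auto)
  then show False unfolding assms(4) argm_phi[OF x] using \<kappa>(1) by simp
qed

lemma phiG_subset_argm: "K \<subseteq> G \<Longrightarrow> x \<in> K \<Longrightarrow> argm y x \<Longrightarrow> phiG K y = phiG G y"
  using phiG_upper[of x K y] argm_phi[of y x] argm_le[of y x]
  by (intro antisym phiG_greatest) (auto intro: order_trans)

text \<open>Two distinct minimizers have different coordinate sums, so rationals p < q separate them
  into a lower and an upper closed piece of \<open>G\<close> that both attain \<phi>. Attainment on
  a piece is an equation between Borel functions.\<close>

lemma uniq_borel [measurable]: "uniq \<in> sets borel"
proof -
  define lower where "lower p = G \<inter> {x. fst x + snd x \<le> p}" for p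
  define upper where "upper p = G \<inter> {x. p \<le> fst x + snd x}" for p
  define B where "B p q = core \<inter> ({y. phiG (lower p) y = phiG G y} \<inter> {y. phiG (upper q) y = phiG G y})" for p q
  have cl: "closed (lower p)" "closed (upper p)" for p
    unfolding lower_def upper_def by (intro closed_Int closed_G closed_Collect_le continuous_intros)+
  have sub: "lower p \<subseteq> G" "upper p \<subseteq> G" for p unfolding lower_def upper_def by auto
  have m: "B p q \<in> sets borel" for p q
  proof -
    have "{y \<in> space borel. phiG (lower p) y = phiG G y} \<in> sets borel" "{y \<in> space borel. phiG (upper q) y = phiG G y} \<in> sets borel"
      by measurable
    then show ?thesis unfolding B_def using open_core by auto
  qed
  have "core - uniq = (\<Union>(p, q)\<in>{(p, q). p \<in> \<rat> \<and> q \<in> \<rat> \<and> p < q}. B p q)" (is "_ = ?R")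
  proof (intro equalityI subsetI)
    fix y assume y: "y \<in> core - uniq"
    then obtain x0 x1 where "argm y x0" "argm y x1" "x0 \<noteq> x1"
      using ex_argm[of y] unfolding uniq_def by blast
    then obtain x x' where x: "argm y x" "argm y x'" "fst x + snd x < fst x' + snd x'"
      using sum_inj argm_in by (metis linorder_neqE)
    obtain p where p: "p \<in> \<rat>" "fst x + snd x < p" "p < fst x' + snd x'" using Rats_dense_in_real[OF x(3)] by blast
    obtain q where q: "q \<in> \<rat>" "p < q" "q < fst x' + snd x'" using Rats_dense_in_real[OF p(3)] by blast
    have "x \<in> lower p" "x' \<in> upper q" using x p q argm_in unfolding lower_def upper_def by auto
    then have "y \<in> B p q"
      unfolding B_def using y phiG_subset_argm[OF sub(1) _ x(1)] phiG_subset_argm[OF sub(2) _ x(2)] by auto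
    then show "y \<in> ?R" using p q by blast
  next
    fix y assume "y \<in> ?R"
    then obtain p q where pq: "p < q" "y \<in> B p q" by auto
    then have y: "y \<in> core" unfolding B_def by blast
    obtain x x' where "x \<in> lower p" "argm y x" "x' \<in> upper q" "argm y x'"
      using attained_on_closed[OF cl(1) sub(1) y] attained_on_closed[OF cl(2) sub(2) y] pq unfolding B_def by blast
    moreover from this have "x \<noteq> x'" using pq unfolding lower_def upper_def by auto
    ultimately show "y \<in> core - uniq" using y unfolding uniq_def by blast
  qed
  moreover have "?R \<in> sets borel"
  proof (rule sets.countable_UN'')
    show "countable {(p, q). p \<in> \<rat> \<and> q \<in> \<rat> \<and> (p::real) < q}"
      by (rule countable_subset[of _ "\<rat> \<times> \<rat>"]) (auto simp: countable_rat)
  qed (use m in auto)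
  ultimately have "core - (core - uniq) \<in> sets borel" using open_core by auto
  moreover have "core - (core - uniq) = uniq" using uniq_core by blast
  ultimately show ?thesis by simp
qed

lemma continuous_tmap: "continuous_on uniq tmap"
  unfolding continuous_on_iff
proof (intro ballI allI impI)
  fix y and e :: real assume y: "y \<in> uniq" and e: "e > 0"
  have "y \<in> core" using y uniq_core by blast
  from argm_continuous[OF this argm_tmap[OF y] tmap_unique[OF y] e]
  show "\<exists>d>0. \<forall>z\<in>uniq. dist z y < d \<longrightarrow> dist (tmap z) (tmap y) < e" using argm_tmap by blast
qed

lemma has_grad_boundary:
  assumes "core \<noteq> {}" "y \<notin> core"
  shows "has_grad (phiG G) y v \<longleftrightarrow> y \<in> closure (dom_phi (phiG G)) \<and>
    limit_from uniq (\<lambda>z. (snd z - snd (tmap z), fst z - fst (tmap z))) y v"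
proof -
  let ?\<gamma> = "\<lambda>z. (snd z - snd (tmap z), fst z - fst (tmap z))"
  have eq: "(\<forall>n. ys n \<in> core \<and> ((\<lambda>z. real_of_ereal (phiG G z)) has_derivative (\<lambda>h. gs n \<bullet> h)) (at (ys n)))
      \<longleftrightarrow> (\<forall>n. ys n \<in> uniq) \<and> gs = (\<lambda>n. ?\<gamma> (ys n))" for ys gs
  proof -
    have "(ys n \<in> core \<and> ((\<lambda>z. real_of_ereal (phiG G z)) has_derivative (\<lambda>h. gs n \<bullet> h)) (at (ys n)))
      \<longleftrightarrow> ys n \<in> uniq \<and> gs n = ?\<gamma> (ys n)" for n
      using core_derivative_iff[of "ys n" "gs n"] uniq_core by blast
    then show ?thesis unfolding fun_eq_iff by blast
  qed
  show ?thesis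
    unfolding has_grad_def interior_dom rel_interior_dom[OF assms(1)] limit_from_def
    using assms(2) by (simp only: eq) blast
qed

text \<open>Four Borel pieces: \<open>grad\<close> is continuous on \<open>uniq\<close>, a fixed
  value of \<open>THE\<close> on the rest of \<open>core\<close>, a limit of gradients on the rest
  of the closure of the domain, and again a fixed value elsewhere.\<close>

lemma Dc_measurable [measurable]:
  assumes "core \<noteq> {}"
  shows "Dc (phiG G) \<in> borel_measurable borel"
proof -
  let ?\<gamma> = "\<lambda>z. (snd z - snd (tmap z), fst z - fst (tmap z))"
  define g1 where "g1 y = (if y \<in> closure (dom_phi (phiG G)) then (THE l. limit_from uniq ?\<gamma> y l) else (THE l. False))" for y
  define g2 where "g2 y = (if y \<in> core then (THE l. False) else g1 y)" for y
  have "g1 \<in> borel_measurable borel" unfolding g1_def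
    by (intro measurable_If_set limit_from_measurable) auto
  then have g2: "g2 \<in> borel_measurable borel" unfolding g2_def
    using open_core by (intro measurable_If_set) auto
  have "grad (phiG G) = (\<lambda>y. if y \<in> uniq then ?\<gamma> y else g2 y)"
  proof
    fix y
    show "grad (phiG G) y = (if y \<in> uniq then ?\<gamma> y else g2 y)"
    proof (cases "y \<in> core")
      case True
      then show ?thesis unfolding grad_def g2_def has_grad_core[OF True] by auto
    next
      case False
      then have "y \<notin> uniq" using uniq_core by blast
      with False show ?thesis
        unfolding grad_def g2_def g1_def has_grad_boundary[OF assms False] by auto
    qed
  qed
  moreover have "(\<lambda>y. if y \<in> uniq then ?\<gamma> y else g2 y) \<in> borel_measurable borel"
  proof (subst measurable_If_restrict_space_iff)
    have "continuous_on uniq ?\<gamma>" by (intro continuous_intros continuous_tmap)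
    then show "?\<gamma> \<in> borel_measurable (restrict_space borel {x. x \<in> uniq}) \<and> g2 \<in> borel_measurable (restrict_space borel {x. x \<notin> uniq})"
      using borel_measurable_continuous_on_restrict measurable_restrict_space1[OF g2] by simp
  qed auto
  ultimately have [measurable]: "grad (phiG G) \<in> borel_measurable borel" by simp
  show ?thesis unfolding Dc_def by (intro borel_measurable_Pair borel_measurable_diff borel_measurable_fst_pair borel_measurable_snd_pair) auto
qed

end

subsection \<open>Null sets of regular measures\<close>

text \<open>For K \<ge> 1, the largest rise over a horizontal step h of either sign along a graph
  with slopes between -K and -1/K. Its subadditivity is what an infimal extension relies on.\<close>

definition slope_bound :: "real \<Rightarrow> real \<Rightarrow> real" where
  "slope_bound K h = max (- h / K) (- K * h)"

lemma slope_bound_0 [simp]: "slope_bound K 0 = 0" by (simp add: slope_bound_def)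

lemma slope_bound_add: "slope_bound K (h + h') \<le> slope_bound K h + slope_bound K h'"
proof -
  have "- (h + h') / K = - h / K + - h' / K" "- K * (h + h') = - K * h + - K * h'"
    by (simp_all add: add_divide_distrib diff_divide_distrib algebra_simps)
  then show ?thesis unfolding slope_bound_def by linarith
qed

lemma slope_bound_between:
  assumes "K > 0" "1 / K \<le> q" "q \<le> K"
  shows "- q * h \<le> slope_bound K h"
proof (cases "h \<ge> 0")
  case True
  then have "(1 / K) * h \<le> q * h" using assms by (intro mult_right_mono) auto
  then show ?thesis unfolding slope_bound_def by simp
next
  case False
  then have "q * (- h) \<le> K * (- h)" using assms by (intro mult_right_mono) auto
  then show ?thesis unfolding slope_bound_def by simp
qed

text \<open>Supplies measurability: \<open>emeasure\<close> of a nonmeasurable set is 0 by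
  convention, so it is closedness that turns regularity into a statement about null sets.\<close>

lemma D_family_closed:
  assumes "D \<in> D_family"
  shows "closed D"
proof -
  obtain a b f K where *: "a \<le> b" "K > 0" "D = (\<lambda>t. (t, f t)) ` {a..b}"
    "\<And>s t. a \<le> s \<and> s < t \<and> t \<le> b \<Longrightarrow> (t - s) / K \<le> f s - f t \<and> f s - f t \<le> K * (t - s)"
    using assms unfolding D_family_def by blast
  have "\<bar>f s - f t\<bar> \<le> K * \<bar>s - t\<bar>" if st: "s \<in> {a..b}" "t \<in> {a..b}" for s t :: real
  proof (cases s t rule: linorder_cases)
    case less
    then have "0 \<le> (t - s) / K" using *(2) by simp
    then show ?thesis using *(4)[of s t] st less by auto
  next
    case greater
    then have "0 \<le> (s - t) / K" using *(2) by simp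
    then show ?thesis using *(4)[of t s] st greater by auto
  qed simp
  then have "K-lipschitz_on {a..b} f" using *(2) unfolding lipschitz_on_def dist_real_def by auto
  then have "continuous_on {a..b} (\<lambda>t. (t, f t))"
    by (intro continuous_intros lipschitz_on_continuous_on)
  then show ?thesis unfolding *(3) by (intro compact_imp_closed compact_continuous_image) auto
qed

text \<open>McShane extension with the asymmetric gauge \<open>slope_bound K\<close> in place of \<open>K * \<bar>h\<bar>\<close>.\<close>

lemma decreasing_set_in_D_family:
  fixes A :: "pt set"
  assumes K: "K \<ge> 1" and A: "\<And>y z. y \<in> A \<Longrightarrow> z \<in> A \<Longrightarrow> snd z - snd y \<le> slope_bound K (fst z - fst y)"
    and m: "\<And>y. y \<in> A \<Longrightarrow> \<bar>fst y\<bar> \<le> m" "m \<ge> 0"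
  shows "\<exists>D\<in>D_family. A \<subseteq> D"
proof -
  \<comment> \<open>The one-sided bound, read for (s, t) and for (t, s), contains both inequalities
    of \<open>D_family\<close>.\<close>
  have fam: "(\<lambda>t. (t, f t)) ` {- m..m} \<in> D_family" if f: "\<And>s t. f t - f s \<le> slope_bound K (t - s)" for f
  proof -
    have "(t - s) / K \<le> f s - f t \<and> f s - f t \<le> K * (t - s)" if "s < t" for s t
    proof -
      have pos: "t - s > 0" and K0: "K > 0" using that K by auto
      have "1 / K \<le> K" using K by (simp add: field_simps) (metis mult_mono' mult_1 zero_le_one)
      then have le: "(1 / K) * (t - s) \<le> K * (t - s)" using pos by (intro mult_right_mono) auto
      have eq: "- (t - s) / K = - (1 / K * (t - s))" "- (s - t) / K = 1 / K * (t - s)"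
        by (simp_all add: algebra_simps diff_divide_distrib)
      have "slope_bound K (t - s) = - (1 / K * (t - s))" unfolding slope_bound_def eq using le by linarith
      moreover have "slope_bound K (s - t) = K * (t - s)"
      proof -
        have "- K * (s - t) = K * (t - s)" by (simp add: algebra_simps)
        then show ?thesis unfolding slope_bound_def eq using le by linarith
      qed
      ultimately show ?thesis using f[of t s] f[of s t] by simp
    qed
    then show ?thesis unfolding D_family_def
      by (intro CollectI exI[of _ "- m"] exI[of _ m] exI[of _ f] exI[of _ K]) (use K m(2) in auto)
  qed
  show ?thesis
  proof (cases "A = {}")
    case True
    have "- t - - s \<le> slope_bound K (t - s)" for s t
      using slope_bound_between[of K 1 "t - s"] K by simp
    then show ?thesis using fam[of uminus] True by blast
  next
    case False
    define f where "f t = (INF p\<in>A. snd p + slope_bound K (t - fst p))" for t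
    have low: "snd q - slope_bound K (fst q - t) \<le> snd p + slope_bound K (t - fst p)" if "p \<in> A" "q \<in> A" for p q t
      using A[OF that] slope_bound_add[of K "fst q - t" "t - fst p"] by simp
    obtain q where q: "q \<in> A" using False by blast
    have bdd: "bdd_below ((\<lambda>p. snd p + slope_bound K (t - fst p)) ` A)" for t
      using low[OF _ q] by (intro bdd_belowI2)
    have f_le: "f t \<le> snd p + slope_bound K (t - fst p)" if "p \<in> A" for p t
      unfolding f_def by (rule cINF_lower[OF bdd that])
    have "f t - slope_bound K (t - s) \<le> f s" for s t
      unfolding f_def[of s]
    proof (rule cINF_greatest[OF False])
      fix p assume "p \<in> A"
      then show "f t - slope_bound K (t - s) \<le> snd p + slope_bound K (s - fst p)"
        using f_le[of p t] slope_bound_add[of K "t - s" "s - fst p"] by simp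
    qed
    then have "f t - f s \<le> slope_bound K (t - s)" for s t by (simp add: algebra_simps)
    then have "(\<lambda>t. (t, f t)) ` {- m..m} \<in> D_family" by (rule fam)
    moreover have "f (fst p) = snd p" if p: "p \<in> A" for p
    proof (rule antisym)
      show "f (fst p) \<le> snd p" using f_le[OF p, of "fst p"] by simp
      show "snd p \<le> f (fst p)"
        unfolding f_def by (rule cINF_greatest[OF False]) (use low[OF _ p, of _ "fst p"] in simp)
    qed
    then have "A \<subseteq> (\<lambda>t. (t, f t)) ` {- m..m}"
      using m(1) by (force simp: image_iff abs_le_iff)
    ultimately show ?thesis by blast
  qed
qed

text \<open>Members of \<open>D_family\<close> have bounded domains, so \<open>A\<close> is cut into
  the strips |y1| \<le> n. \<open>A\<close> is not assumed measurable, hence the covering null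
  set.\<close>

lemma decreasing_set_null:
  assumes \<mu>: "D_regular \<mu>" "sets \<mu> = sets borel" and K: "K \<ge> 1"
    and A: "\<And>y z. y \<in> A \<Longrightarrow> z \<in> A \<Longrightarrow> snd z - snd y \<le> slope_bound K (fst z - fst y)"
  shows "\<exists>N\<in>null_sets \<mu>. A \<subseteq> N"
proof -
  have "\<exists>D\<in>D_family. A \<inter> {y. \<bar>fst y\<bar> \<le> real n} \<subseteq> D" for n :: nat
    by (rule decreasing_set_in_D_family[OF K]) (use A in auto)
  then obtain D where D: "\<And>n::nat. D n \<in> D_family" "\<And>n. A \<inter> {y. \<bar>fst y\<bar> \<le> real n} \<subseteq> D n" by metis
  have "D n \<in> null_sets \<mu>" for n
    using \<mu> D(1)[of n] D_family_closed[OF D(1)[of n]] unfolding D_regular_def by (intro null_setsI) auto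
  then have "(\<Union>n. D n) \<in> null_sets \<mu>" by blast
  moreover have "A \<subseteq> (\<Union>n. D n)"
  proof
    fix y assume "y \<in> A"
    moreover obtain n :: nat where "\<bar>fst y\<bar> \<le> real n" using real_arch_simple by blast
    ultimately show "y \<in> (\<Union>n. D n)" using D(2)[of n] by blast
  qed
  ultimately show ?thesis by blast
qed

lemma line_null:
  fixes a b s t :: real
  assumes \<mu>: "D_regular \<mu>" "sets \<mu> = sets borel" and ab: "a > 0" "b > 0"
  shows "\<exists>N\<in>null_sets \<mu>. {y. a * (snd y - s) + b * (fst y - t) = 0} \<subseteq> N"
proof (rule decreasing_set_null[OF \<mu>, of "max 1 (max (a / b) (b / a))"])
  fix y z assume "y \<in> {y. a * (snd y - s) + b * (fst y - t) = 0}" "z \<in> {y. a * (snd y - s) + b * (fst y - t) = 0}"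
  then have "a * (snd z - snd y) = - b * (fst z - fst y)" by (simp add: algebra_simps)
  then have "snd z - snd y = - (b / a) * (fst z - fst y)" using ab by (simp add: field_simps)
  moreover have "1 / max 1 (max (a / b) (b / a)) \<le> 1 / (a / b)"
    using ab by (intro divide_left_mono) auto
  ultimately show "snd z - snd y \<le> slope_bound (max 1 (max (a / b) (b / a))) (fst z - fst y)"
    using slope_bound_between[of "max 1 (max (a / b) (b / a))" "b / a" "fst z - fst y"] by auto
qed simp

lemma null_sets_AE:
  assumes "\<exists>N\<in>null_sets \<mu>. A \<subseteq> N"
  shows "AE y in \<mu>. y \<notin> A"
proof -
  obtain N where N: "N \<in> null_sets \<mu>" "A \<subseteq> N" using assms by blast
  from AE_not_in[OF N(1)] show ?thesis by eventually_elim (use N(2) in blast)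
qed

text \<open>Adding the two minimality conditions leaves only mixed terms. This is monotonicity of
  the subdifferential of the convex \<psi>, whose subgradients are the minimizers with swapped
  coordinates.\<close>

lemma (in max_monotone) argm_exchange:
  assumes "argm y x" "argm z x'"
  shows "(fst x' - fst x) * (snd z - snd y) + (snd x' - snd x) * (fst z - fst y) \<ge> 0"
  using argm_le[OF assms(1) argm_in[OF assms(2)]] argm_le[OF assms(2) argm_in[OF assms(1)]]
  unfolding cst_def by (simp add: algebra_simps)

text \<open>Distinct minimizers x, x' at y differ in both coordinates or share one. In the first
  case y lies in one of countably many sets \<open>B\<close>, each contained in a null set by its
  slope bounds. In the second, c(x, y) = c(x', y) puts y on the axis-parallel line through x and x',
  which also carries some \<open>g q\<close> with q rational.\<close>

lemma (in max_monotone) AE_uniq_of_core: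
  assumes \<mu>: "D_regular \<mu>" "sets \<mu> = sets borel"
    and lines: "\<And>t. emeasure \<mu> {y. fst y = t} = 0" "\<And>t. emeasure \<mu> {y. snd y = t} = 0"
  shows "AE y in \<mu>. y \<in> core \<longrightarrow> y \<in> uniq"
proof -
  define B where "B q1 q2 n = {y. \<exists>x x'. argm y x \<and> argm y x' \<and> fst x \<in> {q1 - real (Suc n)..q1} \<and> snd x \<in> {q2 - real (Suc n)..q2} \<and>
    fst x' \<in> {q1 + 1 / real (Suc n)..q1 + real (Suc n)} \<and> snd x' \<in> {q2 + 1 / real (Suc n)..q2 + real (Suc n)}}" for q1 q2 :: real and n :: nat
  have B: "\<exists>N\<in>null_sets \<mu>. B q1 q2 n \<subseteq> N" for q1 q2 n
  proof (rule decreasing_set_null[OF \<mu>])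
    let ?k = "real (Suc n)"
    have k: "?k \<ge> 1" by simp
    have "1 * 1 \<le> ?k * ?k" by (intro mult_mono k) auto
    then show "2 * ?k * ?k \<ge> 1" unfolding mult.assoc by linarith
    fix z y assume "z \<in> B q1 q2 n" "y \<in> B q1 q2 n"
    then obtain x x' where x: "argm z x'" "argm y x" "fst x \<in> {q1 - ?k..q1}" "snd x \<in> {q2 - ?k..q2}"
      "fst x' \<in> {q1 + 1 / ?k..q1 + ?k}" "snd x' \<in> {q2 + 1 / ?k..q2 + ?k}" unfolding B_def by blast
    \<comment> \<open>x minimizes at y and x' at the other point z, so the exchange inequality
      relates y and z. By the choice of the boxes both components of x' - x lie between 1/k and 2k,
      which makes 2k^2 the bound for their ratio and its inverse.\<close>
    define a b where "a = snd x' - snd x" and "b = fst x' - fst x"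
    have ab: "a \<in> {1 / ?k..2 * ?k}" "b \<in> {1 / ?k..2 * ?k}" using x unfolding a_def b_def by auto
    then have pos: "a > 0" "b > 0" by (auto intro: less_le_trans[of 0 "1 / ?k"])
    have "b * (snd y - snd z) \<le> - a * (fst y - fst z)"
      using argm_exchange[OF x(2,1)] unfolding a_def b_def by (simp add: algebra_simps)
    then have "snd y - snd z \<le> - (a / b) * (fst y - fst z)" using pos by (simp add: field_simps)
    also have "\<dots> \<le> slope_bound (2 * ?k * ?k) (fst y - fst z)"
    proof (rule slope_bound_between)
      have "a / b \<le> (2 * ?k) / (1 / ?k)" using ab pos by (intro frac_le) auto
      then show "a / b \<le> 2 * ?k * ?k" by simp
      have "(1 / ?k) / (2 * ?k) \<le> a / b" using ab pos by (intro frac_le) auto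
      then show "1 / (2 * ?k * ?k) \<le> a / b" by (simp add: field_simps)
    qed simp
    finally show "snd y - snd z \<le> slope_bound (2 * ?k * ?k) (fst y - fst z)" .
  qed
  have "AE y in \<mu>. \<forall>q1\<in>\<rat>. \<forall>q2\<in>\<rat>. \<forall>n. y \<notin> B q1 q2 n"
    using null_sets_AE[OF B] by (simp add: AE_ball_countable countable_rat AE_all_countable)
  moreover have "AE y in \<mu>. \<forall>q\<in>\<rat>. fst y \<noteq> fst (g q)"
  proof (subst AE_ball_countable[OF countable_rat], intro ballI)
    fix q
    have "{y. fst y = fst (g q)} \<in> null_sets \<mu>"
      using lines(1) \<mu>(2) by (intro null_setsI) (auto intro!: borel_closed closed_Collect_eq continuous_intros)
    then show "AE y in \<mu>. fst y \<noteq> fst (g q)" using AE_not_in by fastforce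
  qed
  moreover have "AE y in \<mu>. \<forall>q\<in>\<rat>. snd y \<noteq> snd (g q)"
  proof (subst AE_ball_countable[OF countable_rat], intro ballI)
    fix q
    have "{y. snd y = snd (g q)} \<in> null_sets \<mu>"
      using lines(2) \<mu>(2) by (intro null_setsI) (auto intro!: borel_closed closed_Collect_eq continuous_intros)
    then show "AE y in \<mu>. snd y \<noteq> snd (g q)" using AE_not_in by fastforce
  qed
  ultimately show ?thesis
  proof eventually_elim
    case (elim y)
    show "y \<in> core \<longrightarrow> y \<in> uniq"
    proof
      assume y: "y \<in> core"
      show "y \<in> uniq"
      proof (rule ccontr)
        assume "y \<notin> uniq"
        then obtain x0 x1 where "argm y x0" "argm y x1" "x0 \<noteq> x1"
          using ex_argm[OF y] y unfolding uniq_def by blast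
        then obtain x x' where x: "argm y x" "argm y x'" "fst x + snd x < fst x' + snd x'"
          using sum_inj argm_in by (metis linorder_neqE)
        obtain q where q: "q \<in> \<rat>" "fst x + snd x < q" "q < fst x' + snd x'" using Rats_dense_in_real[OF x(3)] by blast
        have le: "fst x \<le> fst (g q)" "snd x \<le> snd (g q)" "fst (g q) \<le> fst x'" "snd (g q) \<le> snd x'"
          using g_mono[of "fst x + snd x" q] g_mono[of q "fst x' + snd x'"] q
            g_of_sum[OF argm_in[OF x(1)]] g_of_sum[OF argm_in[OF x(2)]] by auto
        have eq: "cst x y = cst x' y"
          using argm_le[OF x(1) argm_in[OF x(2)]] argm_le[OF x(2) argm_in[OF x(1)]] by simp
        consider "fst x = fst x'" | "snd x = snd x'" | "fst x < fst x'" "snd x < snd x'" using le by linarith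
        then show False
        proof cases
          case 1
          then have "(fst x - fst y) * (snd x - snd x') = 0" using eq unfolding cst_def by (simp add: algebra_simps)
          then have "fst y = fst x" using 1 x(3) by auto
          then have "fst y = fst (g q)" using le 1 by simp
          then show False using elim(2) q by blast
        next
          case 2
          then have "(fst x - fst x') * (snd x - snd y) = 0" using eq unfolding cst_def by (simp add: algebra_simps)
          then have "snd y = snd x" using 2 x(3) by auto
          then have "snd y = snd (g q)" using le 2 by simp
          then show False using elim(3) q by blast
        next
          case 3
          obtain q1 where q1: "q1 \<in> \<rat>" "fst x < q1" "q1 < fst x'" using Rats_dense_in_real[OF 3(1)] by blast
          obtain q2 where q2: "q2 \<in> \<rat>" "snd x < q2" "q2 < snd x'" using Rats_dense_in_real[OF 3(2)] by blast
          define m where "m = max (max (1 / (fst x' - q1)) (1 / (snd x' - q2)))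
            (max (max (q1 - fst x) (q2 - snd x)) (max (fst x' - q1) (snd x' - q2)))"
          obtain n :: nat where "m \<le> real n" using real_arch_simple by blast
          then have n: "m \<le> real (Suc n)" by simp
          have "1 / (fst x' - q1) \<le> real (Suc n)" "1 / (snd x' - q2) \<le> real (Suc n)" using n unfolding m_def by linarith+
          then have "1 / real (Suc n) \<le> fst x' - q1" "1 / real (Suc n) \<le> snd x' - q2"
            using q1 q2 by (simp_all add: divide_le_eq mult.commute pos_divide_le_eq)
          moreover have "q1 - fst x \<le> real (Suc n)" "q2 - snd x \<le> real (Suc n)" "fst x' - q1 \<le> real (Suc n)" "snd x' - q2 \<le> real (Suc n)"
            using n unfolding m_def by linarith+
          ultimately have "y \<in> B q1 q2 n" unfolding B_def using x q1 q2
            by (intro CollectI exI[of _ x] exI[of _ x']) auto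
          then show False using elim(1) q1 q2 by blast
        qed
      qed
    qed
  qed
qed

subsection \<open>The dual maximizer\<close>

locale dual_maximizer = max_monotone G + prob_space \<nu> for G :: "pt set" and \<nu> :: "pt measure" +
  assumes sets_nu [measurable_cong]: "sets \<nu> = sets borel"
    and sq_integrable: "integrable \<nu> (\<lambda>y. (norm y)\<^sup>2)"
    and regular: "D_regular \<nu>"
    and fst_null: "\<And>t. emeasure \<nu> {y. fst y = t} = 0"
    and snd_null: "\<And>t. emeasure \<nu> {y. snd y = t} = 0"
    and optimal: "\<And>H. maximal_monotone H \<Longrightarrow> int_phi \<nu> H \<le> int_phi \<nu> G"
begin

lemma quadratic_integrable:
  assumes [measurable]: "f \<in> borel_measurable \<nu>" and "AE y in \<nu>. \<bar>f y\<bar> \<le> C * (1 + (norm y)\<^sup>2)"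
  shows "integrable \<nu> f"
  using assms(2)
  by (intro Bochner_Integration.integrable_bound[of \<nu> "\<lambda>y. C * (1 + (norm y)\<^sup>2)" f])
    (auto intro!: Bochner_Integration.integrable_add integrable_mult_right sq_integrable elim!: eventually_mono)

text \<open>Comparison with the diagonal, a maximal monotone set whose \<phi> is at least
  -|y|^2.\<close>

lemma nn_int_phi_finite: "(\<integral>\<^sup>+ y. e2ennreal (- phiG G y) \<partial>\<nu>) < \<infinity>"
proof -
  define H0 :: "pt set" where "H0 = {x. fst x = snd x}"
  have "monotone_set H0" unfolding H0_def monotone_set_def cst_def by auto
  moreover have "\<exists>x\<in>H0. fst x + snd x = u" for u
    unfolding H0_def by (intro bexI[of _ "(u / 2, u / 2)"]) auto
  ultimately have "maximal_monotone H0" by (rule monotone_set_surj_sum_imp_maximal)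
  then have le: "int_phi \<nu> H0 \<le> int_phi \<nu> G" by (rule optimal)
  have "- phiG H0 y \<le> ereal ((norm y)\<^sup>2)" for y
  proof -
    have "ereal (- ((norm y)\<^sup>2)) \<le> phiG H0 y"
    proof (rule phiG_greatest)
      fix x assume "x \<in> H0"
      then have x: "snd x = fst x" unfolding H0_def by simp
      have "- (norm y)\<^sup>2 = - ((fst y)\<^sup>2 + (snd y)\<^sup>2)" by (simp add: norm_prod_def)
      moreover have "cst x y + ((fst y)\<^sup>2 + (snd y)\<^sup>2) = ((2 * fst x - fst y - snd y)\<^sup>2 + (fst y + snd y)\<^sup>2 + 2 * ((fst y)\<^sup>2 + (snd y)\<^sup>2)) / 4"
        unfolding cst_def x by (simp add: power2_eq_square algebra_simps)
      ultimately have "- (norm y)\<^sup>2 \<le> cst x y" by (smt (verit) zero_le_power2 divide_nonneg_pos)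
      then show "ereal (- ((norm y)\<^sup>2)) \<le> ereal (cst x y)" by simp
    qed
    then show ?thesis by (subst ereal_uminus_le_reorder) simp
  qed
  then have "e2ennreal (- phiG H0 y) \<le> ennreal ((norm y)\<^sup>2)" for y
    by (metis e2ennreal_mono e2ennreal_ereal)
  then have "(\<integral>\<^sup>+ y. e2ennreal (- phiG H0 y) \<partial>\<nu>) \<le> (\<integral>\<^sup>+ y. ennreal ((norm y)\<^sup>2) \<partial>\<nu>)"
    by (intro nn_integral_mono) auto
  also have "\<dots> < \<infinity>" using sq_integrable by (simp add: nn_integral_eq_integral)
  finally have fin: "(\<integral>\<^sup>+ y. e2ennreal (- phiG H0 y) \<partial>\<nu>) < \<infinity>" .
  have "(\<integral>\<^sup>+ y. e2ennreal (- phiG G y) \<partial>\<nu>) \<le> (\<integral>\<^sup>+ y. e2ennreal (- phiG H0 y) \<partial>\<nu>)"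
    using le unfolding int_phi_def by (simp add: less_eq_ennreal.rep_eq)
  then show ?thesis using fin by simp
qed

lemma AE_uniq: "AE y in \<nu>. y \<in> uniq"
proof -
  have "AE y in \<nu>. e2ennreal (- phiG G y) \<noteq> \<infinity>"
    by (rule nn_integral_PInf_AE) (use nn_int_phi_finite in auto)
  then have dom: "AE y in \<nu>. y \<in> dom_phi (phiG G)"
    by eventually_elim (auto simp: dom_phi_def)
  obtain C where C: "countable C" "\<And>y. y \<in> dom_phi (phiG G) \<Longrightarrow> y \<in> core \<or> fst y \<in> C \<or> snd y \<in> C"
    using dom_minus_core by blast
  have "AE y in \<nu>. \<forall>t\<in>C. fst y \<noteq> t"
    using fst_null sets_nu unfolding AE_ball_countable[OF C(1)]
    by (intro ballI AE_I[where N = "{y. fst y = _}"]) (auto intro!: borel_closed closed_Collect_eq continuous_intros)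
  moreover have "AE y in \<nu>. \<forall>t\<in>C. snd y \<noteq> t"
    using snd_null sets_nu unfolding AE_ball_countable[OF C(1)]
    by (intro ballI AE_I[where N = "{y. snd y = _}"]) (auto intro!: borel_closed closed_Collect_eq continuous_intros)
  moreover note AE_uniq_of_core[OF regular sets_nu fst_null snd_null] dom
  ultimately show ?thesis by eventually_elim (use C(2) in blast)
qed

lemma core_nonempty: "core \<noteq> {}"
proof
  assume "core = {}"
  then have "AE y in \<nu>. False" using AE_uniq uniq_core by auto
  then show False by simp
qed

abbreviation "T \<equiv> Dc (phiG G)"

lemma T_measurable [measurable]: "T \<in> borel_measurable \<nu>" "T \<in> borel_measurable borel"
  using Dc_measurable[OF core_nonempty] sets_nu measurable_cong_sets by blast+

lemma AE_argm: "AE y in \<nu>. argm y (T y) \<and> (\<forall>x. argm y x \<longrightarrow> x = T y)"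
  using AE_uniq by eventually_elim (use uniq_dom_grad argm_tmap tmap_unique in auto)

lemma phi_real_integrable: "integrable \<nu> (\<lambda>y. real_of_ereal (phiG G y))"
proof (rule integrableI_bounded)
  have "AE y in \<nu>. ennreal (norm (real_of_ereal (phiG G y))) = e2ennreal (- phiG G y)"
    using AE_argm
  proof eventually_elim
    case (elim y)
    then show ?case using argm_phi[of y "T y"] argm_nonpos[of y "T y"] by simp
  qed
  then show "(\<integral>\<^sup>+ y. ennreal (norm (real_of_ereal (phiG G y))) \<partial>\<nu>) < \<infinity>"
    using nn_int_phi_finite by (simp add: nn_integral_cong_AE)
qed measurable

lemma int_phi_real:
  assumes "AE y in \<nu>. phiG H y = ereal (f y) \<and> f y \<le> 0" "integrable \<nu> f"
  shows "int_phi \<nu> H = ereal (\<integral>y. f y \<partial>\<nu>)"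
proof -
  have "(\<integral>\<^sup>+ y. e2ennreal (- phiG H y) \<partial>\<nu>) = (\<integral>\<^sup>+ y. ennreal (- f y) \<partial>\<nu>)"
    using assms(1) by (intro nn_integral_cong_AE) (auto elim!: eventually_mono)
  also have "\<dots> = ennreal (\<integral>y. - f y \<partial>\<nu>)"
    using assms by (intro nn_integral_eq_integral) (auto elim!: eventually_mono)
  also have "\<dots> = ennreal (- (\<integral>y. f y \<partial>\<nu>))" by simp
  finally have eq: "(\<integral>\<^sup>+ y. e2ennreal (- phiG H y) \<partial>\<nu>) = ennreal (- (\<integral>y. f y \<partial>\<nu>))" .
  have "(\<integral>y. f y \<partial>\<nu>) \<le> 0"
    using integral_mono_AE[OF assms(2), of "\<lambda>_. 0"] assms(1) by (auto elim!: eventually_mono)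
  then show ?thesis unfolding int_phi_def eq by (simp add: enn2ereal_ennreal)
qed

end

subsection \<open>First variation\<close>

lemma cst_add: "cst (x + h) y = cst x y + (fst h * (snd x - snd y) + snd h * (fst x - fst y)) + fst h * snd h"
  by (simp add: cst_def algebra_simps)

text \<open>Polar form of c: \<open>swap_pair h (x - y)\<close> is the derivative of c(., y) at x in
  direction h.\<close>

definition swap_pair :: "pt \<Rightarrow> pt \<Rightarrow> real" where
  "swap_pair h k = fst h * snd k + snd h * fst k"

lemma swap_pair_bound: "\<bar>swap_pair h k\<bar> \<le> 2 * (norm h * norm k)"
proof -
  have "\<bar>fst h * snd k\<bar> \<le> norm h * norm k" "\<bar>snd h * fst k\<bar> \<le> norm h * norm k"
    unfolding abs_mult by (intro mult_mono abs_fst_snd_le_norm; simp)+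
  then show ?thesis unfolding swap_pair_def by linarith
qed

lemma cst_add_scaled:
  "cst (x + \<epsilon> *\<^sub>R h) y = cst x y + \<epsilon> * swap_pair h (x - y) + \<epsilon>\<^sup>2 * (fst h * snd h)"
  unfolding cst_add swap_pair_def by (simp add: algebra_simps power2_eq_square)

locale perturbation =
  fixes v :: "pt \<Rightarrow> pt" and N B :: real
  assumes cont: "continuous_on UNIV v" and support: "\<And>x. norm x > N \<Longrightarrow> v x = 0"
    and v_bound: "\<And>x. norm (v x) \<le> B" and N_nonneg: "N \<ge> 0"
begin

lemma B_nonneg: "B \<ge> 0" using v_bound[of 0] norm_ge_zero order_trans by blast

text \<open>Chosen so that 2B(N + |y|) + B^2 \<le> C(1 + |y|), which covers the first and second
  order terms of the perturbed cost together when \<epsilon> \<le> 1.\<close>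

definition C where "C = 2 * B * (N + 1) + B\<^sup>2"

lemma C_nonneg: "C \<ge> 0" unfolding C_def using B_nonneg N_nonneg by simp

lemma first_order_bound: "\<bar>swap_pair (v x) (x - y)\<bar> \<le> 2 * B * (N + norm y)"
proof (cases "norm x > N")
  case True then show ?thesis using support B_nonneg N_nonneg by (simp add: swap_pair_def)
next
  case False
  then have n: "norm (x - y) \<le> N + norm y" using norm_triangle_ineq4[of x y] by simp
  have "\<bar>swap_pair (v x) (x - y)\<bar> \<le> 2 * (norm (v x) * norm (x - y))" by (rule swap_pair_bound)
  also have "\<dots> \<le> 2 * (B * (N + norm y))"
    using n v_bound B_nonneg by (intro mult_left_mono mult_mono) auto
  finally show ?thesis by simp
qed

lemma second_order_bound: "\<bar>fst (v x) * snd (v x)\<bar> \<le> B\<^sup>2"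
  unfolding abs_mult power2_eq_square
  using abs_fst_snd_le_norm[of "v x"] v_bound[of x] B_nonneg by (intro mult_mono) linarith+

lemma first_order_bound_C: "\<bar>swap_pair (v x) (x - y)\<bar> \<le> C * (1 + norm y)"
proof -
  have "2 * B * (N + norm y) \<le> C * (1 + norm y)"
    unfolding C_def using B_nonneg N_nonneg by (simp add: algebra_simps)
  then show ?thesis using first_order_bound[of x y] by linarith
qed

lemma cst_perturbed_bound:
  assumes "0 \<le> \<epsilon>" "\<epsilon> \<le> 1"
  shows "cst (x + \<epsilon> *\<^sub>R v x) y \<ge> cst x y - \<epsilon> * (C * (1 + norm y))"
proof -
  have "\<bar>\<epsilon> * swap_pair (v x) (x - y)\<bar> \<le> \<epsilon> * (2 * B * (N + norm y))"
    unfolding abs_mult using first_order_bound assms by (intro mult_mono) auto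
  moreover have "\<bar>\<epsilon>\<^sup>2 * (fst (v x) * snd (v x))\<bar> \<le> \<epsilon> * B\<^sup>2"
    unfolding abs_mult using second_order_bound[of x] assms
    by (intro mult_mono) (auto simp: power2_eq_square mult_left_le abs_mult)
  moreover have "\<epsilon> * (2 * B * (N + norm y)) + \<epsilon> * B\<^sup>2 \<le> \<epsilon> * (C * (1 + norm y))"
    unfolding distrib_left[symmetric] C_def using assms B_nonneg N_nonneg
    by (intro mult_left_mono) (simp_all add: algebra_simps)
  ultimately show ?thesis unfolding cst_add_scaled by linarith
qed

end

locale perturbed_max = max_monotone G + perturbation v N B for G v N B
begin

definition curve :: "real \<Rightarrow> pt set" where
  "curve \<epsilon> = (\<lambda>x. x + \<epsilon> *\<^sub>R v x) ` G"

lemma phiG_curve_lower: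
  assumes "0 \<le> \<epsilon>" "\<epsilon> \<le> 1" "argm y x0"
  shows "ereal (cst x0 y - \<epsilon> * (C * (1 + norm y))) \<le> phiG (curve \<epsilon>) y"
proof (rule phiG_greatest)
  fix z assume "z \<in> curve \<epsilon>"
  then obtain x where x: "x \<in> G" "z = x + \<epsilon> *\<^sub>R v x" unfolding curve_def by blast
  show "ereal (cst x0 y - \<epsilon> * (C * (1 + norm y))) \<le> ereal (cst z y)"
    using cst_perturbed_bound[OF assms(1,2), of x y] argm_le[OF assms(3) x(1)] unfolding x(2) by simp
qed

text \<open>The coordinate sum \<open>\<sigma>\<close> is continuous along the moved curve and
  unchanged far out, so the intermediate value theorem produces every sum.\<close>

lemma ex_dominating_curve:
  assumes "0 \<le> \<epsilon>" "\<epsilon> \<le> 1" "y0 \<in> core"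
  shows "\<exists>G'. maximal_monotone G' \<and> (\<forall>y. phiG (curve \<epsilon>) y \<le> phiG G' y)"
proof (rule ex_maximal_monotone_dominating)
  define \<sigma> where "\<sigma> u = fst (g u + \<epsilon> *\<^sub>R v (g u)) + snd (g u + \<epsilon> *\<^sub>R v (g u))" for u
  have far: "v (g u) = 0" if "\<bar>u\<bar> > 2 * N" for u
  proof (rule support)
    have "\<bar>u\<bar> \<le> 2 * norm (g u)" using abs_fst_snd_le_norm[of "g u"] g_sum[of u] by linarith
    then show "norm (g u) > N" using that by simp
  qed
  have inc: "g u + \<epsilon> *\<^sub>R v (g u) \<in> curve \<epsilon>" for u unfolding curve_def by simp
  show "\<exists>x\<in>curve \<epsilon>. fst x + snd x = t" for t
  proof -
    \<comment> \<open>Since |u| \<le> 2 |g u|, the field vanishes at \<open>g u\<close> once |u| >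
      2N; both ends -b and b are in that range, with t between them.\<close>
    define b where "b = max (2 * N + 1) \<bar>t\<bar>"
    have "\<bar>b\<bar> > 2 * N" "\<bar>- b\<bar> > 2 * N" unfolding b_def using N_nonneg by auto
    then have ends: "\<sigma> b = b" "\<sigma> (- b) = - b" unfolding \<sigma>_def by (simp_all add: far g_sum)
    have "continuous_on {- b..b} (\<lambda>u. v (g u))"
      by (rule continuous_on_compose2[OF cont]) (auto intro: continuous_on_subset[OF continuous_g])
    then have "continuous_on {- b..b} \<sigma>"
      unfolding \<sigma>_def by (intro continuous_intros continuous_on_subset[OF continuous_g]) auto
    moreover have "- b \<le> t" "t \<le> b" "- b \<le> b" unfolding b_def using N_nonneg by auto
    ultimately obtain u where "\<sigma> u = t" using IVT'[of \<sigma> "- b" t b] ends by auto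
    then show ?thesis using inc[of u] unfolding \<sigma>_def by blast
  qed
  show "g u \<in> curve \<epsilon>" if "2 * N + 1 \<le> \<bar>u\<bar>" for u
    using inc[of u] far[of u] that by simp
  obtain x0 where "argm y0 x0" using ex_argm assms(3) by blast
  from phiG_curve_lower[OF assms(1,2) this] show "phiG (curve \<epsilon>) y0 > - \<infinity>"
    by (rule less_le_trans[rotated]) simp
qed

text \<open>A one-sided expansion uniform over \<open>G\<close>. Near the minimizer the first-order
  coefficient is within \<eta>/2 of its value there, by continuity; away from it the gap
  \<open>\<kappa>\<close> absorbs every term of order \<epsilon>.\<close>

lemma cst_perturbed_expansion:
  assumes y: "y \<in> uniq" and \<eta>: "\<eta> > 0"
  shows "\<exists>\<epsilon>0>0. \<forall>\<epsilon>. 0 < \<epsilon> \<and> \<epsilon> < \<epsilon>0 \<longrightarrow> (\<forall>x\<in>G. cst (x + \<epsilon> *\<^sub>R v x) y \<ge>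
    cst (tmap y) y + \<epsilon> * (swap_pair (v (tmap y)) (tmap y - y) - \<eta>))"
proof -
  define x0 where "x0 = tmap y"
  have x0: "argm y x0" "\<And>x. argm y x \<Longrightarrow> x = x0" unfolding x0_def by (rule argm_tmap[OF y], rule tmap_unique[OF y])
  have yc: "y \<in> core" using y uniq_core by blast
  define m where "m x = swap_pair (v x) (x - y)" for x
  have "continuous_on UNIV m"
    unfolding m_def swap_pair_def by (intro continuous_intros cont)
  then obtain \<delta> where \<delta>: "\<delta> > 0" "\<And>x. dist x x0 < \<delta> \<Longrightarrow> dist (m x) (m x0) < \<eta> / 2"
    using half_gt_zero[OF \<eta>] unfolding continuous_on_iff by (meson UNIV_I)
  have cl: "closed (G - ball x0 \<delta>)" using closed_G by (simp add: closed_Diff)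
  have no: "\<not> argm y z" if "z \<in> G - ball x0 \<delta>" for z using that x0(2)[of z] \<delta>(1) by auto
  obtain \<kappa> where \<kappa>: "\<kappa> > 0" "\<And>z. z \<in> G - ball x0 \<delta> \<Longrightarrow> cst z y \<ge> cst x0 y + \<kappa>"
    by (rule argm_gap[OF yc x0(1) cl _ no]) (simp_all add: Diff_subset)
  define D where "D = C * (1 + norm y) + \<bar>m x0\<bar> + 1"
  have D: "D > 0" unfolding D_def using C_nonneg by (simp add: add_nonneg_pos)
  \<comment> \<open>\<open>\<kappa> / D\<close> serves the points away from \<open>x0\<close>, the
    last entry bounds the second-order term by \<epsilon> \<eta> / 2, and 1 admits
    \<open>cst_perturbed_bound\<close>.\<close>
  define \<epsilon>0 where "\<epsilon>0 = min 1 (min (\<kappa> / D) (\<eta> / (2 * (B\<^sup>2 + 1))))"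
  have B1: "B\<^sup>2 + 1 > 0" by (simp add: add_nonneg_pos)
  have "\<epsilon>0 > 0" unfolding \<epsilon>0_def using \<kappa>(1) D \<eta> B1 by simp
  moreover have "cst (x + \<epsilon> *\<^sub>R v x) y \<ge> cst x0 y + \<epsilon> * (m x0 - \<eta>)"
    if \<epsilon>: "0 < \<epsilon>" "\<epsilon> < \<epsilon>0" and x: "x \<in> G" for \<epsilon> x
  proof (cases "x \<in> ball x0 \<delta>")
    case True
    then have mx: "m x > m x0 - \<eta> / 2" using \<delta>(2)[of x] unfolding mem_ball dist_real_def dist_commute[of x0] by linarith
    have "\<epsilon> * (B\<^sup>2 + 1) \<le> \<eta> / 2" using \<epsilon> B1 unfolding \<epsilon>0_def by (simp add: field_simps)
    then have "\<epsilon> * B\<^sup>2 \<le> \<eta> / 2" using \<epsilon> by (simp add: algebra_simps)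
    then have "\<epsilon> * (\<epsilon> * B\<^sup>2) \<le> \<epsilon> * (\<eta> / 2)" using \<epsilon> by (intro mult_left_mono) auto
    moreover have "\<bar>\<epsilon>\<^sup>2 * (fst (v x) * snd (v x))\<bar> \<le> \<epsilon>\<^sup>2 * B\<^sup>2"
      unfolding abs_mult[of "\<epsilon>\<^sup>2"] using second_order_bound[of x] by (intro mult_mono) auto
    moreover have "\<epsilon> * (m x0 - \<eta> / 2) \<le> \<epsilon> * m x" using mx \<epsilon> by (intro mult_left_mono) auto
    moreover have "cst x0 y \<le> cst x y" using argm_le[OF x0(1) x] .
    ultimately show ?thesis
      unfolding cst_add_scaled m_def[of x, symmetric] by (simp add: algebra_simps power2_eq_square)
  next
    case False
    then have "cst x y \<ge> cst x0 y + \<kappa>" using \<kappa>(2) x by blast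
    moreover have "cst (x + \<epsilon> *\<^sub>R v x) y \<ge> cst x y - \<epsilon> * (C * (1 + norm y))"
      by (rule cst_perturbed_bound) (use \<epsilon> in \<open>auto simp: \<epsilon>0_def\<close>)
    moreover have "\<epsilon> * D \<le> \<kappa>" using \<epsilon> D unfolding \<epsilon>0_def by (simp add: field_simps)
    moreover have "\<epsilon> * (m x0 - \<eta>) + \<epsilon> * (C * (1 + norm y)) \<le> \<epsilon> * D"
      unfolding distrib_left[symmetric] D_def using \<epsilon> \<eta> by (intro mult_left_mono) auto
    ultimately show ?thesis by linarith
  qed
  ultimately show ?thesis unfolding m_def x0_def by blast
qed

end

context dual_maximizer begin

lemma affine_norm_integrable: "integrable \<nu> (\<lambda>y. C * (1 + norm y))"
proof (rule quadratic_integrable)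
  have "\<bar>C * (1 + norm y)\<bar> \<le> (2 * \<bar>C\<bar>) * (1 + (norm y)\<^sup>2)" for y :: pt
  proof -
    have "0 \<le> (norm y - 1)\<^sup>2" by simp
    then have "2 * norm y \<le> 1 + (norm y)\<^sup>2" by (simp add: power2_eq_square algebra_simps)
    then have "1 + norm y \<le> 2 * (1 + (norm y)\<^sup>2)" using zero_le_power2[of "norm y"] norm_ge_zero[of y] by argo
    then have "\<bar>C\<bar> * (1 + norm y) \<le> \<bar>C\<bar> * (2 * (1 + (norm y)\<^sup>2))" by (intro mult_left_mono) auto
    then show ?thesis by (simp add: abs_mult, simp add: algebra_simps)
  qed
  then show "AE y in \<nu>. \<bar>C * (1 + norm y)\<bar> \<le> (2 * \<bar>C\<bar>) * (1 + (norm y)\<^sup>2)" by simp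
qed measurable

text \<open>By optimality the difference quotients of \<phi> along the dominating sets have
  nonpositive integrals, while pointwise their lower limit is at least the first-order term.\<close>

lemma first_variation_le:
  assumes "perturbation v N B"
  shows "integrable \<nu> (\<lambda>y. swap_pair (v (T y)) (T y - y))"
    and "(\<integral>y. swap_pair (v (T y)) (T y - y) \<partial>\<nu>) \<le> 0"
proof -
  interpret perturbation v N B by fact
  interpret perturbed_max G v N B ..
  define \<l> where "\<l> y = swap_pair (v (T y)) (T y - y)" for y
  define \<Phi> where "\<Phi> y = real_of_ereal (phiG G y)" for y
  have [measurable]: "v \<in> borel_measurable borel" by (rule borel_measurable_continuous_onI[OF cont])
  have \<l>_meas [measurable]: "\<l> \<in> borel_measurable \<nu>" unfolding \<l>_def swap_pair_def by measurable
  have \<l>_bound: "\<bar>\<l> y\<bar> \<le> C * (1 + norm y)" for y unfolding \<l>_def by (rule first_order_bound_C)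
  show int\<l>: "integrable \<nu> (\<lambda>y. swap_pair (v (T y)) (T y - y))"
    unfolding \<l>_def[symmetric]
    by (rule Bochner_Integration.integrable_bound[OF affine_norm_integrable[of C]])
      (simp_all add: order_trans[OF \<l>_bound abs_ge_self])
  define \<epsilon> where "\<epsilon> n = inverse (real (Suc n))" for n
  have \<epsilon>: "0 < \<epsilon> n" "\<epsilon> n \<le> 1" for n unfolding \<epsilon>_def by (auto simp: field_simps)
  obtain y0 where y0: "y0 \<in> core" using core_nonempty by blast
  have "\<exists>G'. maximal_monotone G' \<and> (\<forall>y. phiG (curve (\<epsilon> n)) y \<le> phiG G' y)" for n
    using ex_dominating_curve[OF _ _ y0, of "\<epsilon> n"] \<epsilon>[of n] by simp
  then obtain G' where G': "\<And>n. maximal_monotone (G' n)" "\<And>n y. phiG (curve (\<epsilon> n)) y \<le> phiG (G' n) y" by metis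
  define \<phi> where "\<phi> n y = real_of_ereal (phiG (G' n) y)" for n y
  have [measurable]: "\<phi> n \<in> borel_measurable \<nu>" for n unfolding \<phi>_def by measurable
  have nonpos: "phiG (G' n) y \<le> 0" for n y
  proof -
    interpret H: max_monotone "G' n" by standard (rule G'(1))
    obtain x where x: "x \<in> G' n" "cst x y \<le> 0" using H.ex_cst_nonpos by blast
    have "phiG (G' n) y \<le> ereal (cst x y)" by (rule phiG_upper[OF x(1)])
    also have "\<dots> \<le> 0" using x(2) by simp
    finally show ?thesis .
  qed
  have fin: "phiG (G' n) y = ereal (\<phi> n y) \<and> \<phi> n y \<le> 0 \<and> \<Phi> y - \<epsilon> n * (C * (1 + norm y)) \<le> \<phi> n y"
    if "argm y x0" for n y x0
  proof -
    have "ereal (\<Phi> y - \<epsilon> n * (C * (1 + norm y))) \<le> phiG (G' n) y"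
      using phiG_curve_lower[OF _ _ that, of "\<epsilon> n"] \<epsilon>[of n] G'(2)[of n y] argm_phi_real[OF that]
      unfolding \<Phi>_def by (simp add: order_trans)
    then show ?thesis using nonpos[of n y] unfolding \<phi>_def by (cases "phiG (G' n) y") auto
  qed
  have AEfin: "AE y in \<nu>. phiG (G' n) y = ereal (\<phi> n y) \<and> \<phi> n y \<le> 0 \<and> \<Phi> y - \<epsilon> n * (C * (1 + norm y)) \<le> \<phi> n y" for n
    using AE_argm by eventually_elim (use fin in blast)
  have \<Phi>int: "integrable \<nu> \<Phi>" unfolding \<Phi>_def by (rule phi_real_integrable)
  have \<phi>int: "integrable \<nu> (\<phi> n)" for n
  proof (rule Bochner_Integration.integrable_bound)
    show "integrable \<nu> (\<lambda>y. \<Phi> y - \<epsilon> n * (C * (1 + norm y)))"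
      by (intro Bochner_Integration.integrable_diff \<Phi>int integrable_mult_right affine_norm_integrable)
    show "AE y in \<nu>. norm (\<phi> n y) \<le> norm (\<Phi> y - \<epsilon> n * (C * (1 + norm y)))"
      using AEfin[of n] by eventually_elim auto
  qed measurable
  have le: "(\<integral>y. \<phi> n y \<partial>\<nu>) \<le> (\<integral>y. \<Phi> y \<partial>\<nu>)" for n
  proof -
    have "int_phi \<nu> (G' n) = ereal (\<integral>y. \<phi> n y \<partial>\<nu>)"
      by (rule int_phi_real[OF _ \<phi>int]) (use AEfin[of n] in \<open>auto elim: eventually_mono\<close>)
    moreover have "int_phi \<nu> G = ereal (\<integral>y. \<Phi> y \<partial>\<nu>)"
    proof (rule int_phi_real[OF _ \<Phi>int])
      show "AE y in \<nu>. phiG G y = ereal (\<Phi> y) \<and> \<Phi> y \<le> 0"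
        using AE_argm
      proof eventually_elim
        case (elim y)
        then show ?case unfolding \<Phi>_def using argm_phi[of y "T y"] argm_nonpos[of y "T y"] by simp
      qed
    qed
    ultimately show ?thesis using optimal[OF G'(1)[of n]] by simp
  qed
  define d where "d n y = (\<phi> n y - \<Phi> y) / \<epsilon> n" for n y
  \<comment> \<open>The quotients are controlled from below only. Truncating them at their expected
    limit gives a sequence that still converges to it and is dominated by C(1 + |y|).\<close>
  define e where "e n y = min (d n y) (\<l> y)" for n y
  have [measurable]: "\<Phi> \<in> borel_measurable \<nu>" unfolding \<Phi>_def by measurable
  have [measurable]: "d n \<in> borel_measurable \<nu>" "e n \<in> borel_measurable \<nu>" for n
    unfolding e_def d_def by measurable
  have dint: "integrable \<nu> (d n)" for n
    unfolding d_def by (intro integrable_divide Bochner_Integration.integrable_diff \<phi>int \<Phi>int)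
  have ebound: "AE y in \<nu>. norm (e n y) \<le> C * (1 + norm y)" for n
    using AEfin[of n]
  proof eventually_elim
    case (elim y)
    have "- (C * (1 + norm y)) \<le> d n y"
    proof -
      define c where "c = C * (1 + norm y)"
      have "\<Phi> y - \<epsilon> n * c \<le> \<phi> n y" using elim unfolding c_def by blast
      then show ?thesis
        unfolding d_def c_def[symmetric] pos_le_divide_eq[OF \<epsilon>(1)] by (simp add: algebra_simps)
    qed
    then show ?case using \<l>_bound[of y] unfolding e_def by auto
  qed
  have "(\<lambda>n. \<integral>y. e n y \<partial>\<nu>) \<longlonglongrightarrow> (\<integral>y. \<l> y \<partial>\<nu>)"
  proof (rule integral_dominated_convergence[OF _ _ affine_norm_integrable _ ebound])
    show "AE y in \<nu>. (\<lambda>n. e n y) \<longlonglongrightarrow> \<l> y"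
      using AE_uniq
    proof eventually_elim
      case (elim y)
      have Ty: "T y = tmap y" using uniq_dom_grad(2)[OF elim] .
      have \<Phi>y: "\<Phi> y = cst (tmap y) y" unfolding \<Phi>_def by (rule argm_phi_real[OF argm_tmap[OF elim]])
      show ?case
      proof (rule tendstoI)
        fix \<eta> :: real assume \<eta>: "\<eta> > 0"
        obtain \<epsilon>0 where \<epsilon>0: "\<epsilon>0 > 0" "\<And>\<epsilon> x. 0 < \<epsilon> \<Longrightarrow> \<epsilon> < \<epsilon>0 \<Longrightarrow> x \<in> G \<Longrightarrow>
            cst (x + \<epsilon> *\<^sub>R v x) y \<ge> \<Phi> y + \<epsilon> * (\<l> y - \<eta> / 2)"
          using cst_perturbed_expansion[OF elim, of "\<eta> / 2"] \<eta> unfolding \<Phi>y \<l>_def Ty by auto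
        have "\<forall>\<^sub>F n in sequentially. \<epsilon> n < \<epsilon>0"
          using order_tendstoD(2)[OF LIMSEQ_inverse_real_of_nat \<epsilon>0(1)] unfolding \<epsilon>_def .
        then show "\<forall>\<^sub>F n in sequentially. dist (e n y) (\<l> y) < \<eta>"
        proof eventually_elim
          case (elim n)
          have "ereal (\<Phi> y + \<epsilon> n * (\<l> y - \<eta> / 2)) \<le> phiG (curve (\<epsilon> n)) y"
            by (rule phiG_greatest) (use \<epsilon>0(2)[OF \<epsilon>(1) elim] in \<open>auto simp: curve_def\<close>)
          also have "\<dots> \<le> phiG (G' n) y" by (rule G'(2))
          also have "\<dots> = ereal (\<phi> n y)" using fin[OF argm_tmap[OF \<open>y \<in> uniq\<close>]] by blast
          finally have "\<l> y - \<eta> / 2 \<le> d n y"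
            unfolding d_def pos_le_divide_eq[OF \<epsilon>(1)] by (simp add: algebra_simps)
          then show ?case using \<eta> unfolding e_def by (auto simp: dist_real_def)
        qed
      qed
    qed
  qed measurable
  moreover have "(\<integral>y. e n y \<partial>\<nu>) \<le> 0" for n
  proof -
    have "(\<integral>y. e n y \<partial>\<nu>) \<le> (\<integral>y. d n y \<partial>\<nu>)"
    proof (rule integral_mono_AE[OF _ dint])
      show "integrable \<nu> (e n)"
        by (rule Bochner_Integration.integrable_bound[OF affine_norm_integrable[of C]])
          (use ebound[of n] in \<open>auto elim!: eventually_mono intro: order_trans[OF _ abs_ge_self]\<close>)
    qed (auto simp: e_def)
    also have "\<dots> = ((\<integral>y. \<phi> n y \<partial>\<nu>) - (\<integral>y. \<Phi> y \<partial>\<nu>)) / \<epsilon> n"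
      unfolding d_def by (simp add: \<phi>int \<Phi>int)
    also have "\<dots> \<le> 0" using le[of n] \<epsilon>[of n] by (intro divide_nonpos_pos) auto
    finally show ?thesis .
  qed
  ultimately have "(\<integral>y. \<l> y \<partial>\<nu>) \<le> 0" by (intro LIMSEQ_le_const2) auto
  then show "(\<integral>y. swap_pair (v (T y)) (T y - y) \<partial>\<nu>) \<le> 0" unfolding \<l>_def .
qed

lemma first_variation:
  assumes "perturbation v N B"
  shows "(\<integral>y. swap_pair (v (T y)) (T y - y) \<partial>\<nu>) = 0"
proof -
  interpret perturbation v N B by fact
  have "perturbation (\<lambda>x. - v x) N B"
    by standard (use cont support v_bound N_nonneg in \<open>auto intro: continuous_intros\<close>)
  note first_variation_le(2)[OF this] first_variation_le(2)[OF assms]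
  moreover have "swap_pair (- h) k = - swap_pair h k" for h k by (simp add: swap_pair_def)
  ultimately show ?thesis by simp
qed

end

subsection \<open>The martingale property\<close>

definition cutoff :: "nat \<Rightarrow> pt \<Rightarrow> real" where
  "cutoff n x = max 0 (min 1 (real n + 1 - norm x))"

lemma cutoff_bounds: "0 \<le> cutoff n x" "cutoff n x \<le> 1" unfolding cutoff_def by auto

lemma cutoff_outside: "norm x > real n + 1 \<Longrightarrow> cutoff n x = 0" unfolding cutoff_def by auto

lemma cutoff_continuous [continuous_intros]: "continuous_on A (cutoff n)"
  unfolding cutoff_def by (intro continuous_intros)

lemma cutoff_tendsto: "(\<lambda>n. cutoff n x) \<longlonglongrightarrow> 1"
proof (rule tendsto_eventually)
  obtain m :: nat where m: "norm x \<le> real m" using real_arch_simple by blast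
  show "\<forall>\<^sub>F n in sequentially. cutoff n x = 1"
    using eventually_ge_at_top[of m] by eventually_elim (use m in \<open>auto simp: cutoff_def\<close>)
qed

text \<open>Cutoffs remove the compact support, distance functions pass from continuous functions to
  closed sets, and a Dynkin argument reaches Borel sets. Since f is signed, the last step sums set
  integrals of f instead of comparing two measures.\<close>

lemma test_functions_imp_sets:
  fixes f :: "'a \<Rightarrow> real" and X :: "'a \<Rightarrow> pt"
  assumes [measurable]: "X \<in> borel_measurable M" and f: "integrable M f"
    and test: "\<And>w n. continuous_on UNIV w \<Longrightarrow> (\<And>x. norm x > n \<Longrightarrow> w x = 0) \<Longrightarrow> (\<integral>\<omega>. w (X \<omega>) * f \<omega> \<partial>M) = 0"
    and A: "A \<in> sets borel"
  shows "(\<integral>\<omega>. indicator A (X \<omega>) * f \<omega> \<partial>M) = 0"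
proof -
  note [measurable] = borel_measurable_integrable[OF f]
  have fa: "integrable M (\<lambda>\<omega>. \<bar>f \<omega>\<bar>)" using f by simp
  have bdd: "(\<integral>\<omega>. w (X \<omega>) * f \<omega> \<partial>M) = 0"
    if w: "continuous_on UNIV w" "\<And>x. \<bar>w x\<bar> \<le> 1" for w
  proof -
    have [measurable]: "w \<in> borel_measurable borel" "cutoff n \<in> borel_measurable borel" for n
      using w(1) by (auto intro!: borel_measurable_continuous_onI continuous_intros)
    have "(\<lambda>n. \<integral>\<omega>. (cutoff n (X \<omega>) * w (X \<omega>)) * f \<omega> \<partial>M) \<longlonglongrightarrow> (\<integral>\<omega>. w (X \<omega>) * f \<omega> \<partial>M)"
    proof (rule integral_dominated_convergence[OF _ _ fa])
      show "AE \<omega> in M. (\<lambda>n. cutoff n (X \<omega>) * w (X \<omega>) * f \<omega>) \<longlonglongrightarrow> w (X \<omega>) * f \<omega>"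
        using tendsto_mult_right[OF tendsto_mult_right[OF cutoff_tendsto]] by (intro AE_I2) fastforce
      show "AE \<omega> in M. norm (cutoff n (X \<omega>) * w (X \<omega>) * f \<omega>) \<le> \<bar>f \<omega>\<bar>" for n
      proof (intro AE_I2)
        fix \<omega>
        have "\<bar>cutoff n (X \<omega>)\<bar> * \<bar>w (X \<omega>)\<bar> * \<bar>f \<omega>\<bar> \<le> 1 * 1 * \<bar>f \<omega>\<bar>"
          using w(2) cutoff_bounds[of n "X \<omega>"] by (intro mult_mono) auto
        then show "norm (cutoff n (X \<omega>) * w (X \<omega>) * f \<omega>) \<le> \<bar>f \<omega>\<bar>" by (simp add: abs_mult)
      qed
    qed measurable
    moreover have "(\<integral>\<omega>. (cutoff n (X \<omega>) * w (X \<omega>)) * f \<omega> \<partial>M) = 0" for n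
      by (rule test[where n = "real n + 1" and w = "\<lambda>x. cutoff n x * w x"])
        (auto intro!: continuous_intros w(1) simp: cutoff_outside)
    ultimately show ?thesis by (simp add: LIMSEQ_const_iff)
  qed
  have ind: "integrable M (\<lambda>\<omega>. indicator A (X \<omega>) * f \<omega>)" if [measurable]: "A \<in> sets borel" for A
    by (rule Bochner_Integration.integrable_bound[OF f]) (auto simp: indicator_def)
  have cl: "(\<integral>\<omega>. indicator F (X \<omega>) * f \<omega> \<partial>M) = 0" if F: "closed F" for F
  proof (cases "F = {}")
    case False
    define w where "w k x = max 0 (1 - real k * infdist x F)" for k x
    have wc: "continuous_on UNIV (w k)" for k unfolding w_def by (intro continuous_intros)
    have [measurable]: "w k \<in> borel_measurable borel" "F \<in> sets borel" for k
      using wc F by (auto intro: borel_measurable_continuous_onI)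
    have wb: "\<bar>w k x\<bar> \<le> 1" for k x unfolding w_def using infdist_nonneg[of x F] by auto
    have lim: "(\<lambda>k. w k x) \<longlonglongrightarrow> indicator F x" for x
    proof (cases "x \<in> F")
      case True
      then show ?thesis unfolding w_def by simp
    next
      case nF: False
      have pos: "infdist x F > 0"
        using in_closed_iff_infdist_zero[OF F False, of x] nF infdist_nonneg[of x F] by simp
      obtain m :: nat where m: "1 / infdist x F \<le> real m" using real_arch_simple by blast
      have "\<forall>\<^sub>F k in sequentially. w k x = indicator F x"
        using eventually_ge_at_top[of m]
      proof eventually_elim
        case (elim k)
        then have "1 / infdist x F \<le> real k" using m by simp
        then have "1 \<le> real k * infdist x F" using pos by (simp add: field_simps)
        then show ?case using nF unfolding w_def by simp
      qed
      then show ?thesis by (rule tendsto_eventually)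
    qed
    have "(\<lambda>k. \<integral>\<omega>. w k (X \<omega>) * f \<omega> \<partial>M) \<longlonglongrightarrow> (\<integral>\<omega>. indicator F (X \<omega>) * f \<omega> \<partial>M)"
    proof (rule integral_dominated_convergence[OF _ _ fa])
      show "AE \<omega> in M. (\<lambda>k. w k (X \<omega>) * f \<omega>) \<longlonglongrightarrow> indicator F (X \<omega>) * f \<omega>"
        by (intro AE_I2 tendsto_mult_right lim)
      show "AE \<omega> in M. norm (w k (X \<omega>) * f \<omega>) \<le> \<bar>f \<omega>\<bar>" for k
        using wb by (intro AE_I2) (simp add: abs_mult mult_left_le_one_le)
    qed measurable
    then show ?thesis using bdd[OF wc wb] by (simp add: LIMSEQ_const_iff)
  qed simp
  have sA: "A \<in> sigma_sets UNIV (Collect closed)"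
    using A unfolding borel_eq_closed by (simp add: sets_measure_of)
  have stable: "Int_stable (Collect closed :: pt set set)" by (auto simp: Int_stable_def)
  have "(Collect closed :: pt set set) \<subseteq> Pow UNIV" by simp
  from stable this sA show ?thesis
  proof (induction rule: sigma_sets_induct_disjoint)
    case (compl A)
    have A: "A \<in> sets borel" using compl(1) unfolding borel_eq_closed by (simp add: sets_measure_of)
    have "(\<integral>\<omega>. indicator (UNIV - A) (X \<omega>) * f \<omega> \<partial>M) = (\<integral>\<omega>. indicator UNIV (X \<omega>) * f \<omega> - indicator A (X \<omega>) * f \<omega> \<partial>M)"
      by (intro Bochner_Integration.integral_cong) (auto simp: indicator_def)
    also have "\<dots> = (\<integral>\<omega>. indicator UNIV (X \<omega>) * f \<omega> \<partial>M) - (\<integral>\<omega>. indicator A (X \<omega>) * f \<omega> \<partial>M)"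
      by (intro Bochner_Integration.integral_diff ind A) auto
    finally show ?case using compl cl[of UNIV] by simp
  next
    case (union A)
    have A [measurable]: "A i \<in> sets borel" for i
      using union(2) unfolding borel_eq_closed by (auto simp: sets_measure_of)
    have [measurable]: "X -` A i \<inter> space M \<in> sets M" for i by measurable
    have eq: "(LINT \<omega>:(X -` B \<inter> space M)|M. f \<omega>) = (\<integral>\<omega>. indicator B (X \<omega>) * f \<omega> \<partial>M)" for B
      unfolding set_lebesgue_integral_def by (rule Bochner_Integration.integral_cong) (auto simp: indicator_def)
    have "(LINT \<omega>:(\<Union>i. X -` A i \<inter> space M)|M. f \<omega>) = (\<Sum>i. (LINT \<omega>:(X -` A i \<inter> space M)|M. f \<omega>))"
    proof (rule lebesgue_integral_countable_add)
      show "(X -` A i \<inter> space M) \<inter> (X -` A j \<inter> space M) = {}" if "i \<noteq> j" for i j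
        using union(1) that unfolding disjoint_family_on_def by blast
      show "set_integrable M (\<Union>i. X -` A i \<inter> space M) f"
        unfolding set_integrable_def by (rule integrable_mult_indicator) (auto simp: f)
    qed measurable
    also have "(\<Union>i. X -` A i \<inter> space M) = X -` (\<Union>i. A i) \<inter> space M" by blast
    finally show ?case unfolding eq using union(3) by simp
  qed (use cl in auto)
qed

context dual_maximizer begin

lemma continuous_bounded_support:
  fixes w :: "pt \<Rightarrow> real"
  assumes "continuous_on UNIV w" "\<And>x. norm x > n \<Longrightarrow> w x = 0"
  obtains B where "\<And>x. \<bar>w x\<bar> \<le> B" "B \<ge> 0"
proof -
  have "compact (w ` cball 0 n)"
    by (intro compact_continuous_image continuous_on_subset[OF assms(1)]) auto
  then have "bounded (w ` cball 0 n)" by (rule compact_imp_bounded)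
  then obtain B where "\<forall>r\<in>w ` cball 0 n. norm r \<le> B" unfolding bounded_iff by blast
  then have B: "\<bar>w x\<bar> \<le> B" if "norm x \<le> n" for x using that by simp
  have "\<bar>w x\<bar> \<le> max B 0" for x using B[of x] assms(2)[of x] by (cases "norm x \<le> n") auto
  then show ?thesis using that[of "max B 0"] by simp
qed

lemma test_property:
  assumes w: "continuous_on UNIV w" "\<And>x. norm x > n \<Longrightarrow> w x = 0"
  shows "integrable \<nu> (\<lambda>y. w (T y) * (fst (T y) - fst y))" "(\<integral>y. w (T y) * (fst (T y) - fst y) \<partial>\<nu>) = 0"
    and "integrable \<nu> (\<lambda>y. w (T y) * (snd (T y) - snd y))" "(\<integral>y. w (T y) * (snd (T y) - snd y) \<partial>\<nu>) = 0"
proof -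
  obtain B where B: "\<And>x. \<bar>w x\<bar> \<le> B" "B \<ge> 0" using continuous_bounded_support[OF w] by blast
  have p1: "perturbation (\<lambda>x. (0, w x)) (max n 0) B"
    by standard (use w B in \<open>auto intro!: continuous_intros simp: norm_Pair zero_prod_def\<close>)
  have p2: "perturbation (\<lambda>x. (w x, 0)) (max n 0) B"
    by standard (use w B in \<open>auto intro!: continuous_intros simp: norm_Pair zero_prod_def\<close>)
  show "integrable \<nu> (\<lambda>y. w (T y) * (fst (T y) - fst y))" "(\<integral>y. w (T y) * (fst (T y) - fst y) \<partial>\<nu>) = 0"
    using first_variation_le(1)[OF p1] first_variation[OF p1] unfolding swap_pair_def by simp_all
  show "integrable \<nu> (\<lambda>y. w (T y) * (snd (T y) - snd y))" "(\<integral>y. w (T y) * (snd (T y) - snd y) \<partial>\<nu>) = 0"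
    using first_variation_le(1)[OF p2] first_variation[OF p2] unfolding swap_pair_def by simp_all
qed

text \<open>Testing with truncations of \<open>p\<close> itself gives \<open>E[p(T)\<^sup>2] = E[p(T) p(Y)]\<close> locally, hence
  \<open>E[p(T)\<^sup>2] \<le> E[p(Y)\<^sup>2]\<close>.\<close>

lemma square_integrable_component:
  fixes p :: "pt \<Rightarrow> real"
  assumes pc: "continuous_on UNIV p" and pb: "\<And>y. \<bar>p y\<bar> \<le> norm y"
    and test: "\<And>w n. continuous_on UNIV w \<Longrightarrow> (\<And>x. norm x > n \<Longrightarrow> w x = 0) \<Longrightarrow>
      integrable \<nu> (\<lambda>y. w (T y) * (p (T y) - p y)) \<and> (\<integral>y. w (T y) * (p (T y) - p y) \<partial>\<nu>) = 0"
  shows "integrable \<nu> (\<lambda>y. (p (T y))\<^sup>2)"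
proof (rule integrableI_bounded)
  have [measurable]: "p \<in> borel_measurable borel" "cutoff n \<in> borel_measurable borel" for n
    by (auto intro!: borel_measurable_continuous_onI pc continuous_intros)
  have p2: "integrable \<nu> (\<lambda>y. (p y)\<^sup>2)"
  proof (rule Bochner_Integration.integrable_bound[OF sq_integrable])
    show "AE y in \<nu>. norm ((p y)\<^sup>2) \<le> norm ((norm y)\<^sup>2)"
      using pb by (intro AE_I2) (simp add: power2_le_iff_abs_le)
  qed measurable
  have bound: "(\<integral>y. cutoff n (T y) * (p (T y))\<^sup>2 \<partial>\<nu>) \<le> (\<integral>y. (p y)\<^sup>2 \<partial>\<nu>)"
    and int: "integrable \<nu> (\<lambda>y. cutoff n (T y) * (p (T y))\<^sup>2)" for n
  proof -
    show int: "integrable \<nu> (\<lambda>y. cutoff n (T y) * (p (T y))\<^sup>2)"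
    proof (rule quadratic_integrable)
      have "\<bar>cutoff n (T y) * (p (T y))\<^sup>2\<bar> \<le> (real n + 1)\<^sup>2" for y
      proof (cases "norm (T y) > real n + 1")
        case False
        then have "\<bar>p (T y)\<bar> \<le> real n + 1" using pb[of "T y"] by simp
        then have "(p (T y))\<^sup>2 \<le> (real n + 1)\<^sup>2" by (simp add: power2_le_iff_abs_le)
        then have "cutoff n (T y) * (p (T y))\<^sup>2 \<le> 1 * (real n + 1)\<^sup>2"
          using cutoff_bounds[of n "T y"] by (intro mult_mono) auto
        then show ?thesis using cutoff_bounds[of n "T y"] by (simp add: abs_mult)
      qed (simp add: cutoff_outside)
      also have "(real n + 1)\<^sup>2 \<le> (real n + 1)\<^sup>2 * (1 + (norm y)\<^sup>2)" for y :: pt by (simp add: algebra_simps)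
      finally show "AE y in \<nu>. \<bar>cutoff n (T y) * (p (T y))\<^sup>2\<bar> \<le> (real n + 1)\<^sup>2 * (1 + (norm y)\<^sup>2)" by simp
    qed measurable
    have "continuous_on UNIV (\<lambda>x. cutoff n x * p x)" by (intro continuous_intros pc)
    moreover have "cutoff n x * p x = 0" if "norm x > real n + 1" for x using that by (simp add: cutoff_outside)
    ultimately have t: "integrable \<nu> (\<lambda>y. cutoff n (T y) * p (T y) * (p (T y) - p y))"
      "(\<integral>y. cutoff n (T y) * p (T y) * (p (T y) - p y) \<partial>\<nu>) = 0"
      using test[of "\<lambda>x. cutoff n x * p x" "real n + 1"] by auto
    \<comment> \<open>Twice a vanishing integral is subtracted because a^2 - 2a(a - b) = b^2 - (a -
      b)^2 \<le> b^2, here with a = p (T y) and b = p y.\<close>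
    have "(\<integral>y. cutoff n (T y) * (p (T y))\<^sup>2 \<partial>\<nu>)
        = (\<integral>y. cutoff n (T y) * (p (T y))\<^sup>2 - 2 * (cutoff n (T y) * p (T y) * (p (T y) - p y)) \<partial>\<nu>)"
      using t int by simp
    also have "\<dots> \<le> (\<integral>y. (p y)\<^sup>2 \<partial>\<nu>)"
    proof (rule integral_mono[OF _ p2])
      show "integrable \<nu> (\<lambda>y. cutoff n (T y) * (p (T y))\<^sup>2 - 2 * (cutoff n (T y) * p (T y) * (p (T y) - p y)))"
        using int t(1) by simp
      fix y
      let ?c = "cutoff n (T y)" and ?a = "p (T y)" and ?b = "p y"
      have "?c * ?a\<^sup>2 - 2 * (?c * ?a * (?a - ?b)) = ?c * ?b\<^sup>2 - ?c * (?a - ?b)\<^sup>2"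
        by (simp add: power2_eq_square algebra_simps)
      also have "\<dots> \<le> ?c * ?b\<^sup>2" using cutoff_bounds[of n "T y"] by simp
      also have "\<dots> \<le> 1 * ?b\<^sup>2" using cutoff_bounds[of n "T y"] by (intro mult_right_mono) auto
      finally show "?c * ?a\<^sup>2 - 2 * (?c * ?a * (?a - ?b)) \<le> ?b\<^sup>2" by simp
    qed
    finally show "(\<integral>y. cutoff n (T y) * (p (T y))\<^sup>2 \<partial>\<nu>) \<le> (\<integral>y. (p y)\<^sup>2 \<partial>\<nu>)" .
  qed
  \<comment> \<open>Fatou's lemma, since integrability of the limit is the very claim.\<close>
  have "(\<integral>\<^sup>+ y. ennreal (norm ((p (T y))\<^sup>2)) \<partial>\<nu>) = (\<integral>\<^sup>+ y. liminf (\<lambda>n. ennreal (cutoff n (T y) * (p (T y))\<^sup>2)) \<partial>\<nu>)"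
  proof (intro nn_integral_cong lim_imp_Liminf[symmetric])
    fix y
    have "(\<lambda>n. cutoff n (T y) * (p (T y))\<^sup>2) \<longlonglongrightarrow> 1 * (p (T y))\<^sup>2"
      by (intro tendsto_mult_right cutoff_tendsto)
    then show "(\<lambda>n. ennreal (cutoff n (T y) * (p (T y))\<^sup>2)) \<longlonglongrightarrow> ennreal (norm ((p (T y))\<^sup>2))"
      by (intro tendsto_ennrealI) simp
  qed simp
  also have "\<dots> \<le> liminf (\<lambda>n. \<integral>\<^sup>+ y. ennreal (cutoff n (T y) * (p (T y))\<^sup>2) \<partial>\<nu>)"
    by (rule nn_integral_liminf) measurable
  also have "\<dots> \<le> ennreal (\<integral>y. (p y)\<^sup>2 \<partial>\<nu>)"
  proof (rule Liminf_le)
    have "(\<integral>\<^sup>+ y. ennreal (cutoff n (T y) * (p (T y))\<^sup>2) \<partial>\<nu>) \<le> ennreal (\<integral>y. (p y)\<^sup>2 \<partial>\<nu>)" for n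
      using int[of n] bound[of n] cutoff_bounds
      by (subst nn_integral_eq_integral) (auto intro!: ennreal_leI)
    then show "\<forall>\<^sub>F n in sequentially. (\<integral>\<^sup>+ y. ennreal (cutoff n (T y) * (p (T y))\<^sup>2) \<partial>\<nu>) \<le> ennreal (\<integral>y. (p y)\<^sup>2 \<partial>\<nu>)"
      by simp
  qed simp
  finally show "(\<integral>\<^sup>+ y. ennreal (norm ((p (T y))\<^sup>2)) \<partial>\<nu>) < \<infinity>"
    using ennreal_less_top le_less_trans by (metis infinity_ennreal_def)
next
  have [measurable]: "p \<in> borel_measurable borel" by (rule borel_measurable_continuous_onI[OF pc])
  show "(\<lambda>y. (p (T y))\<^sup>2) \<in> borel_measurable \<nu>" by measurable
qed

lemma T_square_integrable: "integrable \<nu> (\<lambda>y. (fst (T y))\<^sup>2)" "integrable \<nu> (\<lambda>y. (snd (T y))\<^sup>2)"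
  using test_property
  by (intro square_integrable_component continuous_intros abs_fst_snd_le_norm conjI; blast)+

lemma integrable_of_square:
  assumes [measurable]: "f \<in> borel_measurable \<nu>" and "integrable \<nu> (\<lambda>y. (f y)\<^sup>2)"
  shows "integrable \<nu> (f :: pt \<Rightarrow> real)"
  using square_integrable_imp_integrable[OF assms] by simp

lemma T_integrable: "integrable \<nu> (\<lambda>y. fst (T y))" "integrable \<nu> (\<lambda>y. snd (T y))"
  by (rule integrable_of_square; use T_square_integrable in measurable)+

lemma component_integrable: "integrable \<nu> fst" "integrable \<nu> snd"
proof -
  have le: "\<bar>p y\<bar> \<le> 1 * (1 + (norm y)\<^sup>2)" if "\<bar>p y\<bar> \<le> norm y" for p :: "pt \<Rightarrow> real" and y
  proof -
    have "0 \<le> (norm y - 1)\<^sup>2" by simp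
    then have "2 * norm y \<le> 1 + (norm y)\<^sup>2" by (simp add: power2_eq_square algebra_simps)
    then have "norm y \<le> 1 * (1 + (norm y)\<^sup>2)" using norm_ge_zero[of y] by argo
    with that show ?thesis by (rule order_trans)
  qed
  show "integrable \<nu> fst" "integrable \<nu> snd"
    by (rule quadratic_integrable[where C = 1], measurable, rule AE_I2, rule le, rule abs_fst_snd_le_norm)+
qed

theorem martingale:
  assumes "A \<in> sets borel"
  shows "(\<integral>y. indicator A (T y) * (fst (T y) - fst y) \<partial>\<nu>) = 0"
    and "(\<integral>y. indicator A (T y) * (snd (T y) - snd y) \<partial>\<nu>) = 0"
proof -
  show "(\<integral>y. indicator A (T y) * (fst (T y) - fst y) \<partial>\<nu>) = 0"
  proof (rule test_functions_imp_sets[OF T_measurable(1) _ _ assms])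
    fix w :: "pt \<Rightarrow> real" and n :: real
    assume "continuous_on UNIV w" "\<And>x. norm x > n \<Longrightarrow> w x = 0"
    then show "(\<integral>y. w (T y) * (fst (T y) - fst y) \<partial>\<nu>) = 0" by (rule test_property(2))
  qed (use T_integrable component_integrable in simp)
  show "(\<integral>y. indicator A (T y) * (snd (T y) - snd y) \<partial>\<nu>) = 0"
  proof (rule test_functions_imp_sets[OF T_measurable(1) _ _ assms])
    fix w :: "pt \<Rightarrow> real" and n :: real
    assume "continuous_on UNIV w" "\<And>x. norm x > n \<Longrightarrow> w x = 0"
    then show "(\<integral>y. w (T y) * (snd (T y) - snd y) \<partial>\<nu>) = 0" by (rule test_property(4))
  qed (use T_integrable component_integrable in simp)
qed

end

subsection \<open>Regularity of the law of the optimal map\<close>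

context dual_maximizer begin

lemma AE_fst_neq: "AE y in \<nu>. fst y \<noteq> t"
  using fst_null[of t] sets_nu
  by (intro AE_I[where N = "{y. fst y = t}"]) (auto intro!: borel_closed closed_Collect_eq continuous_intros)

lemma AE_snd_neq: "AE y in \<nu>. snd y \<noteq> t"
  using snd_null[of t] sets_nu
  by (intro AE_I[where N = "{y. snd y = t}"]) (auto intro!: borel_closed closed_Collect_eq continuous_intros)

lemma AE_line_neq:
  fixes l :: real and x :: pt
  assumes "0 \<le> l" "l \<le> 1"
  shows "AE y in \<nu>. l * (snd x - snd y) + (1 - l) * (fst x - fst y) \<noteq> 0"
proof -
  consider "l = 0" | "l = 1" | "0 < l" "l < 1" using assms by linarith
  then show ?thesis
  proof cases
    case 1
    from AE_fst_neq[of "fst x"] show ?thesis by eventually_elim (simp add: 1)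
  next
    case 2
    from AE_snd_neq[of "snd x"] show ?thesis by eventually_elim (simp add: 2)
  next
    case 3
    have "AE y in \<nu>. y \<notin> {y. l * (snd y - snd x) + (1 - l) * (fst y - fst x) = 0}"
      by (rule null_sets_AE[OF line_null[OF regular sets_nu]]) (use 3 in auto)
    then show ?thesis by eventually_elim (simp add: algebra_simps)
  qed
qed

text \<open>(l, 1 - l) is a limit of normalized chord directions from x to later points of
  \<open>G\<close>; minimality of x along these chords gives, to first order, one half-plane for all
  y. \<open>G\<close> need not have a tangent at x, hence the passage to a subsequence.\<close>

lemma tangent_direction:
  assumes x: "x \<in> G"
  obtains l where "0 \<le> l" "l \<le> 1" "\<And>y. argm y x \<Longrightarrow> l * (snd x - snd y) + (1 - l) * (fst x - fst y) \<ge> 0"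
proof -
  define u where "u = fst x + snd x"
  have gu: "g u = x" unfolding u_def by (rule g_of_sum[OF x])
  define \<delta> where "\<delta> n = inverse (real (Suc n))" for n
  have \<delta>: "\<delta> n > 0" for n unfolding \<delta>_def by simp
  define a where "a n = (fst (g (u + \<delta> n)) - fst x) / \<delta> n" for n
  have inc: "fst (g (u + \<delta> n)) - fst x \<ge> 0" "snd (g (u + \<delta> n)) - snd x \<ge> 0"
    "(fst (g (u + \<delta> n)) - fst x) + (snd (g (u + \<delta> n)) - snd x) = \<delta> n" for n
    using g_mono[of u "u + \<delta> n"] g_sum[of "u + \<delta> n"] \<delta>[of n] g_of_sum[OF x] unfolding u_def by auto
  have a: "fst (g (u + \<delta> n)) - fst x = \<delta> n * a n" "snd (g (u + \<delta> n)) - snd x = \<delta> n * (1 - a n)" for n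
  proof -
    show 1: "fst (g (u + \<delta> n)) - fst x = \<delta> n * a n" unfolding a_def using \<delta>[of n] by simp
    show "snd (g (u + \<delta> n)) - snd x = \<delta> n * (1 - a n)" using inc(3)[of n] unfolding 1 by (simp add: algebra_simps)
  qed
  have "a n \<in> {0..1}" for n
    using inc[of n] \<delta>[of n] unfolding a by (auto simp: zero_le_mult_iff)
  then obtain l r where l: "l \<in> {0..1}" "strict_mono r" "(a \<circ> r) \<longlonglongrightarrow> l"
    using compact_Icc[of "0::real" 1] unfolding compact_def by metis
  have "l * (snd x - snd y) + (1 - l) * (fst x - fst y) \<ge> 0" if y: "argm y x" for y
  proof -
    have "a n * (snd x - snd y) + (1 - a n) * (fst x - fst y) + a n * (1 - a n) * \<delta> n \<ge> 0" for n
    proof -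
      have "0 \<le> cst (x + (g (u + \<delta> n) - x)) y - cst x y"
        using argm_le[OF y, of "g (u + \<delta> n)"] by simp
      also have "\<dots> = \<delta> n * (a n * (snd x - snd y) + (1 - a n) * (fst x - fst y) + a n * (1 - a n) * \<delta> n)"
        unfolding cst_add fst_diff snd_diff a by (simp add: algebra_simps)
      finally show ?thesis using \<delta>[of n] by (simp add: zero_le_mult_iff)
    qed
    moreover have "(\<lambda>n. a (r n) * (snd x - snd y) + (1 - a (r n)) * (fst x - fst y) + a (r n) * (1 - a (r n)) * \<delta> (r n))
        \<longlonglongrightarrow> l * (snd x - snd y) + (1 - l) * (fst x - fst y) + l * (1 - l) * 0"
    proof -
      have "(\<lambda>n. a (r n)) \<longlonglongrightarrow> l" using l(3) by (simp add: comp_def)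
      moreover have "(\<lambda>n. \<delta> (r n)) \<longlonglongrightarrow> 0"
        using LIMSEQ_subseq_LIMSEQ[OF LIMSEQ_inverse_real_of_nat l(2)] unfolding \<delta>_def comp_def .
      ultimately show ?thesis by (intro tendsto_intros)
    qed
    ultimately show ?thesis by (intro LIMSEQ_le_const[of _ _ 0]) auto
  qed
  then show ?thesis using that[of l] l(1) by auto
qed

lemma AE_T_neq: "AE y in \<nu>. T y \<noteq> x"
proof (cases "x \<in> G")
  case False
  from AE_argm show ?thesis by eventually_elim (use False argm_in in blast)
next
  case True
  obtain l where l: "0 \<le> l" "l \<le> 1" "\<And>y. argm y x \<Longrightarrow> l * (snd x - snd y) + (1 - l) * (fst x - fst y) \<ge> 0"
    using tangent_direction[OF True] by metis
  define q where "q y = l * (indicator {x} (T y) * (snd (T y) - snd y)) + (1 - l) * (indicator {x} (T y) * (fst (T y) - fst y))" for y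
  have [measurable]: "{x} \<in> sets borel" by simp
  have int: "integrable \<nu> (\<lambda>y. indicator {x} (T y) * (snd (T y) - snd y))"
    "integrable \<nu> (\<lambda>y. indicator {x} (T y) * (fst (T y) - fst y))"
  proof -
    have d: "integrable \<nu> (\<lambda>y. snd (T y) - snd y)" "integrable \<nu> (\<lambda>y. fst (T y) - fst y)"
      using T_integrable component_integrable by simp_all
    show "integrable \<nu> (\<lambda>y. indicator {x} (T y) * (snd (T y) - snd y))"
      by (rule Bochner_Integration.integrable_bound[OF d(1)]) (auto simp: indicator_def)
    show "integrable \<nu> (\<lambda>y. indicator {x} (T y) * (fst (T y) - fst y))"
      by (rule Bochner_Integration.integrable_bound[OF d(2)]) (auto simp: indicator_def)
  qed
  then have qint: "integrable \<nu> q" unfolding q_def by simp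
  have "(\<integral>y. q y \<partial>\<nu>) = 0"
    unfolding q_def using int martingale[of "{x}"] by simp
  moreover have "AE y in \<nu>. 0 \<le> q y"
    using AE_argm
  proof eventually_elim
    case (elim y)
    show ?case using l(3)[of y] elim unfolding q_def by (cases "T y = x") auto
  qed
  ultimately have "AE y in \<nu>. q y = 0" using integral_nonneg_eq_0_iff_AE[OF qint] by blast
  with AE_line_neq[OF l(1,2), of x] show ?thesis
  proof eventually_elim
    case (elim y)
    then show ?case unfolding q_def by (cases "T y = x") auto
  qed
qed

text \<open>\<open>U\<close> parametrizes the part of \<open>G\<close> on the line p = t, and
  \<open>E\<close> holds its least and greatest elements if any, at most two values that
  \<open>AE_T_neq\<close> rules out. On \<open>U\<close> the cost is affine in the parameter with
  slope t - p y; a minimum at a non-extreme parameter forces p y = t. The abstract p, p' serve both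
  coordinates.\<close>

lemma AE_component_neq:
  fixes p p' :: "pt \<Rightarrow> real"
  assumes cst_p: "\<And>x y. cst x y = (p x - p y) * (p' x - p' y)" and sum_p: "\<And>u. p (g u) + p' (g u) = u"
    and neq: "AE y in \<nu>. p y \<noteq> t"
  shows "AE y in \<nu>. p (T y) \<noteq> t"
proof -
  define U where "U = {u. p (g u) = t}"
  define E where "E = {u\<in>U. \<forall>v\<in>U. u \<le> v} \<union> {u\<in>U. \<forall>v\<in>U. v \<le> u}"
  have "countable E" unfolding E_def
    by (intro countable_Un countable_subsingleton) (auto dest: leD)
  then have "AE y in \<nu>. \<forall>u\<in>E. T y \<noteq> g u"
    using AE_T_neq by (simp add: AE_ball_countable)
  with neq AE_argm show ?thesis
  proof eventually_elim
    case (elim y)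
    show ?case
    proof
      assume t: "p (T y) = t"
      define u where "u = fst (T y) + snd (T y)"
      have gu: "g u = T y" unfolding u_def using elim(2) argm_in g_of_sum by blast
      then have uU: "u \<in> U" using t unfolding U_def by simp
      moreover have "u \<notin> E" using elim(3) gu by metis
      ultimately obtain u1 u2 where u12: "u1 \<in> U" "u1 < u" "u2 \<in> U" "u < u2" unfolding E_def by force
      have p': "p' (g v) = v - t" if "v \<in> U" for v using sum_p[of v] that unfolding U_def by simp
      have "(t - p y) * (v - u) \<ge> 0" if v: "v \<in> U" for v
      proof -
        have "cst (g u) y \<le> cst (g v) y" using elim(2) argm_le[of y "T y" "g v"] gu by simp
        then show ?thesis using v uU unfolding cst_p p'[OF v] p'[OF uU] by (simp add: U_def algebra_simps)
      qed
      from this[OF u12(1)] this[OF u12(3)] have "t = p y" using u12 by (simp add: zero_le_mult_iff)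
      then show False using elim(1) by simp
    qed
  qed
qed

lemma AE_fst_T_neq: "AE y in \<nu>. fst (T y) \<noteq> t"
  by (rule AE_component_neq[where p = fst and p' = snd]) (auto simp: cst_def g_sum AE_fst_neq)

lemma AE_snd_T_neq: "AE y in \<nu>. snd (T y) \<noteq> t"
  by (rule AE_component_neq[where p = snd and p' = fst]) (auto simp: cst_def g_sum AE_snd_neq mult.commute add.commute)

text \<open>A strictly decreasing graph meets a monotone set in at most one point, so the absence of
  atoms is enough.\<close>

lemma AE_T_notin_D:
  assumes "D \<in> D_family"
  shows "AE y in \<nu>. T y \<notin> D"
proof -
  obtain a b f K where *: "K > 0" "D = (\<lambda>t. (t, f t)) ` {a..b}"
    "\<And>s t. a \<le> s \<and> s < t \<and> t \<le> b \<Longrightarrow> (t - s) / K \<le> f s - f t \<and> f s - f t \<le> K * (t - s)"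
    using assms unfolding D_family_def by blast
  have lt: False if "(s, f s) \<in> G" "(t, f t) \<in> G" "s \<in> {a..b}" "t \<in> {a..b}" "s < t" for s t
  proof -
    have "(t - s) / K > 0" using that * by simp
    then have "f s - f t > 0" using *(3)[of s t] that by auto
    then have "(s - t) * (f s - f t) < 0" using that by (simp add: mult_neg_pos)
    then show False using cst_nonneg[OF that(1,2)] unfolding cst_def by simp
  qed
  have single: "x = z" if "x \<in> G \<inter> D" "z \<in> G \<inter> D" for x z
  proof -
    from that obtain s t where st: "x = (s, f s)" "z = (t, f t)" "s \<in> {a..b}" "t \<in> {a..b}" unfolding *(2) by blast
    then show ?thesis using lt[of s t] lt[of t s] that by (cases s t rule: linorder_cases) auto
  qed
  obtain x0 where x0: "G \<inter> D \<subseteq> {x0}"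
  proof (cases "G \<inter> D = {}")
    case False
    then obtain x where "x \<in> G \<inter> D" by blast
    then show ?thesis using that[of x] single by blast
  qed blast
  from AE_argm AE_T_neq[of x0] show ?thesis
  proof eventually_elim
    case (elim y)
    then have "T y \<in> G" using argm_in by blast
    with elim x0 show ?case by blast
  qed
qed

end

subsection \<open>Optimality and uniqueness\<close>

lemma vimage_algebra_subalgebra:
  assumes "X \<in> measurable N K"
  shows "subalgebra N (vimage_algebra (space N) X K)"
  using sets_image_in_sets[OF refl assms] unfolding subalgebra_def by simp

lemma product_integrable_of_squares:
  fixes p q :: "'a \<Rightarrow> real"
  assumes [measurable]: "p \<in> borel_measurable N" "q \<in> borel_measurable N"
    and "integrable N (\<lambda>\<omega>. (p \<omega>)\<^sup>2)" "integrable N (\<lambda>\<omega>. (q \<omega>)\<^sup>2)"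
  shows "integrable N (\<lambda>\<omega>. p \<omega> * q \<omega>)"
proof (rule Bochner_Integration.integrable_bound)
  show "integrable N (\<lambda>\<omega>. (p \<omega>)\<^sup>2 + (q \<omega>)\<^sup>2)" using assms by simp
  show "AE \<omega> in N. norm (p \<omega> * q \<omega>) \<le> norm ((p \<omega>)\<^sup>2 + (q \<omega>)\<^sup>2)"
  proof (intro AE_I2)
    fix \<omega>
    have "0 \<le> (\<bar>p \<omega>\<bar> - \<bar>q \<omega>\<bar>)\<^sup>2" by simp
    then have "2 * (\<bar>p \<omega>\<bar> * \<bar>q \<omega>\<bar>) \<le> (p \<omega>)\<^sup>2 + (q \<omega>)\<^sup>2" by (simp add: power2_diff)
    moreover have "0 \<le> \<bar>p \<omega>\<bar> * \<bar>q \<omega>\<bar>" by simp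
    ultimately have "\<bar>p \<omega>\<bar> * \<bar>q \<omega>\<bar> \<le> (p \<omega>)\<^sup>2 + (q \<omega>)\<^sup>2" by linarith
    then show "norm (p \<omega> * q \<omega>) \<le> norm ((p \<omega>)\<^sup>2 + (q \<omega>)\<^sup>2)" by (simp add: abs_mult)
  qed
qed measurable

lemma square_components_integrable:
  fixes Z :: "'a \<Rightarrow> pt"
  assumes [measurable]: "Z \<in> borel_measurable N" and "integrable N (\<lambda>\<omega>. (norm (Z \<omega>))\<^sup>2)"
  shows "integrable N (\<lambda>\<omega>. (fst (Z \<omega>))\<^sup>2)" "integrable N (\<lambda>\<omega>. (snd (Z \<omega>))\<^sup>2)"
  by (rule Bochner_Integration.integrable_bound[OF assms(2)], measurable,
      use abs_fst_snd_le_norm in \<open>simp add: power2_le_iff_abs_le\<close>)+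

text \<open>The expression is continuous in the parameter of \<open>g\<close>, so rational
  parameters decide it; almost sure inequalities can then be collected over a countable set.\<close>

lemma (in max_monotone) affine_le_all:
  assumes "\<And>q. q \<in> \<rat> \<Longrightarrow> fst (g q) * snd z + snd (g q) * fst z - fst (g q) * snd (g q) \<le> c" and "x \<in> G"
  shows "fst x * snd z + snd x * fst z - fst x * snd x \<le> c"
proof -
  define a where "a u = fst (g u) * snd z + snd (g u) * fst z - fst (g u) * snd (g u)" for u
  have "continuous_on UNIV a" unfolding a_def by (intro continuous_intros continuous_g)
  then have op: "open {u. c < a u}"
    using open_Collect_less[of "\<lambda>_. c" a] by simp
  have "\<not> c < a u" for u
  proof
    assume "c < a u"
    then obtain e where e: "e > 0" "ball u e \<subseteq> {u. c < a u}" using op open_contains_ball by blast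
    obtain q where q: "q \<in> \<rat>" "u < q" "q < u + e" using Rats_dense_in_real[of u "u + e"] e(1) by auto
    then have "q \<in> ball u e" by (simp add: dist_real_def)
    then have "c < a q" using e(2) by blast
    then show False using assms(1)[OF q(1)] unfolding a_def by simp
  qed
  then have "a (fst x + snd x) \<le> c" by (simp add: not_less)
  then show ?thesis unfolding a_def g_of_sum[OF assms(2)] .
qed

context dual_maximizer begin

abbreviation "\<Phi> y \<equiv> real_of_ereal (phiG G y)"

lemma AE_Phi: "AE y in \<nu>. \<Phi> y = cst (T y) y \<and> (\<forall>x\<in>G. \<Phi> y \<le> cst x y)"
  using AE_argm
proof eventually_elim
  case (elim y)
  then have "argm y (T y)" by blast
  then show ?case using argm_phi_real argm_le by metis
qed

context
  fixes N :: "'a measure" and X Y :: "'a \<Rightarrow> pt"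
  assumes N: "prob_space N" and X [measurable]: "X \<in> borel_measurable N" and Y [measurable]: "Y \<in> borel_measurable N"
    and law: "distr N borel Y = \<nu>"
begin

lemma AE_law: "AE y in \<nu>. P y \<Longrightarrow> AE \<omega> in N. P (Y \<omega>)"
  unfolding law[symmetric] by (rule AE_distrD[OF Y])

lemma integrable_law: "integrable \<nu> f \<Longrightarrow> integrable N (\<lambda>\<omega>. f (Y \<omega>))" for f :: "pt \<Rightarrow> real"
  unfolding law[symmetric] by (rule integrable_distr[OF Y])

lemma integral_law: "f \<in> borel_measurable \<nu> \<Longrightarrow> (\<integral>\<omega>. f (Y \<omega>) \<partial>N) = (\<integral>y. f y \<partial>\<nu>)" for f :: "pt \<Rightarrow> real"
  unfolding law[symmetric] by (subst integral_distr) auto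

lemma subalg: "finite_measure_subalgebra N (vimage_algebra (space N) X borel)"
  using N X by (simp add: finite_measure_subalgebra_def finite_measure_subalgebra_axioms_def
      vimage_algebra_subalgebra prob_space.finite_measure)

text \<open>The space \<open>N\<close> is arbitrary so that the result serves the original
  probability space as well as a plan with X = fst and Y = snd. On the preimages of Borel sets under
  X the defining identity is \<open>martingale\<close>, transported by the law of Y.\<close>

lemma cond_exp_of_map:
  assumes XT: "AE \<omega> in N. X \<omega> = T (Y \<omega>)"
  shows "AE \<omega> in N. real_cond_exp N (vimage_algebra (space N) X borel) (\<lambda>\<omega>. fst (Y \<omega>)) \<omega> = fst (X \<omega>)"
    and "AE \<omega> in N. real_cond_exp N (vimage_algebra (space N) X borel) (\<lambda>\<omega>. snd (Y \<omega>)) \<omega> = snd (X \<omega>)"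
proof -
  interpret F: finite_measure_subalgebra N "vimage_algebra (space N) X borel" by (rule subalg)
  have gen: "AE \<omega> in N. real_cond_exp N (vimage_algebra (space N) X borel) (\<lambda>\<omega>. p (Y \<omega>)) \<omega> = p (X \<omega>)"
    if [measurable]: "p \<in> borel_measurable borel" and p: "integrable \<nu> p" "integrable \<nu> (\<lambda>y. p (T y))"
      and mart: "\<And>A. A \<in> sets borel \<Longrightarrow> (\<integral>y. indicator A (T y) * (p (T y) - p y) \<partial>\<nu>) = 0" for p :: "pt \<Rightarrow> real"
  proof (rule F.real_cond_exp_charact)
    show i1: "integrable N (\<lambda>\<omega>. p (Y \<omega>))" by (rule integrable_law[OF p(1)])
    have "integrable N (\<lambda>\<omega>. p (T (Y \<omega>)))" by (rule integrable_law[OF p(2)])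
    moreover have "AE \<omega> in N. p (X \<omega>) = p (T (Y \<omega>))" using XT by eventually_elim simp
    ultimately show i2: "integrable N (\<lambda>\<omega>. p (X \<omega>))"
      by (subst integrable_cong_AE[where g = "\<lambda>\<omega>. p (T (Y \<omega>))"]) (auto intro: borel_measurable_integrable)
    show "(\<lambda>\<omega>. p (X \<omega>)) \<in> borel_measurable (vimage_algebra (space N) X borel)"
      by (rule measurable_compose[OF measurable_vimage_algebra1]) auto
    fix S assume "S \<in> sets (vimage_algebra (space N) X borel)"
    then obtain A where A [measurable]: "A \<in> sets borel" and S: "S = X -` A \<inter> space N"
      using X by (auto simp: sets_vimage_algebra2)
    have iA: "integrable N (\<lambda>\<omega>. indicator A (X \<omega>) * f \<omega>)" if "integrable N f" for f :: "'a \<Rightarrow> real"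
      by (rule Bochner_Integration.integrable_bound[OF that]) (use that in \<open>auto simp: indicator_def\<close>)
    have "(\<integral>\<omega>. indicator A (X \<omega>) * p (X \<omega>) \<partial>N) - (\<integral>\<omega>. indicator A (X \<omega>) * p (Y \<omega>) \<partial>N)
        = (\<integral>\<omega>. indicator A (X \<omega>) * p (X \<omega>) - indicator A (X \<omega>) * p (Y \<omega>) \<partial>N)"
      by (rule Bochner_Integration.integral_diff[symmetric]) (rule iA i1 i2)+
    also have "\<dots> = (\<integral>\<omega>. indicator A (T (Y \<omega>)) * (p (T (Y \<omega>)) - p (Y \<omega>)) \<partial>N)"
    proof (rule integral_cong_AE)
      show "AE \<omega> in N. indicator A (X \<omega>) * p (X \<omega>) - indicator A (X \<omega>) * p (Y \<omega>) = indicator A (T (Y \<omega>)) * (p (T (Y \<omega>)) - p (Y \<omega>))"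
        using XT by eventually_elim (simp add: algebra_simps)
    qed measurable
    also have "\<dots> = (\<integral>y. indicator A (T y) * (p (T y) - p y) \<partial>\<nu>)"
      by (rule integral_law) measurable
    also have "\<dots> = 0" by (rule mart[OF A])
    finally have eq: "(\<integral>\<omega>. indicator A (X \<omega>) * p (Y \<omega>) \<partial>N) = (\<integral>\<omega>. indicator A (X \<omega>) * p (X \<omega>) \<partial>N)" by simp
    have S_eq: "(\<integral>\<omega>\<in>S. f \<omega> \<partial>N) = (\<integral>\<omega>. indicator A (X \<omega>) * f \<omega> \<partial>N)" for f :: "'a \<Rightarrow> real"
      unfolding set_lebesgue_integral_def S by (rule Bochner_Integration.integral_cong) (auto simp: indicator_def)
    show "(\<integral>\<omega>\<in>S. p (Y \<omega>) \<partial>N) = (\<integral>\<omega>\<in>S. p (X \<omega>) \<partial>N)" unfolding S_eq by (rule eq)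
  qed
  show "AE \<omega> in N. real_cond_exp N (vimage_algebra (space N) X borel) (\<lambda>\<omega>. fst (Y \<omega>)) \<omega> = fst (X \<omega>)"
    by (rule gen[of fst]) (use component_integrable T_integrable martingale in auto)
  show "AE \<omega> in N. real_cond_exp N (vimage_algebra (space N) X borel) (\<lambda>\<omega>. snd (Y \<omega>)) \<omega> = snd (X \<omega>)"
    by (rule gen[of snd]) (use component_integrable T_integrable martingale in auto)
qed

lemma integral_of_map: "(\<integral>\<omega>. cst (T (Y \<omega>)) (Y \<omega>) \<partial>N) = (\<integral>y. \<Phi> y \<partial>\<nu>)"
proof -
  have "(\<integral>\<omega>. cst (T (Y \<omega>)) (Y \<omega>) \<partial>N) = (\<integral>y. cst (T y) y \<partial>\<nu>)"
    by (rule integral_law) (unfold cst_def, measurable)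
  also have "\<dots> = (\<integral>y. \<Phi> y \<partial>\<nu>)"
    using AE_Phi by (intro integral_cong_AE) (auto simp: cst_def elim: eventually_mono)
  finally show ?thesis .
qed

text \<open>Jensen's inequality for \<open>\<psi> y = fst y * snd y - \<Phi> y\<close>, a supremum of countably many affine
  functions, gives \<open>E[\<psi>(Y) | X] \<ge> \<psi>(X) \<ge> X\<^sub>1 X\<^sub>2\<close>; equality in the last place means \<open>X \<in> G\<close>.\<close>

lemma weak_duality:
  assumes sq: "integrable N (\<lambda>\<omega>. (norm (X \<omega>))\<^sup>2)"
    and ce1: "AE \<omega> in N. real_cond_exp N (vimage_algebra (space N) X borel) (\<lambda>\<omega>. fst (Y \<omega>)) \<omega> = fst (X \<omega>)"
    and ce2: "AE \<omega> in N. real_cond_exp N (vimage_algebra (space N) X borel) (\<lambda>\<omega>. snd (Y \<omega>)) \<omega> = snd (X \<omega>)"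
  shows "(\<integral>y. \<Phi> y \<partial>\<nu>) \<le> (\<integral>\<omega>. cst (X \<omega>) (Y \<omega>) \<partial>N)"
    and "(\<integral>\<omega>. cst (X \<omega>) (Y \<omega>) \<partial>N) \<le> (\<integral>y. \<Phi> y \<partial>\<nu>) \<Longrightarrow> AE \<omega> in N. X \<omega> = T (Y \<omega>)"
proof -
  define F where "F = vimage_algebra (space N) X borel"
  interpret N: prob_space N by (rule N)
  interpret F: finite_measure_subalgebra N F unfolding F_def by (rule subalg)
  note ce = ce1[folded F_def] ce2[folded F_def]
  have XF: "X \<in> borel_measurable F" unfolding F_def by (rule measurable_vimage_algebra1) auto
  have XF12 [measurable]: "(\<lambda>\<omega>. fst (X \<omega>)) \<in> borel_measurable F" "(\<lambda>\<omega>. snd (X \<omega>)) \<in> borel_measurable F"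
    by (rule borel_measurable_fst_pair[OF XF], rule borel_measurable_snd_pair[OF XF])
  have sqY: "integrable N (\<lambda>\<omega>. (norm (Y \<omega>))\<^sup>2)" by (rule integrable_law[OF sq_integrable])
  note sqs = square_components_integrable[OF X sq] square_components_integrable[OF Y sqY]
  have prods: "integrable N (\<lambda>\<omega>. fst (X \<omega>) * snd (X \<omega>))" "integrable N (\<lambda>\<omega>. fst (X \<omega>) * snd (Y \<omega>))"
    "integrable N (\<lambda>\<omega>. snd (X \<omega>) * fst (Y \<omega>))" "integrable N (\<lambda>\<omega>. fst (Y \<omega>) * snd (Y \<omega>))"
    by (rule product_integrable_of_squares; (rule sqs | measurable))+
  have intY: "integrable N (\<lambda>\<omega>. fst (Y \<omega>))" "integrable N (\<lambda>\<omega>. snd (Y \<omega>))"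
    using integrable_law[OF component_integrable(1)] integrable_law[OF component_integrable(2)] by simp_all
  have \<Phi>int: "integrable N (\<lambda>\<omega>. \<Phi> (Y \<omega>))" by (rule integrable_law[OF phi_real_integrable])
  define P where "P \<omega> = fst (Y \<omega>) * snd (Y \<omega>) - \<Phi> (Y \<omega>)" for \<omega>
  have Pint: "integrable N P" unfolding P_def using prods(4) \<Phi>int by simp
  define h where "h = real_cond_exp N F P"
  have hint: "integrable N h" "(\<integral>\<omega>. h \<omega> \<partial>N) = (\<integral>\<omega>. P \<omega> \<partial>N)"
    unfolding h_def using F.real_cond_exp_int[OF Pint] by auto
  have affine: "AE \<omega> in N. fst x * snd (X \<omega>) + snd x * fst (X \<omega>) - fst x * snd x \<le> h \<omega>" if x: "x \<in> G" for x
  proof -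
    let ?a = "\<lambda>\<omega>. (fst x * snd (Y \<omega>) + snd x * fst (Y \<omega>)) - fst x * snd x"
    have "AE \<omega> in N. ?a \<omega> \<le> P \<omega>"
      using AE_law[OF AE_Phi]
    proof eventually_elim
      case (elim \<omega>)
      then have "\<Phi> (Y \<omega>) \<le> cst x (Y \<omega>)" using x by blast
      then show ?case unfolding P_def cst_def by (simp add: algebra_simps)
    qed
    then have "AE \<omega> in N. real_cond_exp N F ?a \<omega> \<le> h \<omega>"
      unfolding h_def using intY Pint by (intro F.real_cond_exp_mono) auto
    moreover have "AE \<omega> in N. real_cond_exp N F ?a \<omega> =
        real_cond_exp N F (\<lambda>\<omega>. fst x * snd (Y \<omega>) + snd x * fst (Y \<omega>)) \<omega> - real_cond_exp N F (\<lambda>\<omega>. fst x * snd x) \<omega>"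
      using intY by (intro F.real_cond_exp_diff) auto
    moreover have "AE \<omega> in N. real_cond_exp N F (\<lambda>\<omega>. fst x * snd (Y \<omega>) + snd x * fst (Y \<omega>)) \<omega> =
        real_cond_exp N F (\<lambda>\<omega>. fst x * snd (Y \<omega>)) \<omega> + real_cond_exp N F (\<lambda>\<omega>. snd x * fst (Y \<omega>)) \<omega>"
      using intY by (intro F.real_cond_exp_add) auto
    moreover have "AE \<omega> in N. real_cond_exp N F (\<lambda>\<omega>. fst x * snd (Y \<omega>)) \<omega> = fst x * real_cond_exp N F (\<lambda>\<omega>. snd (Y \<omega>)) \<omega>"
      using intY by (intro F.real_cond_exp_cmult) auto
    moreover have "AE \<omega> in N. real_cond_exp N F (\<lambda>\<omega>. snd x * fst (Y \<omega>)) \<omega> = snd x * real_cond_exp N F (\<lambda>\<omega>. fst (Y \<omega>)) \<omega>"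
      using intY by (intro F.real_cond_exp_cmult) auto
    moreover have "AE \<omega> in N. real_cond_exp N F (\<lambda>\<omega>. fst x * snd x) \<omega> = fst x * snd x"
      by (intro F.real_cond_exp_F_meas) auto
    ultimately show ?thesis using ce by eventually_elim simp
  qed
  have "AE \<omega> in N. \<forall>q\<in>\<rat>. fst (g q) * snd (X \<omega>) + snd (g q) * fst (X \<omega>) - fst (g q) * snd (g q) \<le> h \<omega>"
    using affine by (simp add: AE_ball_countable countable_rat)
  then have all: "AE \<omega> in N. \<forall>x\<in>G. fst x * snd (X \<omega>) + snd x * fst (X \<omega>) - fst x * snd x \<le> h \<omega>"
    by eventually_elim (use affine_le_all in blast)
  \<comment> \<open>A point x of \<open>G\<close> with c(x, X) \<le> 0 has an affine function whose
    value at X is at least X1 X2.\<close>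
  have ge: "AE \<omega> in N. 0 \<le> h \<omega> - fst (X \<omega>) * snd (X \<omega>)"
    using all
  proof eventually_elim
    case (elim \<omega>)
    obtain x where x: "x \<in> G" "cst x (X \<omega>) \<le> 0" using ex_cst_nonpos by blast
    then have "fst x * snd (X \<omega>) + snd x * fst (X \<omega>) - fst x * snd x \<le> h \<omega>" using elim by blast
    then show ?case using x(2) unfolding cst_def by (simp add: algebra_simps)
  qed
  \<comment> \<open>Conditioning on X replaces Y by X in both mixed terms, so that E[c(X, Y)] =
    E[Y1 Y2] - E[X1 X2].\<close>
  have "(\<integral>\<omega>. fst (X \<omega>) * snd (Y \<omega>) \<partial>N) = (\<integral>\<omega>. fst (X \<omega>) * real_cond_exp N F (\<lambda>\<omega>. snd (Y \<omega>)) \<omega> \<partial>N)"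
    by (rule F.real_cond_exp_intg(2)[symmetric, OF prods(2)]) measurable
  also have "\<dots> = (\<integral>\<omega>. fst (X \<omega>) * snd (X \<omega>) \<partial>N)"
    using ce(2) by (intro integral_cong_AE) (auto elim: eventually_mono)
  finally have e1: "(\<integral>\<omega>. fst (X \<omega>) * snd (Y \<omega>) \<partial>N) = (\<integral>\<omega>. fst (X \<omega>) * snd (X \<omega>) \<partial>N)" .
  have "(\<integral>\<omega>. snd (X \<omega>) * fst (Y \<omega>) \<partial>N) = (\<integral>\<omega>. snd (X \<omega>) * real_cond_exp N F (\<lambda>\<omega>. fst (Y \<omega>)) \<omega> \<partial>N)"
    by (rule F.real_cond_exp_intg(2)[symmetric, OF prods(3)]) measurable
  also have "\<dots> = (\<integral>\<omega>. fst (X \<omega>) * snd (X \<omega>) \<partial>N)"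
    using ce(1) by (intro integral_cong_AE) (auto elim!: eventually_mono)
  finally have e2: "(\<integral>\<omega>. snd (X \<omega>) * fst (Y \<omega>) \<partial>N) = (\<integral>\<omega>. fst (X \<omega>) * snd (X \<omega>) \<partial>N)" .
  have cst_eq: "cst (X \<omega>) (Y \<omega>) = fst (X \<omega>) * snd (X \<omega>) - fst (X \<omega>) * snd (Y \<omega>) - snd (X \<omega>) * fst (Y \<omega>) + fst (Y \<omega>) * snd (Y \<omega>)" for \<omega>
    unfolding cst_def by (simp add: algebra_simps)
  have cint: "integrable N (\<lambda>\<omega>. cst (X \<omega>) (Y \<omega>))" unfolding cst_eq using prods by simp
  have "(\<integral>\<omega>. cst (X \<omega>) (Y \<omega>) \<partial>N) = (\<integral>\<omega>. fst (Y \<omega>) * snd (Y \<omega>) \<partial>N) - (\<integral>\<omega>. fst (X \<omega>) * snd (X \<omega>) \<partial>N)"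
    unfolding cst_eq using prods e1 e2 by simp
  moreover have "(\<integral>\<omega>. P \<omega> \<partial>N) = (\<integral>\<omega>. fst (Y \<omega>) * snd (Y \<omega>) \<partial>N) - (\<integral>y. \<Phi> y \<partial>\<nu>)"
    unfolding P_def using prods(4) \<Phi>int integral_law[of \<Phi>] by simp
  \<comment> \<open>The duality gap is thus the integral of the nonnegative variable h - X1
    X2.\<close>
  ultimately have gap: "(\<integral>\<omega>. h \<omega> - fst (X \<omega>) * snd (X \<omega>) \<partial>N) = (\<integral>\<omega>. cst (X \<omega>) (Y \<omega>) \<partial>N) - (\<integral>y. \<Phi> y \<partial>\<nu>)"
    using hint prods(1) by simp
  have "(\<integral>\<omega>. h \<omega> - fst (X \<omega>) * snd (X \<omega>) \<partial>N) \<ge> 0" by (rule integral_nonneg_AE[OF ge])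
  then show le: "(\<integral>y. \<Phi> y \<partial>\<nu>) \<le> (\<integral>\<omega>. cst (X \<omega>) (Y \<omega>) \<partial>N)" using gap by simp
  assume "(\<integral>\<omega>. cst (X \<omega>) (Y \<omega>) \<partial>N) \<le> (\<integral>y. \<Phi> y \<partial>\<nu>)"
  then have eq: "(\<integral>\<omega>. cst (X \<omega>) (Y \<omega>) \<partial>N) = (\<integral>y. \<Phi> y \<partial>\<nu>)" using le by simp
  have "integrable N (\<lambda>\<omega>. h \<omega> - fst (X \<omega>) * snd (X \<omega>))" using hint prods(1) by simp
  then have "AE \<omega> in N. h \<omega> - fst (X \<omega>) * snd (X \<omega>) = 0"
    using integral_nonneg_eq_0_iff_AE[OF _ ge] gap eq by simp
  with all have XG: "AE \<omega> in N. X \<omega> \<in> G"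
  proof eventually_elim
    case (elim \<omega>)
    have "cst (X \<omega>) x \<ge> 0" if "x \<in> G" for x
      using elim that unfolding cst_def by (fastforce simp: algebra_simps)
    then show ?case using mem_iff by blast
  qed
  \<comment> \<open>Lying in \<open>G\<close> does not yet make X a minimizer for Y; a second
    vanishing integral of a nonnegative variable gives c(X, Y) = \<phi>(Y).\<close>
  have ge2: "AE \<omega> in N. 0 \<le> cst (X \<omega>) (Y \<omega>) - \<Phi> (Y \<omega>)"
    using XG AE_law[OF AE_Phi] by eventually_elim auto
  have "integrable N (\<lambda>\<omega>. cst (X \<omega>) (Y \<omega>) - \<Phi> (Y \<omega>))" using cint \<Phi>int by simp
  moreover have "(\<integral>\<omega>. cst (X \<omega>) (Y \<omega>) - \<Phi> (Y \<omega>) \<partial>N) = 0"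
    using cint \<Phi>int eq integral_law[of \<Phi>] by simp
  ultimately have "AE \<omega> in N. cst (X \<omega>) (Y \<omega>) - \<Phi> (Y \<omega>) = 0"
    using integral_nonneg_eq_0_iff_AE[OF _ ge2] by simp
  with XG AE_law[OF AE_Phi] AE_law[OF AE_argm] show "AE \<omega> in N. X \<omega> = T (Y \<omega>)"
  proof eventually_elim
    case (elim \<omega>)
    then have "argm (Y \<omega>) (X \<omega>)" unfolding argm_def by auto
    then show ?case using elim by blast
  qed
qed

end

end

theorem theorem5:
  fixes M :: "'a measure" and Y :: "'a \<Rightarrow> pt" and G :: "pt set"
  assumes "prob_space M"
    and "Y \<in> borel_measurable M"
    and "integrable M (\<lambda>\<omega>. (norm (Y \<omega>))\<^sup>2)"
    and "D_regular (distr M borel Y)"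
    and "atomless (distr M borel (\<lambda>\<omega>. fst (Y \<omega>)))"
    and "atomless (distr M borel (\<lambda>\<omega>. snd (Y \<omega>)))"
    and "maximal_monotone G"
    and "\<forall>H. maximal_monotone H \<longrightarrow> int_phi (distr M borel Y) H \<le> int_phi (distr M borel Y) G"
  shows "(AE \<omega> in M. Y \<omega> \<in> dom_grad (phiG G))
    \<and> (\<lambda>\<omega>. Dc (phiG G) (Y \<omega>)) \<in> admissible_maps M Y
    \<and> (\<forall>X' \<in> admissible_maps M Y.
          (\<integral>\<omega>. cst (Dc (phiG G) (Y \<omega>)) (Y \<omega>) \<partial>M) \<le> (\<integral>\<omega>. cst (X' \<omega>) (Y \<omega>) \<partial>M))
    \<and> (\<forall>X' \<in> admissible_maps M Y.
          (\<integral>\<omega>. cst (X' \<omega>) (Y \<omega>) \<partial>M) \<le> (\<integral>\<omega>. cst (Dc (phiG G) (Y \<omega>)) (Y \<omega>) \<partial>M)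
          \<longrightarrow> (AE \<omega> in M. X' \<omega> = Dc (phiG G) (Y \<omega>)))
    \<and> distr M borel (\<lambda>\<omega>. (Dc (phiG G) (Y \<omega>), Y \<omega>)) \<in> admissible_plans (distr M borel Y)
    \<and> (\<forall>\<gamma> \<in> admissible_plans (distr M borel Y).
          (\<integral>p. cst (fst p) (snd p) \<partial>(distr M borel (\<lambda>\<omega>. (Dc (phiG G) (Y \<omega>), Y \<omega>))))
            \<le> (\<integral>p. cst (fst p) (snd p) \<partial>\<gamma>))
    \<and> (\<forall>\<gamma> \<in> admissible_plans (distr M borel Y).
          (\<integral>p. cst (fst p) (snd p) \<partial>\<gamma>)
            \<le> (\<integral>p. cst (fst p) (snd p) \<partial>(distr M borel (\<lambda>\<omega>. (Dc (phiG G) (Y \<omega>), Y \<omega>))))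
          \<longrightarrow> \<gamma> = distr M borel (\<lambda>\<omega>. (Dc (phiG G) (Y \<omega>), Y \<omega>)))
    \<and> D_regular (distr M borel (\<lambda>\<omega>. Dc (phiG G) (Y \<omega>)))
    \<and> atomless (distr M borel (\<lambda>\<omega>. fst (Dc (phiG G) (Y \<omega>))))
    \<and> atomless (distr M borel (\<lambda>\<omega>. snd (Dc (phiG G) (Y \<omega>))))"
proof -
  let ?\<nu> = "distr M borel Y"
  interpret M: prob_space M by fact
  note Y [measurable] = assms(2)
  have prob: "prob_space ?\<nu>" by (rule M.prob_space_distr) simp
  have closed_lines: "{y :: pt. fst y = t} \<in> sets borel" "{y :: pt. snd y = t} \<in> sets borel" for t
    by (auto intro!: borel_closed closed_Collect_eq continuous_intros)
  have null: "emeasure ?\<nu> {y. fst y = t} = 0" "emeasure ?\<nu> {y. snd y = t} = 0" for t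
  proof -
    have "emeasure ?\<nu> {y. fst y = t} = emeasure (distr M borel (\<lambda>\<omega>. fst (Y \<omega>))) {t}"
      "emeasure ?\<nu> {y. snd y = t} = emeasure (distr M borel (\<lambda>\<omega>. snd (Y \<omega>))) {t}"
      using closed_lines[of t] by (simp_all add: emeasure_distr vimage_def)
    then show "emeasure ?\<nu> {y. fst y = t} = 0" "emeasure ?\<nu> {y. snd y = t} = 0"
      using assms(5,6) unfolding atomless_def by simp_all
  qed
  interpret dual_maximizer G ?\<nu>
  proof (intro dual_maximizer.intro dual_maximizer_axioms.intro max_monotone.intro prob)
    show "maximal_monotone G" by fact
    show "integrable ?\<nu> (\<lambda>y. (norm y)\<^sup>2)" using assms(3) by (simp add: integrable_distr_eq)
    show "D_regular ?\<nu>" by fact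
    show "int_phi ?\<nu> H \<le> int_phi ?\<nu> G" if "maximal_monotone H" for H using assms(8) that by blast
  qed (simp_all add: null)
  let ?X = "\<lambda>\<omega>. T (Y \<omega>)"
  let ?\<gamma> = "distr M borel (\<lambda>\<omega>. (?X \<omega>, Y \<omega>))"
  have X [measurable]: "?X \<in> borel_measurable M" by measurable
  have pair [measurable]: "(\<lambda>\<omega>. (?X \<omega>, Y \<omega>)) \<in> borel_measurable M" by measurable
  note law_M = assms(1) X Y refl
  have dom: "AE \<omega> in M. Y \<omega> \<in> dom_grad (phiG G)"
    using AE_law[OF law_M AE_uniq] by eventually_elim (rule uniq_dom_grad(1))
  have sqT: "integrable ?\<nu> (\<lambda>y. (norm (T y))\<^sup>2)"
    using T_square_integrable by (simp add: norm_prod_def)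
  then have sqX: "integrable M (\<lambda>\<omega>. (norm (?X \<omega>))\<^sup>2)"
    by (rule integrable_law[OF law_M])
  have X_adm: "?X \<in> admissible_maps M Y"
    unfolding admissible_maps_def
  proof (intro CollectI conjI X sqX)
    have "Y \<in> measurable (vimage_algebra (space M) Y borel) borel"
      by (rule measurable_vimage_algebra1) auto
    then show "?X \<in> borel_measurable (vimage_algebra (space M) Y borel)"
      by (rule measurable_compose) (rule T_measurable(2))
  qed (rule cond_exp_of_map[OF assms(1) X Y refl], simp)+
  have map_opt: "\<forall>X' \<in> admissible_maps M Y.
      (\<integral>\<omega>. cst (?X \<omega>) (Y \<omega>) \<partial>M) \<le> (\<integral>\<omega>. cst (X' \<omega>) (Y \<omega>) \<partial>M)"
    unfolding integral_of_map[OF law_M] admissible_maps_def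
    by (auto intro!: weak_duality(1)[OF assms(1) _ Y refl])
  have map_unique: "\<forall>X' \<in> admissible_maps M Y.
      (\<integral>\<omega>. cst (X' \<omega>) (Y \<omega>) \<partial>M) \<le> (\<integral>\<omega>. cst (?X \<omega>) (Y \<omega>) \<partial>M) \<longrightarrow> (AE \<omega> in M. X' \<omega> = ?X \<omega>)"
    unfolding integral_of_map[OF law_M] admissible_maps_def
    using weak_duality(2)[OF assms(1) _ Y refl] by blast
  have plan_adm: "?\<gamma> \<in> admissible_plans ?\<nu>"
  proof -
    have g: "prob_space ?\<gamma>" by (rule M.prob_space_distr) simp
    have meas: "fst \<in> borel_measurable ?\<gamma>" "snd \<in> borel_measurable ?\<gamma>" by measurable
    have snd_law: "distr ?\<gamma> borel snd = ?\<nu>" by (simp add: distr_distr comp_def)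
    have "{p :: pt \<times> pt. fst p = T (snd p)} \<in> sets borel" 
    proof -
      have "{p \<in> space borel. fst p = T (snd p)} \<in> sets (borel :: (pt \<times> pt) measure)" by measurable
      then show ?thesis by simp
    qed
    then have "AE p in ?\<gamma>. fst p = T (snd p)" by (subst AE_distr_iff) auto
    \<comment> \<open>Here the plan itself is the probability space and the two projections are X
      and Y.\<close>
    note ce = cond_exp_of_map[OF g meas snd_law this]
    have "integrable ?\<gamma> (\<lambda>p. (norm (fst p))\<^sup>2 + (norm (snd p))\<^sup>2)"
      using sqX assms(3) by (subst integrable_distr_eq) auto
    then show ?thesis unfolding admissible_plans_def using g snd_law ce by simp
  qed
  have cost: "(\<integral>p. cst (fst p) (snd p) \<partial>?\<gamma>) = (\<integral>y. \<Phi> y \<partial>?\<nu>)"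
  proof -
    have "(\<lambda>p. cst (fst p) (snd p)) \<in> borel_measurable (borel :: (pt \<times> pt) measure)"
      unfolding cst_def by measurable
    then have "(\<integral>p. cst (fst p) (snd p) \<partial>?\<gamma>) = (\<integral>\<omega>. cst (?X \<omega>) (Y \<omega>) \<partial>M)"
      by (subst integral_distr) auto
    then show ?thesis using integral_of_map[OF law_M] by simp
  qed
  have plan: "(\<integral>y. \<Phi> y \<partial>?\<nu>) \<le> (\<integral>p. cst (fst p) (snd p) \<partial>\<gamma>)"
    "(\<integral>p. cst (fst p) (snd p) \<partial>\<gamma>) \<le> (\<integral>y. \<Phi> y \<partial>?\<nu>) \<Longrightarrow> \<gamma> = ?\<gamma>"
    if "\<gamma> \<in> admissible_plans ?\<nu>" for \<gamma>
  proof -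
    from that have g: "prob_space \<gamma>" and s [measurable_cong]: "sets \<gamma> = sets borel"
      and i: "integrable \<gamma> (\<lambda>p. (norm (fst p))\<^sup>2 + (norm (snd p))\<^sup>2)" and l: "distr \<gamma> borel snd = ?\<nu>"
      and ce: "AE p in \<gamma>. real_cond_exp \<gamma> (vimage_algebra (space \<gamma>) fst borel) (\<lambda>p. fst (snd p)) p = fst (fst p)"
        "AE p in \<gamma>. real_cond_exp \<gamma> (vimage_algebra (space \<gamma>) fst borel) (\<lambda>p. snd (snd p)) p = snd (fst p)"
      unfolding admissible_plans_def by auto
    have meas [measurable]: "fst \<in> borel_measurable \<gamma>" "snd \<in> borel_measurable \<gamma>" by measurable
    have sq: "integrable \<gamma> (\<lambda>p. (norm (fst p))\<^sup>2)"
      by (rule Bochner_Integration.integrable_bound[OF i]) auto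
    note duality = weak_duality[OF g meas l sq ce]
    show "(\<integral>y. \<Phi> y \<partial>?\<nu>) \<le> (\<integral>p. cst (fst p) (snd p) \<partial>\<gamma>)" by (rule duality(1))
    assume "(\<integral>p. cst (fst p) (snd p) \<partial>\<gamma>) \<le> (\<integral>y. \<Phi> y \<partial>?\<nu>)"
    then have AE: "AE p in \<gamma>. fst p = T (snd p)" by (rule duality(2))
    \<comment> \<open>Concentration on the graph of \<open>T\<close> makes \<gamma> the image of its
      second marginal under y \<mapsto> (T y, y), which determines it.\<close>
    have "\<gamma> = distr \<gamma> borel (\<lambda>p. p)" using s by (simp add: distr_id2)
    also have "\<dots> = distr \<gamma> borel (\<lambda>p. (T (snd p), snd p))"
      by (rule distr_cong_AE) (use AE in \<open>auto elim!: eventually_mono simp: prod_eq_iff\<close>)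
    also have "\<dots> = distr (distr \<gamma> borel snd) borel (\<lambda>y. (T y, y))"
      by (subst distr_distr) (auto simp: comp_def)
    also have "\<dots> = ?\<gamma>" unfolding l by (subst distr_distr) (auto simp: comp_def)
    finally show "\<gamma> = ?\<gamma>" .
  qed
  have D_reg: "D_regular (distr M borel ?X)"
    unfolding D_regular_def
  proof
    fix D assume D: "D \<in> D_family"
    then have [measurable]: "D \<in> sets borel" using D_family_closed by auto
    have "AE \<omega> in M. ?X \<omega> \<notin> D" by (rule AE_law[OF law_M AE_T_notin_D[OF D]])
    then have "emeasure M (?X -` D \<inter> space M) = 0" by (intro AE_iff_measurable[THEN iffD1]) auto
    then show "emeasure (distr M borel ?X) D = 0" by (simp add: emeasure_distr)
  qed
  have atom: "atomless (distr M borel f)"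
    if [measurable]: "f \<in> borel_measurable M" and neq: "\<And>t. AE \<omega> in M. f \<omega> \<noteq> t" for f :: "'a \<Rightarrow> real"
    unfolding atomless_def
  proof
    fix t
    have "emeasure M (f -` {t} \<inter> space M) = 0"
      using neq[of t] by (intro AE_iff_measurable[THEN iffD1]) auto
    then show "emeasure (distr M borel f) {t} = 0" by (simp add: emeasure_distr)
  qed
  have atoms: "atomless (distr M borel (\<lambda>\<omega>. fst (?X \<omega>)))" "atomless (distr M borel (\<lambda>\<omega>. snd (?X \<omega>)))"
    using AE_law[OF law_M AE_fst_T_neq] AE_law[OF law_M AE_snd_T_neq] by (auto intro!: atom)
  have plan_opt: "\<forall>\<gamma> \<in> admissible_plans ?\<nu>. (\<integral>p. cst (fst p) (snd p) \<partial>?\<gamma>) \<le> (\<integral>p. cst (fst p) (snd p) \<partial>\<gamma>)"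
    unfolding cost using plan(1) by blast
  have plan_unique: "\<forall>\<gamma> \<in> admissible_plans ?\<nu>.
      (\<integral>p. cst (fst p) (snd p) \<partial>\<gamma>) \<le> (\<integral>p. cst (fst p) (snd p) \<partial>?\<gamma>) \<longrightarrow> \<gamma> = ?\<gamma>"
    unfolding cost using plan(2) by blast
  show ?thesis
    by (intro conjI dom X_adm map_opt map_unique plan_adm plan_opt plan_unique D_reg atoms)
qed

end
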